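(* There is a natural structure of a $|G|$-valued topological group on $S^3$, determined by $G$, for each $G$ from the list $\{D_2,D_4,D_6,T,O,I\}$. There is a natural structure of a $|G|$-valued topological group on $\mathbb{R}P^3$, determined by $G$, for each $G$ from the list $\{C_2,C_3,C_4,C_6,D_3\}$. (Here the natural structure determined by $G$ is the bicoset structure on $G\backslash\mathrm{SO}(3)/G$, transported along a homeomorphism of $G\backslash\mathrm{SO}(3)/G$ with $S^3$, respectively with $\mathbb{R}P^3$.)
   Context: Groups (finite subgroups of $\mathrm{SO}(3)$, specified up to conjugacy): $C_n$ is generated by an axial rotation of order $n$; $D_n$ (order $2n$) is generated by an axial rotation of order $n$ and a rotation of order $2$ about an axis orthogonal to the first axis; $T,O,I$ are the groups of orientation-preserving (rotational) symmetries of a regular tetrahedron, octahedron, icosahedron respectively. $|G|$ is the order of $G$. For a topological space $X$, let $\mathrm{Sym}^n X=X^n/\Sigma_n$ be its $n$-th symmetric power, whose elements are $n$-multisets $[x_1,\ldots,x_n]$. An $n$-valued topological group structure on $X$ consists of a continuous map $*\colon X\times X\to\mathrm{Sym}^nX$, $x*y=[z_1,\ldots,z_n]$, a unit $e\in X$ and a continuous map $\mathrm{inv}\colon X\to X$ such that: (associativity) for all $x,y,z$, the $n^2$-multisets obtained from $[x*w_1,\ldots,x*w_n]$ with $y*z=[w_1,\ldots,w_n]$ and from $[v_1*z,\ldots,v_n*z]$ with $x*y=[v_1,\ldots,v_n]$ coincide; (unit) $e*x=x*e=[x,\ldots,x]$ for all $x$; (inverse) $e\in \mathrm{inv}(x)*x$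 and $e\in x*\mathrm{inv}(x)$ for all $x$. For a finite subgroup $\Gamma$ of a Lie group $W$, the bicoset space $\Gamma\backslash W/\Gamma$ has a natural $|\Gamma|$-valued topological group structure, called the bicoset structure: the product of the classes of $x,y\in W$ is the multiset of the classes of $x\gamma y$, $\gamma\in\Gamma$; the unit is the class of the identity of $W$; the inverse of the class of $x$ is the class of $x^{-1}$. *)

theory Defs
  imports
    "HOL-Analysis.Analysis"
    "HOL-Library.Multiset"
    "HOL-Algebra.Multiplicative_Group"
    "HOL-Algebra.Generated_Groups"
begin

section \<open>Quotient topologies\<close>

definition quotient_topology :: "'a topology \<Rightarrow> ('a \<Rightarrow> 'b) \<Rightarrow> 'b topology" where
  "quotient_topology X q =
     topology (\<lambda>U. U \<subseteq> q ` topspace X \<and> openin X {x \<in> topspace X. q x \<in> U})"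

lemma openin_quotient_topology:
  "openin (quotient_topology X q) U \<longleftrightarrow>
     U \<subseteq> q ` topspace X \<and> openin X {x \<in> topspace X. q x \<in> U}"
proof -
  have "istopology (\<lambda>U. U \<subseteq> q ` topspace X \<and> openin X {x \<in> topspace X. q x \<in> U})"
    unfolding istopology_def
  proof (intro conjI allI impI)
    fix S T
    assume S: "S \<subseteq> q ` topspace X \<and> openin X {x \<in> topspace X. q x \<in> S}"
      and T: "T \<subseteq> q ` topspace X \<and> openin X {x \<in> topspace X. q x \<in> T}"
    show "S \<inter> T \<subseteq> q ` topspace X" using S by blast
    have "{x \<in> topspace X. q x \<in> S \<inter> T} =
        {x \<in> topspace X. q x \<in> S} \<inter> {x \<in> topspace X. q x \<in> T}" by blast
    then show "openin X {x \<in> topspace X. q x \<in> S \<inter> T}" using S T by auto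
  next
    fix \<K>
    assume K: "\<forall>K\<in>\<K>. K \<subseteq> q ` topspace X \<and> openin X {x \<in> topspace X. q x \<in> K}"
    show "\<Union>\<K> \<subseteq> q ` topspace X" using K by blast
    have "{x \<in> topspace X. q x \<in> \<Union>\<K>} = (\<Union>K\<in>\<K>. {x \<in> topspace X. q x \<in> K})" by blast
    then show "openin X {x \<in> topspace X. q x \<in> \<Union>\<K>}" using K by auto
  qed
  then show ?thesis unfolding quotient_topology_def by (simp add: topology_inverse')
qed

lemma topspace_quotient_topology: "topspace (quotient_topology X q) = q ` topspace X"
proof
  show "topspace (quotient_topology X q) \<subseteq> q ` topspace X"
    using openin_quotient_topology[THEN iffD1, OF openin_topspace] by (rule conjunct1)
  have "{x \<in> topspace X. q x \<in> q ` topspace X} = topspace X" by blast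
  then have "openin (quotient_topology X q) (q ` topspace X)"
    by (simp add: openin_quotient_topology)
  then show "q ` topspace X \<subseteq> topspace (quotient_topology X q)" by (rule openin_subset)
qed

lemma quotient_map_quotient_topology: "quotient_map X (quotient_topology X q) q"
  by (simp add: quotient_map_def topspace_quotient_topology openin_quotient_topology)


section \<open>Symmetric powers and multivalued groups\<close>

text \<open>A point of $X^n$ is a function on the index set; its orbit under permutations of the
  indices is identified with the multiset of its values.\<close>

definition symmetric_power :: "nat \<Rightarrow> 'a topology \<Rightarrow> 'a multiset topology" where
  "symmetric_power n X =
     quotient_topology (product_topology (\<lambda>_. X) {..<n}) (\<lambda>x. image_mset x (mset_set {..<n}))"

record 'a multivalued_structure =
  mv_mult :: "'a \<Rightarrow> 'a \<Rightarrow> 'a multiset"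
  mv_unit :: 'a
  mv_inv :: "'a \<Rightarrow> 'a"

definition multivalued_topological_group ::
    "nat \<Rightarrow> 'a topology \<Rightarrow> 'a multivalued_structure \<Rightarrow> bool" where
  "multivalued_topological_group n X S \<longleftrightarrow>
     continuous_map (prod_topology X X) (symmetric_power n X) (\<lambda>(x, y). mv_mult S x y) \<and>
     mv_unit S \<in> topspace X \<and>
     continuous_map X X (mv_inv S) \<and>
     (\<forall>x\<in>topspace X. \<forall>y\<in>topspace X. \<forall>z\<in>topspace X.
        (\<Sum>w\<in>#mv_mult S y z. mv_mult S x w) = (\<Sum>v\<in>#mv_mult S x y. mv_mult S v z)) \<and>
     (\<forall>x\<in>topspace X.
        mv_mult S (mv_unit S) x = replicate_mset n x \<and>
        mv_mult S x (mv_unit S) = replicate_mset n x) \<and>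
     (\<forall>x\<in>topspace X.
        mv_unit S \<in># mv_mult S (mv_inv S x) x \<and>
        mv_unit S \<in># mv_mult S x (mv_inv S x))"

text \<open>For \<open>h\<close> a homeomorphism defined on \<open>X\<close>, this determines \<open>S'\<close> on the image of \<open>h\<close>.\<close>

definition transported_structure ::
    "'a topology \<Rightarrow> ('a \<Rightarrow> 'b) \<Rightarrow> 'a multivalued_structure \<Rightarrow> 'b multivalued_structure \<Rightarrow> bool" where
  "transported_structure X h S S' \<longleftrightarrow>
     (\<forall>a\<in>topspace X. \<forall>b\<in>topspace X.
        mv_mult S' (h a) (h b) = image_mset h (mv_mult S a b)) \<and>
     mv_unit S' = h (mv_unit S) \<and>
     (\<forall>a\<in>topspace X. mv_inv S' (h a) = h (mv_inv S a))"


section \<open>Bicosets\<close>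

definition bicoset :: "('a, 'b) monoid_scheme \<Rightarrow> 'a set \<Rightarrow> 'a \<Rightarrow> 'a set" where
  "bicoset W \<Gamma> x = {g \<otimes>\<^bsub>W\<^esub> x \<otimes>\<^bsub>W\<^esub> h |g h. g \<in> \<Gamma> \<and> h \<in> \<Gamma>}"

text \<open>Here \<open>T\<close> is the topology of \<open>W\<close>, with \<open>carrier W\<close> as its set of points.\<close>

definition bicoset_space ::
    "('a, 'b) monoid_scheme \<Rightarrow> 'a topology \<Rightarrow> 'a set \<Rightarrow> 'a set topology" where
  "bicoset_space W T \<Gamma> = quotient_topology T (bicoset W \<Gamma>)"

text \<open>The structure is described on representatives; since the equations are required for all
  representatives, satisfying them includes that the operations are well defined on bicosets.
  They determine \<open>S\<close> on all bicosets.\<close>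

definition bicoset_structure ::
    "('a, 'b) monoid_scheme \<Rightarrow> 'a set \<Rightarrow> 'a set multivalued_structure \<Rightarrow> bool" where
  "bicoset_structure W \<Gamma> S \<longleftrightarrow>
     (\<forall>x\<in>carrier W. \<forall>y\<in>carrier W.
        mv_mult S (bicoset W \<Gamma> x) (bicoset W \<Gamma> y) =
          image_mset (\<lambda>\<gamma>. bicoset W \<Gamma> (x \<otimes>\<^bsub>W\<^esub> \<gamma> \<otimes>\<^bsub>W\<^esub> y)) (mset_set \<Gamma>)) \<and>
     mv_unit S = bicoset W \<Gamma> \<one>\<^bsub>W\<^esub> \<and>
     (\<forall>x\<in>carrier W. mv_inv S (bicoset W \<Gamma> x) = bicoset W \<Gamma> (inv\<^bsub>W\<^esub> x))"


section \<open>The rotation group and its finite subgroups\<close>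

definition SO3 :: "(real^3^3) monoid" where
  "SO3 = \<lparr>carrier = {A. rotation_matrix A}, monoid.mult = (**), one = mat 1\<rparr>"

lemma group_SO3: "group SO3"
proof (rule groupI)
  show "\<one>\<^bsub>SO3\<^esub> \<in> carrier SO3"
    by (simp add: SO3_def rotation_matrix_def orthogonal_matrix_id)
next
  fix A assume "A \<in> carrier SO3"
  then have A: "orthogonal_matrix A" "det A = 1" by (simp_all add: SO3_def rotation_matrix_def)
  have "transpose A \<in> carrier SO3"
    using A by (simp add: SO3_def rotation_matrix_def orthogonal_matrix_transpose)
  moreover have "transpose A \<otimes>\<^bsub>SO3\<^esub> A = \<one>\<^bsub>SO3\<^esub>"
    using A by (simp add: SO3_def orthogonal_matrix_def)
  ultimately show "\<exists>B\<in>carrier SO3. B \<otimes>\<^bsub>SO3\<^esub> A = \<one>\<^bsub>SO3\<^esub>" by blast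
next
  fix A B assume "A \<in> carrier SO3" "B \<in> carrier SO3"
  then show "A \<otimes>\<^bsub>SO3\<^esub> B \<in> carrier SO3"
    by (simp add: SO3_def rotation_matrix_def orthogonal_matrix_mul det_mul)
next
  fix A B C :: "real^3^3"
  show "A \<otimes>\<^bsub>SO3\<^esub> B \<otimes>\<^bsub>SO3\<^esub> C = A \<otimes>\<^bsub>SO3\<^esub> (B \<otimes>\<^bsub>SO3\<^esub> C)"
    by (simp add: SO3_def matrix_mul_assoc)
next
  fix A :: "real^3^3"
  show "\<one>\<^bsub>SO3\<^esub> \<otimes>\<^bsub>SO3\<^esub> A = A" by (simp add: SO3_def)
qed

definition SO3_topology :: "(real^3^3) topology" where
  "SO3_topology = top_of_set (carrier SO3)"

definition axial_rotation :: "real^3 \<Rightarrow> nat \<Rightarrow> real^3^3 \<Rightarrow> bool" where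
  "axial_rotation v n A \<longleftrightarrow> v \<noteq> 0 \<and> A \<in> carrier SO3 \<and> A *v v = v \<and> group.ord SO3 A = n"

definition cyclic_rotation_group :: "nat \<Rightarrow> (real^3^3) set \<Rightarrow> bool" where
  "cyclic_rotation_group n G \<longleftrightarrow> (\<exists>v A. axial_rotation v n A \<and> G = generate SO3 {A})"

definition dihedral_rotation_group :: "nat \<Rightarrow> (real^3^3) set \<Rightarrow> bool" where
  "dihedral_rotation_group n G \<longleftrightarrow>
     (\<exists>v w A B. axial_rotation v n A \<and> axial_rotation w 2 B \<and> v \<bullet> w = 0 \<and>
        G = generate SO3 {A, B})"

definition rotational_symmetries :: "(real^3) set \<Rightarrow> (real^3^3) set" where
  "rotational_symmetries P = {A \<in> carrier SO3. (\<lambda>x. A *v x) ` P = P}"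

definition conjugate_in :: "('a, 'b) monoid_scheme \<Rightarrow> 'a set \<Rightarrow> 'a set \<Rightarrow> bool" where
  "conjugate_in W H G \<longleftrightarrow>
     (\<exists>Q\<in>carrier W. G = (\<lambda>A. Q \<otimes>\<^bsub>W\<^esub> A \<otimes>\<^bsub>W\<^esub> inv\<^bsub>W\<^esub> Q) ` H)"

text \<open>Standard regular solids centred at the origin. Any other regular solid of the same type
  centred at the origin is the image of the standard one under a rotation and a scaling, so its
  rotation group is conjugate in \<^const>\<open>SO3\<close> to that of the standard one.\<close>

definition regular_tetrahedron :: "(real^3) set" where
  "regular_tetrahedron =
     convex hull {vector [1, 1, 1], vector [1, -1, -1], vector [-1, 1, -1], vector [-1, -1, 1]}"

definition regular_octahedron :: "(real^3) set" where
  "regular_octahedron =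
     convex hull {vector [1, 0, 0], vector [-1, 0, 0], vector [0, 1, 0], vector [0, -1, 0],
                  vector [0, 0, 1], vector [0, 0, -1]}"

definition golden_ratio :: real where
  "golden_ratio = (1 + sqrt 5) / 2"

definition regular_icosahedron :: "(real^3) set" where
  "regular_icosahedron =
     convex hull (\<Union>s\<in>{1, -1}. \<Union>t\<in>{golden_ratio, - golden_ratio}.
       {vector [0, s, t], vector [s, t, 0], vector [t, 0, s]})"

definition tetrahedral_rotation_group :: "(real^3^3) set \<Rightarrow> bool" where
  "tetrahedral_rotation_group = conjugate_in SO3 (rotational_symmetries regular_tetrahedron)"

definition octahedral_rotation_group :: "(real^3^3) set \<Rightarrow> bool" where
  "octahedral_rotation_group = conjugate_in SO3 (rotational_symmetries regular_octahedron)"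

definition icosahedral_rotation_group :: "(real^3^3) set \<Rightarrow> bool" where
  "icosahedral_rotation_group = conjugate_in SO3 (rotational_symmetries regular_icosahedron)"


section \<open>The 3-sphere and real projective 3-space\<close>

definition S3 :: "(real^4) topology" where
  "S3 = top_of_set (sphere 0 1)"

definition RP3 :: "(real^4) set topology" where
  "RP3 = quotient_topology S3 (\<lambda>x. {x, - x})"


text \<open>\<open>M\<close> is the bicoset structure of \<open>G\<close>, and \<open>h\<close> the homeomorphism along which it is
  transported to \<open>N\<close> on \<open>X\<close>.\<close>

definition carries_bicoset_structure :: "'a topology \<Rightarrow> (real^3^3) set \<Rightarrow> bool" where
  "carries_bicoset_structure X G \<longleftrightarrow>
     (\<exists>M h N.
        bicoset_structure SO3 G M \<and>
        multivalued_topological_group (card G) (bicoset_space SO3 SO3_topology G) M \<and>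
        homeomorphic_map (bicoset_space SO3 SO3_topology G) X h \<and>
        transported_structure (bicoset_space SO3 SO3_topology G) h M N \<and>
        multivalued_topological_group (card G) X N)"

end

theory Submission
  imports Defs
begin

text \<open>
  The unit quaternions cover \<open>SO(3)\<close> twice. If \<open>\<Gamma>\<close> is the preimage of \<open>G\<close>, then the bicosets of \<open>G\<close>
  correspond to the orbits of the maps \<open>x \<mapsto> a x b\<close> with \<open>a, b \<in> \<Gamma>\<close> on the three-sphere. The bicoset
  space is compact, so a continuous map from the sphere onto a Hausdorff space \<open>X\<close> whose fibres are
  exactly these orbits induces a homeomorphism of the bicoset space with \<open>X\<close>. The bicoset structure
  of a finite subgroup of a topological group is always a multivalued topological group, and a
  homeomorphism transports it. Hence all that is needed for each \<open>G\<close> is such an orbit map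
  (\<open>carries_bicoset_structure_if_orbit_map\<close>), and replacing \<open>G\<close> by a conjugate does not matter.

  Cyclic groups. Write a quaternion as \<open>z + w j\<close> with complex \<open>z, w\<close>. Multiplying on both sides by
  \<open>2n\<close>-th roots of unity yields exactly the maps \<open>(z, w) \<mapsto> (\<mu> z, \<nu> w)\<close> with
  \<open>\<mu>\<^sup>n = \<nu>\<^sup>n = \<plusminus>1\<close>. So \<open>(z, w) \<mapsto> (z\<^sup>n, w\<^sup>n)\<close>, rescaled so that moduli are kept, identifies the
  quotient with the sphere modulo sign, which is \<open>\<real>P\<^sup>3\<close>.

  Dihedral groups. Now \<open>j\<close> acts as well, from both sides. For even \<open>n\<close> it acts on the image of the
  power map by the exchange of both coordinates and by simultaneous complex conjugation; together
  with the sign, and after a rotation by 45 degrees, this is the group of all sign changes of an even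
  number of the four real coordinates. Its quotient is again a sphere, because a quotient by a sign
  change in a plane is undone by complex squaring. For odd \<open>n\<close> the power map commutes with
  multiplication by \<open>j\<close>; the remaining group is generated by \<open>j\<close> from both sides and is conjugate to
  the cyclic one with \<open>n = 2\<close>, so that the quotient is \<open>\<real>P\<^sup>3\<close>.

  Polyhedral groups. Together with the maps \<open>x \<mapsto> a x b\<close> consider the maps \<open>x \<mapsto> a x\<^sup>* b\<close>, where \<open>x\<^sup>*\<close> is
  the quaternion conjugate. Among them are the reflections \<open>x \<mapsto> - \<alpha> x\<^sup>* \<alpha>\<close> in the elements \<open>\<alpha>\<close> of
  \<open>\<Gamma>\<close>, which therefore form a root system: H4 for the binary icosahedral group and F4 for the
  binary octahedral group. A chamber of the reflection group is a cone with four walls that meets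
  every orbit once. The orbits of a subgroup that is cut out by sign characters are then described by
  the four wall coordinates of the representative, decorated with the signs, where a sign has to be
  forgotten when a wall that changes it is hit. A folding by complex squaring forgets precisely this
  (\<open>chamber_orbit_map\<close>). For the icosahedral group the only character is the determinant, and the
  sphere appears as two copies of a chamber glued along the boundary. The tetrahedral group is the
  common kernel of two characters of the reflection group of F4, counting reflections in the roots
  of either class, and four chambers are glued to a sphere. The octahedral group permits in
  addition the exchange of the two classes of roots, which acts on this sphere by the exchange of two
  complex coordinates and by complex conjugation, and one more folding gives a sphere again.
\<close>

section \<open>Bicoset structures of topological groups\<close>

lemma bicoset_eq_iff:
  fixes W (structure)
  assumes "group W" "subgroup \<Gamma> W" "x \<in> carrier W" "y \<in> carrier W"
  shows "bicoset W \<Gamma> x = bicoset W \<Gamma> y \<longleftrightarrow> (\<exists>g\<in>\<Gamma>. \<exists>h\<in>\<Gamma>. y = g \<otimes>\<^bsub>W\<^esub> x \<otimes>\<^bsub>W\<^esub> h)"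
proof -
  interpret group W by fact
  interpret H: subgroup \<Gamma> W by fact
  note mem = H.mem_carrier
  have self: "y \<in> bicoset W \<Gamma> y" if "y \<in> carrier W" for y
  proof -
    have "y = \<one> \<otimes> y \<otimes> \<one>" using that by simp
    then show ?thesis unfolding bicoset_def using H.one_closed by blast
  qed
  have sub: "bicoset W \<Gamma> (g \<otimes> x \<otimes> h) \<subseteq> bicoset W \<Gamma> x" if "x \<in> carrier W" "g \<in> \<Gamma>" "h \<in> \<Gamma>" for x g h
  proof
    fix z assume "z \<in> bicoset W \<Gamma> (g \<otimes> x \<otimes> h)"
    then obtain g' h' where z: "g' \<in> \<Gamma>" "h' \<in> \<Gamma>" "z = g' \<otimes> (g \<otimes> x \<otimes> h) \<otimes> h'"
      unfolding bicoset_def by blast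
    then have "z = (g' \<otimes> g) \<otimes> x \<otimes> (h \<otimes> h')" using that mem by (simp add: m_assoc)
    then show "z \<in> bicoset W \<Gamma> x" unfolding bicoset_def using z that H.m_closed by blast
  qed
  show ?thesis
  proof
    assume "bicoset W \<Gamma> x = bicoset W \<Gamma> y"
    then have "y \<in> bicoset W \<Gamma> x" using self assms by blast
    then show "\<exists>g\<in>\<Gamma>. \<exists>h\<in>\<Gamma>. y = g \<otimes> x \<otimes> h" unfolding bicoset_def by blast
  next
    assume "\<exists>g\<in>\<Gamma>. \<exists>h\<in>\<Gamma>. y = g \<otimes> x \<otimes> h"
    then obtain g h where gh: "g \<in> \<Gamma>" "h \<in> \<Gamma>" "y = g \<otimes> x \<otimes> h" by blast
    have "inv g \<otimes> y \<otimes> inv h = x" using gh assms mem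
      by (simp add: m_assoc) (simp add: m_assoc[symmetric])
    then show "bicoset W \<Gamma> x = bicoset W \<Gamma> y"
      using sub[of x g h] sub[of y "inv g" "inv h"] gh assms by auto
  qed
qed

lemma image_mset_mset_set_reindex:
  assumes "bij_betw f A A"
  shows "image_mset (\<lambda>x. g (f x)) (mset_set A) = image_mset g (mset_set A)"
proof -
  have "image_mset f (mset_set A) = mset_set A"
    using assms by (simp add: image_mset_mset_set bij_betw_def)
  then have "image_mset g (image_mset f (mset_set A)) = image_mset g (mset_set A)" by simp
  then show ?thesis by (simp add: multiset.map_comp comp_def)
qed

text \<open>If \<open>x' = g x h\<close> and \<open>y' = g' y h'\<close>, then \<open>x' \<gamma> y'\<close> lies in the bicoset of
  \<open>x (h \<gamma> g') y\<close>, and \<open>\<gamma> \<mapsto> h \<gamma> g'\<close> permutes \<open>\<Gamma>\<close>; so only the order of the factors of the multiset changes.\<close>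

lemma bicoset_product_representatives:
  fixes W (structure)
  assumes "group W" "subgroup \<Gamma> W" "x \<in> carrier W" "y \<in> carrier W" "x' \<in> carrier W" "y' \<in> carrier W"
    and "bicoset W \<Gamma> x = bicoset W \<Gamma> x'" "bicoset W \<Gamma> y = bicoset W \<Gamma> y'"
  shows "image_mset (\<lambda>\<gamma>. bicoset W \<Gamma> (x \<otimes>\<^bsub>W\<^esub> \<gamma> \<otimes>\<^bsub>W\<^esub> y)) (mset_set \<Gamma>) =
         image_mset (\<lambda>\<gamma>. bicoset W \<Gamma> (x' \<otimes>\<^bsub>W\<^esub> \<gamma> \<otimes>\<^bsub>W\<^esub> y')) (mset_set \<Gamma>)"
proof -
  interpret group W by fact
  interpret H: subgroup \<Gamma> W by fact
  note mem = H.mem_carrier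
  obtain g h where gh: "g \<in> \<Gamma>" "h \<in> \<Gamma>" "x' = g \<otimes> x \<otimes> h"
    using assms(7) bicoset_eq_iff[OF assms(1,2,3,5)] by blast
  obtain g' h' where gh': "g' \<in> \<Gamma>" "h' \<in> \<Gamma>" "y' = g' \<otimes> y \<otimes> h'"
    using assms(8) bicoset_eq_iff[OF assms(1,2,4,6)] by blast
  have eq: "bicoset W \<Gamma> (x' \<otimes> \<gamma> \<otimes> y') = bicoset W \<Gamma> (x \<otimes> (h \<otimes> \<gamma> \<otimes> g') \<otimes> y)" if "\<gamma> \<in> \<Gamma>" for \<gamma>
  proof -
    have "x' \<otimes> \<gamma> \<otimes> y' = g \<otimes> (x \<otimes> (h \<otimes> \<gamma> \<otimes> g') \<otimes> y) \<otimes> h'"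
      using gh gh' assms(3-6) that mem by (simp add: m_assoc)
    then show ?thesis
      using bicoset_eq_iff[OF assms(1,2), of "x \<otimes> (h \<otimes> \<gamma> \<otimes> g') \<otimes> y" "x' \<otimes> \<gamma> \<otimes> y'"]
        gh gh' assms(3-6) that mem by auto
  qed
  have bij: "bij_betw (\<lambda>\<gamma>. h \<otimes> \<gamma> \<otimes> g') \<Gamma> \<Gamma>"
  proof (rule bij_betw_byWitness[where f' = "\<lambda>\<gamma>. inv h \<otimes> \<gamma> \<otimes> inv g'"])
    show "\<forall>a\<in>\<Gamma>. inv h \<otimes> (h \<otimes> a \<otimes> g') \<otimes> inv g' = a"
      using gh gh' mem by (auto simp: m_assoc) (auto simp: m_assoc[symmetric])
    show "\<forall>a'\<in>\<Gamma>. h \<otimes> (inv h \<otimes> a' \<otimes> inv g') \<otimes> g' = a'"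
      using gh gh' mem by (auto simp: m_assoc) (auto simp: m_assoc[symmetric])
  qed (use gh gh' in auto)
  show ?thesis
  proof (cases "finite \<Gamma>")
    case True
    have "image_mset (\<lambda>\<gamma>. bicoset W \<Gamma> (x' \<otimes> \<gamma> \<otimes> y')) (mset_set \<Gamma>)
        = image_mset (\<lambda>\<gamma>. bicoset W \<Gamma> (x \<otimes> (h \<otimes> \<gamma> \<otimes> g') \<otimes> y)) (mset_set \<Gamma>)"
      by (rule image_mset_cong) (use eq True in auto)
    also have "\<dots> = image_mset (\<lambda>\<gamma>. bicoset W \<Gamma> (x \<otimes> \<gamma> \<otimes> y)) (mset_set \<Gamma>)"
      by (rule image_mset_mset_set_reindex[OF bij])
    finally show ?thesis by simp
  qed simp
qed

lemma bicoset_structure_exists: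
  fixes W (structure)
  assumes "group W" "subgroup \<Gamma> W"
  shows "\<exists>S. bicoset_structure W \<Gamma> S"
proof -
  interpret group W by fact
  interpret H: subgroup \<Gamma> W by fact
  define rep where "rep A = (SOME x. x \<in> carrier W \<and> bicoset W \<Gamma> x = A)" for A
  have rep: "rep (bicoset W \<Gamma> x) \<in> carrier W \<and> bicoset W \<Gamma> (rep (bicoset W \<Gamma> x)) = bicoset W \<Gamma> x"
    if "x \<in> carrier W" for x
    unfolding rep_def by (rule someI[of _ x]) (use that in simp)
  have inv_eq: "bicoset W \<Gamma> (inv x) = bicoset W \<Gamma> (inv y)"
    if xy: "x \<in> carrier W" "y \<in> carrier W" and eq: "bicoset W \<Gamma> x = bicoset W \<Gamma> y" for x y
  proof -
    obtain g h where gh: "g \<in> \<Gamma>" "h \<in> \<Gamma>" "y = g \<otimes> x \<otimes> h"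
      using eq bicoset_eq_iff[OF assms xy] by blast
    then have "inv y = inv h \<otimes> inv x \<otimes> inv g"
      using xy H.mem_carrier by (simp add: inv_mult_group m_assoc)
    then show ?thesis
      using bicoset_eq_iff[OF assms, of "inv x" "inv y"] gh xy by auto
  qed
  define S where "S = \<lparr>mv_mult = \<lambda>A B. image_mset (\<lambda>\<gamma>. bicoset W \<Gamma> (rep A \<otimes> \<gamma> \<otimes> rep B)) (mset_set \<Gamma>),
      mv_unit = bicoset W \<Gamma> \<one>, mv_inv = \<lambda>A. bicoset W \<Gamma> (inv (rep A))\<rparr>"
  have "bicoset_structure W \<Gamma> S"
    unfolding bicoset_structure_def
  proof (intro conjI ballI)
    fix x y assume xy: "x \<in> carrier W" "y \<in> carrier W"
    show "mv_mult S (bicoset W \<Gamma> x) (bicoset W \<Gamma> y) =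
        image_mset (\<lambda>\<gamma>. bicoset W \<Gamma> (x \<otimes> \<gamma> \<otimes> y)) (mset_set \<Gamma>)"
      unfolding S_def multivalued_structure.simps
      by (rule bicoset_product_representatives[OF assms]) (use rep xy in auto)
    show "mv_inv S (bicoset W \<Gamma> x) = bicoset W \<Gamma> (inv x)"
      unfolding S_def multivalued_structure.simps
      by (rule inv_eq) (use rep xy in auto)
  qed (simp add: S_def)
  then show ?thesis by blast
qed

lemma open_map_prod_map:
  assumes "open_map X X' f" "open_map Y Y' g"
  shows "open_map (prod_topology X Y) (prod_topology X' Y') (\<lambda>(x, y). (f x, g y))"
  unfolding open_map_def
proof (intro allI impI)
  fix U assume U: "openin (prod_topology X Y) U"
  show "openin (prod_topology X' Y') ((\<lambda>(x, y). (f x, g y)) ` U)"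
    unfolding openin_prod_topology_alt
  proof (intro allI impI)
    fix a b assume "(a, b) \<in> (\<lambda>(x, y). (f x, g y)) ` U"
    then obtain x y where xy: "(x, y) \<in> U" "a = f x" "b = g y" by auto
    then obtain A B where "openin X A" "openin Y B" "x \<in> A" "y \<in> B" "A \<times> B \<subseteq> U"
      using U unfolding openin_prod_topology_alt by metis
    then have "openin X' (f ` A)" "openin Y' (g ` B)" "a \<in> f ` A" "b \<in> g ` B"
       "f ` A \<times> g ` B \<subseteq> (\<lambda>(x, y). (f x, g y)) ` U"
      using assms xy by (auto simp: open_map_def)
    then show "\<exists>U' V. openin X' U' \<and> openin Y' V \<and> a \<in> U' \<and> b \<in> V \<and> U' \<times> V \<subseteq> (\<lambda>(x, y). (f x, g y)) ` U"
      by blast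
  qed
qed

text \<open>The saturation of an open set is a union of translates of it. Openness is what makes the
  product of two projections a quotient map again, and the multiplication of bicosets is
  continuous only because it can be lifted along that product.\<close>

lemma open_map_bicoset:
  fixes W (structure)
  assumes "group W" "subgroup \<Gamma> W" and T: "topspace T = carrier W"
    and mult: "continuous_map (prod_topology T T) T (\<lambda>(x, y). x \<otimes>\<^bsub>W\<^esub> y)"
  shows "open_map T (bicoset_space W T \<Gamma>) (bicoset W \<Gamma>)"
  unfolding open_map_def
proof (intro allI impI)
  interpret group W by fact
  interpret H: subgroup \<Gamma> W by fact
  fix U assume U: "openin T U"
  then have UT: "U \<subseteq> carrier W" using openin_subset T by blast
  have trans: "continuous_map T T (\<lambda>x. g \<otimes> x \<otimes> h)" if "g \<in> carrier W" "h \<in> carrier W" for g h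
  proof -
    have "continuous_map T T (\<lambda>x. (\<lambda>(x, y). x \<otimes> y) (g, x))"
      by (rule continuous_map_compose[OF _ mult, unfolded comp_def])
        (use that T in \<open>simp add: continuous_map_pairwise comp_def\<close>)
    then have "continuous_map T T (\<lambda>x. (\<lambda>(x, y). x \<otimes> y) (g \<otimes> x, h))"
      by (intro continuous_map_compose[OF _ mult, unfolded comp_def])
        (use that T in \<open>simp add: continuous_map_pairwise comp_def\<close>)
    then show ?thesis by simp
  qed
  have "{x \<in> topspace T. bicoset W \<Gamma> x \<in> bicoset W \<Gamma> ` U} =
      (\<Union>g\<in>\<Gamma>. \<Union>h\<in>\<Gamma>. {x \<in> topspace T. g \<otimes> x \<otimes> h \<in> U})" (is "?L = ?R")
  proof
    show "?L \<subseteq> ?R"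
    proof
      fix x assume "x \<in> ?L"
      then obtain u where "x \<in> carrier W" "u \<in> U" "bicoset W \<Gamma> x = bicoset W \<Gamma> u" using T by auto
      then show "x \<in> ?R" using bicoset_eq_iff[OF assms(1,2), of x u] UT T by auto
    qed
    show "?R \<subseteq> ?L"
    proof
      fix x assume "x \<in> ?R"
      then obtain g h where "g \<in> \<Gamma>" "h \<in> \<Gamma>" "x \<in> carrier W" "g \<otimes> x \<otimes> h \<in> U" using T by auto
      moreover from this have "bicoset W \<Gamma> x = bicoset W \<Gamma> (g \<otimes> x \<otimes> h)"
        using bicoset_eq_iff[OF assms(1,2), of x "g \<otimes> x \<otimes> h"] UT by auto
      ultimately show "x \<in> ?L" using T by auto
    qed
  qed
  moreover have "openin T ?R"
    by (intro openin_Union) (use trans H.mem_carrier U in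
      \<open>auto intro!: openin_Union openin_continuous_map_preimage\<close>)
  ultimately show "openin (bicoset_space W T \<Gamma>) (bicoset W \<Gamma> ` U)"
    unfolding bicoset_space_def openin_quotient_topology using UT T by auto
qed

lemma sum_mset_mset_set_image:
  "finite A \<Longrightarrow> (\<Sum>w\<in>#image_mset f (mset_set A). g w) = (\<Sum>a\<in>A. g (f a))"
  by (simp add: multiset.map_comp comp_def sum_unfold_sum_mset)

lemma image_mset_mset_set_as_sum:
  "finite A \<Longrightarrow> image_mset f (mset_set A) = (\<Sum>a\<in>A. {#f a#})"
  by (induction rule: finite_induct) auto

text \<open>Both sides of the associative law are the sum over \<open>\<gamma>, \<delta> \<in> \<Gamma>\<close> of the bicosets of
  \<open>x \<delta> y \<gamma> z\<close>. For continuity, \<open>\<Gamma>\<close> is enumerated, which lifts the product of bicosets to a map into a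
  finite power of the bicoset space.\<close>

theorem bicoset_structure_multivalued_group:
  fixes W (structure)
  assumes W: "group W" "subgroup \<Gamma> W" and fin: "finite \<Gamma>" and T: "topspace T = carrier W"
    and mult: "continuous_map (prod_topology T T) T (\<lambda>(x, y). x \<otimes>\<^bsub>W\<^esub> y)"
    and inv: "continuous_map T T (\<lambda>x. inv\<^bsub>W\<^esub> x)"
    and S: "bicoset_structure W \<Gamma> S"
  shows "multivalued_topological_group (card \<Gamma>) (bicoset_space W T \<Gamma>) S"
proof -
  interpret group W by fact
  interpret H: subgroup \<Gamma> W by fact
  note mem = H.mem_carrier
  let ?B = "bicoset W \<Gamma>" and ?X = "bicoset_space W T \<Gamma>"
  have top: "topspace ?X = ?B ` carrier W"
    by (simp add: bicoset_space_def topspace_quotient_topology T)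
  have q: "quotient_map T ?X ?B"
    unfolding bicoset_space_def by (rule quotient_map_quotient_topology)
  have qc: "continuous_map T ?X ?B" using q quotient_imp_continuous_map by blast
  have mul: "mv_mult S (?B x) (?B y) = image_mset (\<lambda>\<gamma>. ?B (x \<otimes> \<gamma> \<otimes> y)) (mset_set \<Gamma>)"
    if "x \<in> carrier W" "y \<in> carrier W" for x y using S that by (simp add: bicoset_structure_def)
  have unit: "mv_unit S = ?B \<one>" using S by (simp add: bicoset_structure_def)
  have invS: "mv_inv S (?B x) = ?B (inv x)" if "x \<in> carrier W" for x
    using S that by (simp add: bicoset_structure_def)
  have q2: "quotient_map (prod_topology T T) (prod_topology ?X ?X) (\<lambda>(x, y). (?B x, ?B y))"
  proof (rule continuous_open_imp_quotient_map)
    have "continuous_map (prod_topology T T) ?X (\<lambda>z. ?B (fst z))"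
      "continuous_map (prod_topology T T) ?X (\<lambda>z. ?B (snd z))"
      using continuous_map_compose[OF continuous_map_fst qc] continuous_map_compose[OF continuous_map_snd qc]
      by (simp_all add: comp_def)
    then show "continuous_map (prod_topology T T) (prod_topology ?X ?X) (\<lambda>(x, y). (?B x, ?B y))"
      by (simp add: continuous_map_pairwise comp_def case_prod_unfold)
    show "open_map (prod_topology T T) (prod_topology ?X ?X) (\<lambda>(x, y). (?B x, ?B y))"
      by (intro open_map_prod_map open_map_bicoset W T mult)
    show "(\<lambda>(x, y). (?B x, ?B y)) ` topspace (prod_topology T T) = topspace (prod_topology ?X ?X)"
      by (auto simp: top T image_iff)
  qed
  obtain e where e: "bij_betw e {..<card \<Gamma>} \<Gamma>"
    using ex_bij_betw_nat_finite[OF fin] by (auto simp: atLeast0LessThan)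
  have cont1: "continuous_map (prod_topology T T) ?X (\<lambda>(x, y). ?B (x \<otimes> g \<otimes> y))" if "g \<in> carrier W" for g
  proof -
    have "continuous_map (prod_topology T T) T (\<lambda>z. (\<lambda>(x, y). x \<otimes> y) (fst z, g))"
      by (rule continuous_map_compose[OF _ mult, unfolded comp_def])
        (use that T in \<open>simp add: continuous_map_pairwise comp_def continuous_map_fst\<close>)
    then have "continuous_map (prod_topology T T) T (\<lambda>z. (\<lambda>(x, y). x \<otimes> y) (fst z \<otimes> g, snd z))"
      by (intro continuous_map_compose[OF _ mult, unfolded comp_def])
        (use that T in \<open>simp add: continuous_map_pairwise comp_def continuous_map_snd\<close>)
    from continuous_map_compose[OF this qc] show ?thesis by (simp add: comp_def case_prod_unfold)
  qed
  define \<Phi> where "\<Phi> = (\<lambda>(x, y). restrict (\<lambda>i. ?B (x \<otimes> e i \<otimes> y)) {..<card \<Gamma>})"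
  have "continuous_map (prod_topology T T) (product_topology (\<lambda>_. ?X) {..<card \<Gamma>}) \<Phi>"
    unfolding continuous_map_componentwise
  proof (intro conjI ballI)
    show "\<Phi> ` topspace (prod_topology T T) \<subseteq> extensional {..<card \<Gamma>}" by (auto simp: \<Phi>_def)
    fix k assume k: "k \<in> {..<card \<Gamma>}"
    then have "e k \<in> carrier W" using bij_betwE[OF e] mem by blast
    from cont1[OF this] show "continuous_map (prod_topology T T) ?X (\<lambda>x. \<Phi> x k)"
      using k by (simp add: \<Phi>_def case_prod_unfold)
  qed
  then have "continuous_map (prod_topology T T) (symmetric_power (card \<Gamma>) ?X)
      ((\<lambda>x. image_mset x (mset_set {..<card \<Gamma>})) \<circ> \<Phi>)"
    unfolding symmetric_power_def
    by (rule continuous_map_compose)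
      (rule quotient_imp_continuous_map[OF quotient_map_quotient_topology])
  moreover have "((\<lambda>x. image_mset x (mset_set {..<card \<Gamma>})) \<circ> \<Phi>) z =
      ((\<lambda>(A, B). mv_mult S A B) \<circ> (\<lambda>(x, y). (?B x, ?B y))) z" if "z \<in> topspace (prod_topology T T)" for z
  proof -
    obtain x y where z: "z = (x, y)" "x \<in> carrier W" "y \<in> carrier W" using \<open>z \<in> _\<close> T by auto
    have "image_mset (\<Phi> z) (mset_set {..<card \<Gamma>}) = image_mset (\<lambda>i. ?B (x \<otimes> e i \<otimes> y)) (mset_set {..<card \<Gamma>})"
      by (rule image_mset_cong) (simp add: \<Phi>_def z)
    also have "\<dots> = image_mset (\<lambda>\<gamma>. ?B (x \<otimes> \<gamma> \<otimes> y)) (image_mset e (mset_set {..<card \<Gamma>}))"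
      by (simp add: multiset.map_comp comp_def)
    also have "image_mset e (mset_set {..<card \<Gamma>}) = mset_set \<Gamma>"
      using e by (simp add: image_mset_mset_set bij_betw_def)
    finally show ?thesis using z by (simp add: mul)
  qed
  ultimately have "continuous_map (prod_topology T T) (symmetric_power (card \<Gamma>) ?X)
      ((\<lambda>(A, B). mv_mult S A B) \<circ> (\<lambda>(x, y). (?B x, ?B y)))"
    by (rule continuous_map_eq)
  then have 1: "continuous_map (prod_topology ?X ?X) (symmetric_power (card \<Gamma>) ?X) (\<lambda>(A, B). mv_mult S A B)"
    using continuous_compose_quotient_map_eq[OF q2] by blast
  have "continuous_map T ?X (?B \<circ> (\<lambda>x. inv x))" by (rule continuous_map_compose[OF inv qc])
  then have "continuous_map T ?X (mv_inv S \<circ> ?B)"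
    by (rule continuous_map_eq) (simp add: T invS)
  then have 2: "continuous_map ?X ?X (mv_inv S)"
    using continuous_compose_quotient_map_eq[OF q] by blast
  have 3: "(\<Sum>w\<in>#mv_mult S (?B y) (?B z). mv_mult S (?B x) w) = (\<Sum>v\<in>#mv_mult S (?B x) (?B y). mv_mult S v (?B z))"
    if x: "x \<in> carrier W" and y: "y \<in> carrier W" and z: "z \<in> carrier W" for x y z
  proof -
    have "(\<Sum>w\<in>#mv_mult S (?B y) (?B z). mv_mult S (?B x) w) = (\<Sum>\<gamma>\<in>\<Gamma>. mv_mult S (?B x) (?B (y \<otimes> \<gamma> \<otimes> z)))"
      using x y z by (simp add: mul sum_mset_mset_set_image fin)
    also have "\<dots> = (\<Sum>\<gamma>\<in>\<Gamma>. \<Sum>\<delta>\<in>\<Gamma>. {#?B (x \<otimes> \<delta> \<otimes> y \<otimes> \<gamma> \<otimes> z)#})"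
      using x y z mem by (intro sum.cong refl) (simp add: mul image_mset_mset_set_as_sum fin m_assoc)
    also have "\<dots> = (\<Sum>\<delta>\<in>\<Gamma>. \<Sum>\<gamma>\<in>\<Gamma>. {#?B (x \<otimes> \<delta> \<otimes> y \<otimes> \<gamma> \<otimes> z)#})" by (rule sum.swap)
    also have "\<dots> = (\<Sum>\<delta>\<in>\<Gamma>. mv_mult S (?B (x \<otimes> \<delta> \<otimes> y)) (?B z))"
      using x y z mem by (intro sum.cong refl) (simp add: mul image_mset_mset_set_as_sum fin)
    also have "\<dots> = (\<Sum>v\<in>#mv_mult S (?B x) (?B y). mv_mult S v (?B z))"
      using x y z by (simp add: mul sum_mset_mset_set_image fin)
    finally show ?thesis .
  qed
  have triv: "?B (\<gamma> \<otimes> x) = ?B x" "?B (x \<otimes> \<gamma>) = ?B x" if "x \<in> carrier W" "\<gamma> \<in> \<Gamma>" for x \<gamma>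
  proof -
    have "\<gamma> \<otimes> x = \<gamma> \<otimes> x \<otimes> \<one>" "x \<otimes> \<gamma> = \<one> \<otimes> x \<otimes> \<gamma>" using that mem by auto
    then show "?B (\<gamma> \<otimes> x) = ?B x" "?B (x \<otimes> \<gamma>) = ?B x"
      using that mem H.one_closed bicoset_eq_iff[OF W, of x "\<gamma> \<otimes> x"] bicoset_eq_iff[OF W, of x "x \<otimes> \<gamma>"]
      by (metis m_closed)+
  qed
  have const: "image_mset f (mset_set \<Gamma>) = replicate_mset (card \<Gamma>) c" if "\<And>\<gamma>. \<gamma> \<in> \<Gamma> \<Longrightarrow> f \<gamma> = c" for f c
  proof -
    have "image_mset f (mset_set \<Gamma>) = image_mset (\<lambda>_. c) (mset_set \<Gamma>)"
      by (rule image_mset_cong) (use that fin in auto)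
    then show ?thesis by (simp add: image_mset_const_eq)
  qed
  have 4: "mv_mult S (?B \<one>) (?B x) = replicate_mset (card \<Gamma>) (?B x)
      \<and> mv_mult S (?B x) (?B \<one>) = replicate_mset (card \<Gamma>) (?B x)" if "x \<in> carrier W" for x
    using that mem triv by (auto simp: mul intro!: const)
  have 5: "?B \<one> \<in># mv_mult S (?B (inv x)) (?B x) \<and> ?B \<one> \<in># mv_mult S (?B x) (?B (inv x))"
    if "x \<in> carrier W" for x
    using that fin H.one_closed by (auto simp: mul image_iff intro!: bexI[of _ \<one>])
  show ?thesis
    unfolding multivalued_topological_group_def unit
    using 1 2 3 4 5 by (simp add: top invS)
qed

lemma image_mset_sum_of_msets:
  "image_mset h (\<Sum>w\<in>#M. f w) = (\<Sum>w\<in>#M. image_mset h (f w))"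
  by (induction M) auto

lemma multivalued_topological_group_values:
  assumes "multivalued_topological_group n X S" "x \<in> topspace X" "y \<in> topspace X"
  shows "set_mset (mv_mult S x y) \<subseteq> topspace X"
proof -
  have "(\<lambda>(x, y). mv_mult S x y) \<in> topspace (prod_topology X X) \<rightarrow> topspace (symmetric_power n X)"
    using assms(1) unfolding multivalued_topological_group_def continuous_map_def by blast
  from funcset_mem[OF this, of "(x, y)"] have "mv_mult S x y \<in> topspace (symmetric_power n X)"
    using assms(2,3) by simp
  then obtain f where f: "f \<in> topspace (product_topology (\<lambda>_. X) {..<n})"
      "mv_mult S x y = image_mset f (mset_set {..<n})"
    unfolding symmetric_power_def topspace_quotient_topology by blast
  have "f i \<in> topspace X" if "i < n" for i using f(1) that PiE_mem[of f "{..<n}"] by simp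
  then show ?thesis unfolding f(2) by auto
qed

lemma continuous_map_symmetric_power:
  assumes "continuous_map X Y h"
  shows "continuous_map (symmetric_power n X) (symmetric_power n Y) (image_mset h)"
proof -
  let ?P = "\<lambda>X. product_topology (\<lambda>_. X) {..<n}" and ?q = "\<lambda>x. image_mset x (mset_set {..<n})"
  have q: "quotient_map (?P X) (symmetric_power n X) ?q" for X :: "'c topology"
    unfolding symmetric_power_def by (rule quotient_map_quotient_topology)
  have "continuous_map (?P X) (?P Y) (\<lambda>x. restrict (h \<circ> x) {..<n})"
    unfolding continuous_map_componentwise
  proof (intro conjI ballI)
    fix k assume k: "k \<in> {..<n}"
    have "continuous_map (?P X) Y (h \<circ> (\<lambda>x. x k))"
      by (rule continuous_map_compose[OF _ assms]) (use continuous_map_product_projection[of k "{..<n}" "\<lambda>_. X"] k in simp)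
    then show "continuous_map (?P X) Y (\<lambda>x. restrict (h \<circ> x) {..<n} k)" using k by (simp add: comp_def)
  qed auto
  then have "continuous_map (?P X) (symmetric_power n Y) (?q \<circ> (\<lambda>x. restrict (h \<circ> x) {..<n}))"
    using continuous_map_compose quotient_imp_continuous_map[OF q] by blast
  moreover have "(?q \<circ> (\<lambda>x. restrict (h \<circ> x) {..<n})) x = (image_mset h \<circ> ?q) x" for x
    by (auto simp: multiset.map_comp intro!: image_mset_cong)
  ultimately have "continuous_map (?P X) (symmetric_power n Y) (image_mset h \<circ> ?q)"
    by (metis (no_types, lifting) continuous_map_eq)
  then show ?thesis using continuous_compose_quotient_map_eq[OF q] by blast
qed

text \<open>The only delicate axiom is associativity: \<open>h\<close> and its inverse cancel only on points of \<open>X\<close>, so it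
  is needed that all values of the multiplication are points of \<open>X\<close>.\<close>

theorem transport_multivalued_group:
  assumes S: "multivalued_topological_group n X S" and h: "homeomorphic_map X Y h"
  shows "\<exists>S'. transported_structure X h S S' \<and> multivalued_topological_group n Y S'"
proof -
  obtain k where k: "homeomorphic_maps X Y h k" using h homeomorphic_map_maps by blast
  then have hc: "continuous_map X Y h" and kc: "continuous_map Y X k"
    and kh: "\<And>x. x \<in> topspace X \<Longrightarrow> k (h x) = x" and hk: "\<And>y. y \<in> topspace Y \<Longrightarrow> h (k y) = y"
    by (auto simp: homeomorphic_maps_def)
  have kX: "k y \<in> topspace X" if "y \<in> topspace Y" for y using kc that by (auto simp: continuous_map_def)
  have hY: "h x \<in> topspace Y" if "x \<in> topspace X" for x using hc that by (auto simp: continuous_map_def)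
  define S' where "S' = \<lparr>mv_mult = \<lambda>a b. image_mset h (mv_mult S (k a) (k b)),
     mv_unit = h (mv_unit S), mv_inv = \<lambda>a. h (mv_inv S (k a))\<rparr>"
  have S'simps: "mv_mult S' a b = image_mset h (mv_mult S (k a) (k b))" "mv_unit S' = h (mv_unit S)"
    "mv_inv S' a = h (mv_inv S (k a))" for a b by (simp_all add: S'_def)
  have vals: "set_mset (mv_mult S x y) \<subseteq> topspace X" if "x \<in> topspace X" "y \<in> topspace X" for x y
    using multivalued_topological_group_values[OF S that] .
  have c1: "continuous_map (prod_topology X X) (symmetric_power n X) (\<lambda>(x, y). mv_mult S x y)"
    and uX: "mv_unit S \<in> topspace X" and c2: "continuous_map X X (mv_inv S)"
    and assoc: "\<And>x y z. \<lbrakk>x\<in>topspace X; y\<in>topspace X; z\<in>topspace X\<rbrakk> \<Longrightarrow>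
        (\<Sum>w\<in>#mv_mult S y z. mv_mult S x w) = (\<Sum>v\<in>#mv_mult S x y. mv_mult S v z)"
    and unit: "\<And>x. x\<in>topspace X \<Longrightarrow> mv_mult S (mv_unit S) x = replicate_mset n x \<and>
        mv_mult S x (mv_unit S) = replicate_mset n x"
    and invx: "\<And>x. x\<in>topspace X \<Longrightarrow> mv_unit S \<in># mv_mult S (mv_inv S x) x \<and>
        mv_unit S \<in># mv_mult S x (mv_inv S x)"
    using S unfolding multivalued_topological_group_def by blast+
  have iX: "mv_inv S x \<in> topspace X" if "x \<in> topspace X" for x using c2 that by (auto simp: continuous_map_def)
  have "transported_structure X h S S'"
    unfolding transported_structure_def S'simps by (auto simp: kh)
  moreover have "multivalued_topological_group n Y S'"
    unfolding multivalued_topological_group_def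
  proof (intro conjI ballI)
    have "continuous_map (prod_topology Y Y) (prod_topology X X) (\<lambda>z. (k (fst z), k (snd z)))"
      using continuous_map_compose[OF continuous_map_fst kc, of Y] continuous_map_compose[OF continuous_map_snd kc, of Y]
      by (simp add: continuous_map_pairwise comp_def)
    from continuous_map_compose[OF continuous_map_compose[OF this c1] continuous_map_symmetric_power[OF hc]]
    show "continuous_map (prod_topology Y Y) (symmetric_power n Y) (\<lambda>(x, y). mv_mult S' x y)"
      by (simp add: comp_def case_prod_unfold S'simps)
    show "mv_unit S' \<in> topspace Y" by (simp add: S'simps hY uX)
    show "continuous_map Y Y (mv_inv S')"
      using continuous_map_compose[OF continuous_map_compose[OF kc c2] hc] by (simp add: comp_def S'simps[abs_def])
  next
    fix x y z assume "x \<in> topspace Y" "y \<in> topspace Y" "z \<in> topspace Y"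
    then have xyz: "k x \<in> topspace X" "k y \<in> topspace X" "k z \<in> topspace X" by (auto simp: kX)
    have "(\<Sum>w\<in>#mv_mult S' y z. mv_mult S' x w) = (\<Sum>w\<in>#mv_mult S (k y) (k z). image_mset h (mv_mult S (k x) w))"
      using vals[OF xyz(2,3)] by (auto simp: S'simps multiset.map_comp comp_def kh intro!: arg_cong[where f=sum_mset] image_mset_cong)
    also have "\<dots> = image_mset h (\<Sum>w\<in>#mv_mult S (k y) (k z). mv_mult S (k x) w)"
      by (simp add: image_mset_sum_of_msets)
    also have "\<dots> = image_mset h (\<Sum>v\<in>#mv_mult S (k x) (k y). mv_mult S v (k z))"
      using assoc xyz by simp
    also have "\<dots> = (\<Sum>v\<in>#mv_mult S (k x) (k y). image_mset h (mv_mult S v (k z)))"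
      by (simp add: image_mset_sum_of_msets)
    also have "\<dots> = (\<Sum>v\<in>#mv_mult S' x y. mv_mult S' v z)"
      using vals[OF xyz(1,2)] by (auto simp: S'simps multiset.map_comp comp_def kh intro!: arg_cong[where f=sum_mset] image_mset_cong)
    finally show "(\<Sum>w\<in>#mv_mult S' y z. mv_mult S' x w) = (\<Sum>v\<in>#mv_mult S' x y. mv_mult S' v z)" .
  next
    fix x assume x: "x \<in> topspace Y"
    show "mv_mult S' (mv_unit S') x = replicate_mset n x" "mv_mult S' x (mv_unit S') = replicate_mset n x"
      using x by (simp_all add: S'simps kh uX unit kX hk)
    show "mv_unit S' \<in># mv_mult S' (mv_inv S' x) x" "mv_unit S' \<in># mv_mult S' x (mv_inv S' x)"
      using x invx[OF kX[OF x]] by (auto simp: S'simps kh iX kX)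
  qed
  ultimately show ?thesis by blast
qed

section \<open>Quaternions and rotations\<close>

text \<open>The pair \<open>(z, w)\<close> stands for the quaternion \<open>z + w j\<close>, where \<open>j z = z\<^sup>* j\<close> and \<open>j\<^sup>2 = -1\<close>. This
  makes cyclic and dihedral groups act by simple formulas on complex numbers, and the inner product,
  norm and topology of pairs are those of the quaternions.\<close>

type_synonym quat = "complex \<times> complex"

definition qmul :: "quat \<Rightarrow> quat \<Rightarrow> quat" (infixl "\<odot>" 70) where
  "x \<odot> y = (fst x * fst y - snd x * cnj (snd y), fst x * snd y + snd x * cnj (fst y))"

definition qcnj :: "quat \<Rightarrow> quat" where
  "qcnj x = (cnj (fst x), - snd x)"

abbreviation qone :: quat where "qone \<equiv> (1, 0)"

lemma qmul_assoc: "(x \<odot> y) \<odot> z = x \<odot> (y \<odot> z)"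
  by (simp add: qmul_def algebra_simps)

lemma qmul_one [simp]: "qone \<odot> x = x" "x \<odot> qone = x"
  by (simp_all add: qmul_def)

lemma qcnj_qmul: "qcnj (x \<odot> y) = qcnj y \<odot> qcnj x"
  by (simp add: qmul_def qcnj_def algebra_simps)

lemma qcnj_qcnj [simp]: "qcnj (qcnj x) = x"
  by (simp add: qcnj_def)

lemma qcnj_one [simp]: "qcnj qone = qone"
  by (simp add: qcnj_def)

lemma qmul_add: "(x + y) \<odot> z = x \<odot> z + y \<odot> z" "z \<odot> (x + y) = z \<odot> x + z \<odot> y"
  by (simp_all add: qmul_def algebra_simps)

lemma qmul_minus [simp]: "(- x) \<odot> z = - (x \<odot> z)" "z \<odot> (- x) = - (z \<odot> x)"
  by (simp_all add: qmul_def algebra_simps)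

lemma qmul_diff: "(x - y) \<odot> z = x \<odot> z - y \<odot> z" "z \<odot> (x - y) = z \<odot> x - z \<odot> y"
  by (simp_all add: qmul_def algebra_simps)

lemma qmul_scaleR [simp]: "(c *\<^sub>R x) \<odot> z = c *\<^sub>R (x \<odot> z)" "z \<odot> (c *\<^sub>R x) = c *\<^sub>R (z \<odot> x)"
  by (simp_all add: qmul_def scaleR_conv_of_real algebra_simps)

lemma qcnj_add: "qcnj (x + y) = qcnj x + qcnj y"
  by (simp add: qcnj_def)

lemma qcnj_minus [simp]: "qcnj (- x) = - qcnj x"
  by (simp add: qcnj_def)

lemma qcnj_scaleR [simp]: "qcnj (c *\<^sub>R x) = c *\<^sub>R qcnj x"
  by (simp add: qcnj_def)

lemma norm_quat_squared: "(norm (x :: quat))\<^sup>2 = (Re (fst x))\<^sup>2 + (Im (fst x))\<^sup>2 + (Re (snd x))\<^sup>2 + (Im (snd x))\<^sup>2"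
  by (simp add: norm_prod_def cmod_power2)

lemma norm_qcnj [simp]: "norm (qcnj x) = norm x"
  by (simp add: norm_prod_def qcnj_def)

lemma norm_qmul: "norm (x \<odot> y) = norm x * norm y"
proof -
  have "(norm (x \<odot> y))\<^sup>2 = (norm x * norm y)\<^sup>2"
    unfolding power_mult_distrib norm_quat_squared by (simp add: qmul_def algebra_simps power2_eq_square)
  then show ?thesis by (simp add: power2_eq_iff_nonneg)
qed

lemma inner_quat: "(x :: quat) \<bullet> y = Re (fst x) * Re (fst y) + Im (fst x) * Im (fst y)
    + Re (snd x) * Re (snd y) + Im (snd x) * Im (snd y)"
  by (simp add: inner_prod_def inner_complex_def)

lemma inner_qmul_left: "(a \<odot> x) \<bullet> (a \<odot> y) = (norm a)\<^sup>2 * (x \<bullet> y)"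
  unfolding inner_quat norm_quat_squared by (simp add: qmul_def algebra_simps power2_eq_square)

lemma inner_qmul_right: "(x \<odot> a) \<bullet> (y \<odot> a) = (norm a)\<^sup>2 * (x \<bullet> y)"
  unfolding inner_quat norm_quat_squared by (simp add: qmul_def algebra_simps power2_eq_square)

lemma inner_qcnj [simp]: "qcnj x \<bullet> qcnj y = x \<bullet> y"
  by (simp add: inner_quat qcnj_def)

lemma qmul_qcnj:
  assumes "norm x = 1"
  shows "x \<odot> qcnj x = qone" "qcnj x \<odot> x = qone"
proof -
  have "(norm x)\<^sup>2 = 1" using assms by simp
  then show "x \<odot> qcnj x = qone" "qcnj x \<odot> x = qone"
    unfolding norm_quat_squared by (simp_all add: qmul_def qcnj_def complex_eq_iff power2_eq_square)
qed

lemma qmul_qcnj_cancel: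
  assumes "norm a = 1"
  shows "qcnj a \<odot> (a \<odot> x) = x" "a \<odot> (qcnj a \<odot> x) = x" "x \<odot> a \<odot> qcnj a = x" "x \<odot> qcnj a \<odot> a = x"
  using qmul_qcnj[OF assms] by (simp_all add: qmul_assoc) (simp_all add: qmul_assoc[symmetric])

lemma continuous_on_qmul [continuous_intros]:
  "continuous_on S f \<Longrightarrow> continuous_on S g \<Longrightarrow> continuous_on S (\<lambda>x. f x \<odot> g x)"
  unfolding qmul_def by (intro continuous_intros)

lemma continuous_on_qcnj [continuous_intros]:
  "continuous_on S f \<Longrightarrow> continuous_on S (\<lambda>x. qcnj (f x))"
  unfolding qcnj_def by (intro continuous_intros)

text \<open>The identification of space with the purely imaginary quaternions.\<close>

definition imq :: "real^3 \<Rightarrow> quat" where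
  "imq v = (Complex 0 (v$1), Complex (v$2) (v$3))"

text \<open>The matrix of \<open>v \<mapsto> q v q\<^sup>*\<close> on the imaginary quaternions, see \<open>imq_rot\<close>.\<close>

definition rot :: "quat \<Rightarrow> real^3^3" where
  "rot q = (let a = Re (fst q); b = Im (fst q); c = Re (snd q); d = Im (snd q) in
     vector [vector [a^2 + b^2 - c^2 - d^2, 2 * (b*c - a*d), 2 * (b*d + a*c)],
             vector [2 * (b*c + a*d), a^2 - b^2 + c^2 - d^2, 2 * (c*d - a*b)],
             vector [2 * (b*d - a*c), 2 * (c*d + a*b), a^2 - b^2 - c^2 + d^2]])"

lemma imq_rot: "imq (rot q *v v) = q \<odot> imq v \<odot> qcnj q"
  by (simp add: imq_def rot_def Let_def qmul_def qcnj_def matrix_vector_mult_def sum_3 vector_3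
      complex_eq_iff) (simp add: algebra_simps power2_eq_square)

lemma imq_inject: "imq u = imq v \<longleftrightarrow> u = v"
  by (auto simp: imq_def vec_eq_iff forall_3)

lemma rot_qmul: "rot (p \<odot> q) = rot p ** rot q"
proof -
  have "rot (p \<odot> q) *v v = (rot p ** rot q) *v v" for v
    unfolding imq_inject[symmetric]
    by (simp add: imq_rot matrix_vector_mul_assoc[symmetric] qcnj_qmul qmul_assoc)
  then show ?thesis by (simp add: matrix_eq)
qed

lemma rot_one: "rot qone = mat 1"
  by (simp add: rot_def vec_eq_iff forall_3 vector_3 mat_def)

lemma rot_minus [simp]: "rot (- q) = rot q"
  by (simp add: rot_def Let_def)

lemma rot_qcnj: "rot (qcnj q) = transpose (rot q)"
  by (simp add: rot_def Let_def qcnj_def vec_eq_iff forall_3 vector_3 transpose_def algebra_simps)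

lemma rot_in_SO3:
  assumes "norm q = 1"
  shows "rot q \<in> carrier SO3"
proof -
  have "transpose (rot q) ** rot q = mat 1" "rot q ** transpose (rot q) = mat 1"
    using qmul_qcnj[OF assms] by (simp_all add: rot_qcnj[symmetric] rot_qmul[symmetric] rot_one)
  moreover have "det (rot q) = ((norm q)\<^sup>2)^3"
    unfolding norm_quat_squared det_3 by (simp add: rot_def Let_def vector_3 algebra_simps power2_eq_square power3_eq_cube)
  ultimately show ?thesis
    using assms by (simp add: SO3_def rotation_matrix_def orthogonal_matrix_def)
qed

lemma rot_eq_one:
  assumes "norm r = 1" "rot r = mat 1"
  shows "r = qone \<or> r = - qone"
proof -
  define a b c d where abcd: "a = Re (fst r)" "b = Im (fst r)" "c = Re (snd r)" "d = Im (snd r)"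
  have n: "a\<^sup>2 + b\<^sup>2 + c\<^sup>2 + d\<^sup>2 = 1" using assms(1) norm_quat_squared[of r] by (simp add: abcd)
  have "rot r $ 1 $ 1 = 1" "rot r $ 2 $ 2 = 1" using assms(2) by (simp_all add: mat_def)
  then have "a\<^sup>2 + b\<^sup>2 - c\<^sup>2 - d\<^sup>2 = 1" "a\<^sup>2 - b\<^sup>2 + c\<^sup>2 - d\<^sup>2 = 1"
    by (simp_all add: rot_def Let_def vector_3 abcd)
  then have "c\<^sup>2 + d\<^sup>2 = 0" "b\<^sup>2 + d\<^sup>2 = 0" using n by linarith+
  then have bcd: "b = 0" "c = 0" "d = 0" by (simp_all add: sum_power2_eq_zero_iff)
  then have "a = 1 \<or> a = - 1" using n by (simp add: power2_eq_1_iff)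
  then show ?thesis using bcd by (auto simp: abcd prod_eq_iff complex_eq_iff)
qed

lemma rot_eq_iff:
  assumes "norm p = 1" "norm q = 1"
  shows "rot p = rot q \<longleftrightarrow> q = p \<or> q = - p"
proof
  assume "rot p = rot q"
  then have "rot (qcnj p \<odot> q) = rot (qcnj p \<odot> p)" by (simp add: rot_qmul)
  then have "rot (qcnj p \<odot> q) = mat 1" using qmul_qcnj[OF assms(1)] by (simp add: rot_one)
  then have "qcnj p \<odot> q = qone \<or> qcnj p \<odot> q = - qone"
    using assms by (intro rot_eq_one) (simp_all add: norm_qmul)
  then have "p \<odot> (qcnj p \<odot> q) = p \<or> p \<odot> (qcnj p \<odot> q) = - p"
    by (metis qmul_minus(2) qmul_one(2))
  then show "q = p \<or> q = - p" by (simp add: qmul_qcnj_cancel assms)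
qed auto

text \<open>The rotation by an angle \<open>\<theta>\<close> about the first axis comes from the unit complex number with
  argument \<open>\<theta>/2\<close>, a square root of \<open>cos \<theta> + i sin \<theta>\<close>.\<close>

lemma SO3_fixing_e1:
  assumes A: "A \<in> carrier SO3" and fix1: "A *v axis 1 1 = axis 1 1"
  shows "\<exists>\<alpha>. cmod \<alpha> = 1 \<and> A = rot (\<alpha>, 0)"
proof -
  have o: "transpose A ** A = mat 1" "A ** transpose A = mat 1" and d: "det A = 1"
    using A by (simp_all add: SO3_def rotation_matrix_def orthogonal_matrix_def)
  have c1: "A$1$1 = 1" "A$2$1 = 0" "A$3$1 = 0"
    using fix1 by (auto simp: vec_eq_iff forall_3 matrix_vector_mult_def sum_3 axis_def)
  have "(A ** transpose A)$1$1 = 1" using o by (simp add: mat_def)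
  then have "(A$1$2)\<^sup>2 + (A$1$3)\<^sup>2 = 0"
    by (simp add: matrix_matrix_mult_def transpose_def sum_3 c1 power2_eq_square)
  then have r1: "A$1$2 = 0" "A$1$3 = 0" by (simp_all add: sum_power2_eq_zero_iff)
  define c s c' s' where cs: "c = A$2$2" "s = A$3$2" "c' = A$3$3" "s' = A$2$3"
  have "(transpose A ** A)$2$2 = 1" "(transpose A ** A)$3$3 = 1" "(transpose A ** A)$2$3 = 0"
    using o by (simp_all add: mat_def)
  then have e: "c\<^sup>2 + s\<^sup>2 = 1" "c'\<^sup>2 + s'\<^sup>2 = 1" "c * s' + s * c' = 0"
    by (simp_all add: matrix_matrix_mult_def transpose_def sum_3 r1 cs power2_eq_square)
  have "c * c' - s' * s = 1" using d by (simp add: det_3 c1 r1 cs)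
  then have "(c - c')\<^sup>2 + (s + s')\<^sup>2 = 0" using e by (simp add: power2_diff power2_sum algebra_simps)
  then have c': "c' = c" "s' = - s" by (simp_all add: sum_power2_eq_zero_iff)
  define \<alpha> where "\<alpha> = csqrt (Complex c s)"
  have sq: "\<alpha>\<^sup>2 = Complex c s" by (simp add: \<alpha>_def)
  then have "cmod (\<alpha>\<^sup>2) = 1" using e(1) by (simp add: cmod_def)
  then have "(cmod \<alpha>)\<^sup>2 = 1" by (simp add: norm_power)
  then have n: "cmod \<alpha> = 1" using power2_eq_1_iff[of "cmod \<alpha>"] norm_ge_zero[of \<alpha>] by auto
  have "(Re \<alpha>)\<^sup>2 - (Im \<alpha>)\<^sup>2 = c" "2 * (Re \<alpha> * Im \<alpha>) = s"
    using arg_cong[OF sq, of Re] arg_cong[OF sq, of Im] by (simp_all add: Re_power2 Im_power2)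
  moreover have "(Re \<alpha>)\<^sup>2 + (Im \<alpha>)\<^sup>2 = 1" using cmod_power2[of \<alpha>] n by simp
  ultimately have "A = rot (\<alpha>, 0)"
    by (simp add: vec_eq_iff forall_3 rot_def Let_def vector_3 c1 r1 cs[symmetric] c')
  then show ?thesis using n by blast
qed

lemma imq_minus: "imq (- v) = - imq v"
  by (simp add: imq_def complex_eq_iff)

lemma imq_square: "imq v \<odot> imq v = - ((norm v)\<^sup>2 *\<^sub>R qone)"
proof -
  have "(norm v)\<^sup>2 = (v$1)\<^sup>2 + (v$2)\<^sup>2 + (v$3)\<^sup>2"
    by (simp add: norm_vec_def L2_set_def sum_3)
  then show ?thesis
    by (simp add: imq_def qmul_def complex_eq_iff power2_eq_square)
qed

text \<open>For unit imaginary \<open>u, v\<close> the quaternion \<open>p = 1 - v u\<close> satisfies \<open>p u = u + v = v p\<close>, because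
  \<open>u\<^sup>2 = v\<^sup>2 = -1\<close>. It vanishes only when \<open>v = - u\<close>, and otherwise can be normalised.\<close>

lemma rot_takes_to_nonopposite:
  assumes "norm u = 1" "norm v = 1" "v \<noteq> - u"
  shows "\<exists>q. norm q = 1 \<and> rot q *v u = v"
proof -
  define p where "p = qone - imq v \<odot> imq u"
  have sq: "imq u \<odot> imq u = - qone" "imq v \<odot> imq v = - qone"
    using imq_square[of u] imq_square[of v] assms by simp_all
  have "p \<odot> imq u = imq u - imq v \<odot> (imq u \<odot> imq u)"
    by (simp add: p_def qmul_diff qmul_assoc)
  then have pu: "p \<odot> imq u = imq u + imq v" unfolding sq qmul_minus qmul_one by simp
  have "imq v \<odot> p = imq v - (imq v \<odot> imq v) \<odot> imq u"
    by (simp add: p_def qmul_diff qmul_assoc)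
  then have "imq v \<odot> p = imq v + imq u" unfolding sq qmul_minus qmul_one by simp
  with pu have comm: "p \<odot> imq u = imq v \<odot> p" by simp
  have "p \<noteq> 0"
  proof
    assume "p = 0"
    then have "imq u + imq v = 0" using pu by (simp add: qmul_def zero_prod_def)
    then have "imq v = imq (- u)" by (simp add: imq_minus eq_neg_iff_add_eq_0 add.commute)
    then show False using assms(3) by (simp add: imq_inject)
  qed
  define q where "q = (1 / norm p) *\<^sub>R p"
  have nq: "norm q = 1" using \<open>p \<noteq> 0\<close> by (simp add: q_def)
  have "q \<odot> imq u = imq v \<odot> q" using comm by (simp add: q_def)
  then have "q \<odot> imq u \<odot> qcnj q = imq v" using nq by (simp add: qmul_qcnj_cancel)
  then have "rot q *v u = v" by (simp add: imq_rot[symmetric] imq_inject)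
  then show ?thesis using nq by blast
qed

lemma rot_transitive:
  assumes "norm u = 1" "norm v = 1"
  shows "\<exists>q. norm q = 1 \<and> rot q *v u = v"
proof (cases "v = - u")
  case False
  then show ?thesis using rot_takes_to_nonopposite assms by blast
next
  case True
  obtain t :: "real^3" where t: "norm t = 1" "t \<noteq> u" "t \<noteq> - u"
  proof (cases "u = axis 1 1 \<or> u = - axis 1 1")
    case True
    have "axis 2 1 \<noteq> u" "axis 2 1 \<noteq> - u"
      using True by (auto simp: vec_eq_iff forall_3 axis_def)
    then show ?thesis by (intro that[of "axis 2 1"]) (auto simp: norm_axis_1)
  next
    case False
    then show ?thesis by (intro that[of "axis 1 1"]) (auto simp: norm_axis_1)
  qed
  obtain p where p: "norm p = 1" "rot p *v u = t" using rot_takes_to_nonopposite[of u t] t assms by blast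
  obtain q where q: "norm q = 1" "rot q *v t = v" using rot_takes_to_nonopposite[of t v] t assms True by auto
  have "norm (q \<odot> p) = 1" "rot (q \<odot> p) *v u = v"
    using p q by (simp_all add: norm_qmul rot_qmul matrix_vector_mul_assoc[symmetric])
  then show ?thesis by blast
qed

text \<open>By transitivity one can first correct a rotation so that it fixes the first axis, and then it is
  a rotation about that axis.\<close>

lemma rot_surj:
  assumes A: "A \<in> carrier SO3"
  shows "\<exists>q. norm q = 1 \<and> rot q = A"
proof -
  have o: "orthogonal_matrix A" using A by (simp add: SO3_def rotation_matrix_def)
  then have "orthogonal_transformation ((*v) A)" by (simp add: orthogonal_transformation_matrix)
  then have "norm (A *v axis 1 1) = norm (axis 1 1 :: real^3)"
    by (simp add: orthogonal_transformation)
  then have "norm (A *v axis 1 1) = 1" by (simp add: norm_axis_1)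
  then obtain q where q: "norm q = 1" "rot q *v axis 1 1 = A *v axis 1 1"
    using rot_transitive[of "axis 1 1"] norm_axis_1 by blast
  interpret SO: group SO3 by (rule group_SO3)
  define B where "B = rot (qcnj q) ** A"
  have "B \<in> carrier SO3"
    using SO.m_closed[OF rot_in_SO3 A, of "qcnj q"] q by (simp add: B_def SO3_def)
  moreover have "B *v axis 1 1 = axis 1 1"
    using qmul_qcnj[OF q(1)]
    by (simp add: B_def matrix_vector_mul_assoc[symmetric] q(2)[symmetric])
      (simp add: matrix_vector_mul_assoc rot_qmul[symmetric] rot_one)
  ultimately obtain \<alpha> where \<alpha>: "cmod \<alpha> = 1" "B = rot (\<alpha>, 0)" using SO3_fixing_e1 by blast
  have "rot (q \<odot> (\<alpha>, 0)) = rot q ** B" by (simp add: rot_qmul \<alpha>)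
  also have "\<dots> = rot (q \<odot> qcnj q) ** A" by (simp add: B_def matrix_mul_assoc rot_qmul)
  also have "\<dots> = A" by (simp add: qmul_qcnj q rot_one)
  finally show ?thesis using q \<alpha> by (intro exI[of _ "q \<odot> (\<alpha>, 0)"]) (simp add: norm_qmul norm_Pair)
qed

lemma SO3_simps: "A \<otimes>\<^bsub>SO3\<^esub> B = A ** B" "\<one>\<^bsub>SO3\<^esub> = mat 1"
  by (simp_all add: SO3_def)

lemma SO3_inv:
  assumes "A \<in> carrier SO3"
  shows "inv\<^bsub>SO3\<^esub> A = transpose A"
proof -
  interpret SO: group SO3 by (rule group_SO3)
  have "orthogonal_matrix A" "det A = 1" using assms by (simp_all add: SO3_def rotation_matrix_def)
  then have "transpose A \<in> carrier SO3" "transpose A \<otimes>\<^bsub>SO3\<^esub> A = \<one>\<^bsub>SO3\<^esub>"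
    by (simp_all add: SO3_def rotation_matrix_def orthogonal_matrix_transpose orthogonal_matrix_def)
  then show ?thesis using SO.inv_equality assms by metis
qed

lemma SO3_inv_rot: "norm q = 1 \<Longrightarrow> inv\<^bsub>SO3\<^esub> (rot q) = rot (qcnj q)"
  by (simp add: SO3_inv rot_in_SO3 rot_qcnj)

lemma continuous_on_rot: "continuous_on S rot"
proof -
  have "\<forall>i j. continuous_on S (\<lambda>q. rot q $ i $ j)"
    unfolding forall_3 rot_def Let_def vector_3 by (intro conjI continuous_intros)
  then have "continuous_on S (\<lambda>q. \<chi> i j. rot q $ i $ j)"
    by (intro continuous_on_vec_lambda) auto
  then show ?thesis by simp
qed

lemma SO3_mult_continuous:
  "continuous_map (prod_topology SO3_topology SO3_topology) SO3_topology (\<lambda>(x, y). x \<otimes>\<^bsub>SO3\<^esub> y)"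
proof -
  interpret SO: group SO3 by (rule group_SO3)
  have "continuous_on (carrier SO3 \<times> carrier SO3) (\<lambda>z. \<chi> i j. (fst z ** snd z :: real^3^3) $ i $ j)"
    unfolding matrix_matrix_mult_def by (simp, intro continuous_intros)
  then show ?thesis
    using SO.m_closed
    by (auto simp: SO3_topology_def prod_topology_subtopology_eu SO3_simps case_prod_unfold)
qed

lemma SO3_inv_continuous: "continuous_map SO3_topology SO3_topology (\<lambda>x. inv\<^bsub>SO3\<^esub> x)"
proof -
  interpret SO: group SO3 by (rule group_SO3)
  have "continuous_on (carrier SO3) (\<lambda>A. transpose A)"
    unfolding transpose_def by (intro continuous_intros)
  then have "continuous_on (carrier SO3) (\<lambda>x. inv\<^bsub>SO3\<^esub> x)"
    by (rule continuous_on_eq) (simp add: SO3_inv)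
  then show ?thesis using SO.inv_closed by (auto simp: SO3_topology_def)
qed

lemma topspace_SO3 [simp]: "topspace SO3_topology = carrier SO3"
  by (simp add: SO3_topology_def)

definition spin_lift :: "(real^3^3) set \<Rightarrow> quat set" where
  "spin_lift G = {q. norm q = 1 \<and> rot q \<in> G}"

text \<open>A model of the bicoset space, but with the three-sphere instead of \<open>SO(3)\<close> as its source: the
  two-sided action of a group of unit quaternions is linear, so that explicit formulas for the
  invariants can be given.\<close>

definition bicoset_orbit_map :: "'b topology \<Rightarrow> quat set \<Rightarrow> (quat \<Rightarrow> 'b) \<Rightarrow> bool" where
  "bicoset_orbit_map X \<Gamma> F \<longleftrightarrow>
     continuous_map (top_of_set (sphere 0 1)) X F \<and> F ` sphere 0 1 = topspace X \<and>
     (\<forall>x\<in>sphere 0 1. \<forall>y\<in>sphere 0 1. F x = F y \<longleftrightarrow> (\<exists>a\<in>\<Gamma>. \<exists>b\<in>\<Gamma>. y = a \<odot> x \<odot> b))"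

text \<open>The orbit map descends first along the double cover to \<open>SO(3)\<close>, since \<open>\<Gamma>\<close> contains \<open>-1\<close>,
  and then to the bicoset space, where it becomes injective. A continuous bijection from a compact
  space to a Hausdorff space is a homeomorphism.\<close>

theorem carries_bicoset_structure_if_orbit_map:
  assumes G: "subgroup G SO3" "finite G" and X: "Hausdorff_space X"
    and F: "bicoset_orbit_map X (spin_lift G) F"
  shows "carries_bicoset_structure X G"
proof -
  let ?S = "top_of_set (sphere (0::quat) 1)" and ?B = "bicoset SO3 G"
    and ?Q = "bicoset_space SO3 SO3_topology G"
  have Fc: "continuous_map ?S X F" and Fs: "F ` sphere 0 1 = topspace X"
    and Ff: "\<And>x y. norm x = 1 \<Longrightarrow> norm y = 1 \<Longrightarrow>
        F x = F y \<longleftrightarrow> (\<exists>a\<in>spin_lift G. \<exists>b\<in>spin_lift G. y = a \<odot> x \<odot> b)"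
    using F by (auto simp: bicoset_orbit_map_def)
  have GS: "G \<subseteq> carrier SO3" using G(1) by (rule subgroup.subset)
  have bic: "?B (rot x) = ?B (rot y) \<longleftrightarrow> F x = F y" if n: "norm x = 1" "norm y = 1" for x y
  proof -
    have "(\<exists>g\<in>G. \<exists>h\<in>G. rot y = g \<otimes>\<^bsub>SO3\<^esub> rot x \<otimes>\<^bsub>SO3\<^esub> h) \<longleftrightarrow>
        (\<exists>a\<in>spin_lift G. \<exists>b\<in>spin_lift G. y = a \<odot> x \<odot> b)"
    proof
      assume "\<exists>g\<in>G. \<exists>h\<in>G. rot y = g \<otimes>\<^bsub>SO3\<^esub> rot x \<otimes>\<^bsub>SO3\<^esub> h"
      then obtain g h where gh: "g \<in> G" "h \<in> G" "rot y = g ** rot x ** h" by (auto simp: SO3_simps)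
      then obtain a b where ab: "norm a = 1" "rot a = g" "norm b = 1" "rot b = h"
        using rot_surj GS by blast
      then have "rot (a \<odot> x \<odot> b) = rot y" by (simp add: rot_qmul gh)
      \<comment> \<open>The equation in \<open>SO(3)\<close> determines \<open>a x b\<close> only up to sign; the sign is absorbed into \<open>a\<close>.\<close>
      then have "y = a \<odot> x \<odot> b \<or> y = (- a) \<odot> x \<odot> b"
        using rot_eq_iff[of "a \<odot> x \<odot> b" y] n ab by (simp add: norm_qmul)
      moreover have "a \<in> spin_lift G" "- a \<in> spin_lift G" "b \<in> spin_lift G"
        using ab gh by (auto simp: spin_lift_def)
      ultimately show "\<exists>a\<in>spin_lift G. \<exists>b\<in>spin_lift G. y = a \<odot> x \<odot> b" by blast
    next
      assume "\<exists>a\<in>spin_lift G. \<exists>b\<in>spin_lift G. y = a \<odot> x \<odot> b"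
      then obtain a b where "rot a \<in> G" "rot b \<in> G" "y = a \<odot> x \<odot> b"
        unfolding spin_lift_def by blast
      then show "\<exists>g\<in>G. \<exists>h\<in>G. rot y = g \<otimes>\<^bsub>SO3\<^esub> rot x \<otimes>\<^bsub>SO3\<^esub> h"
        by (intro bexI[of _ "rot a"] bexI[of _ "rot b"]) (simp_all add: SO3_simps rot_qmul)
    qed
    then show ?thesis
      using bicoset_eq_iff[OF group_SO3 G(1) rot_in_SO3 rot_in_SO3, OF n] Ff[OF n] by simp
  qed
  have rc: "continuous_map ?S SO3_topology rot"
    unfolding SO3_topology_def using continuous_on_rot rot_in_SO3 by (auto simp: Pi_iff)
  have ri: "rot ` sphere 0 1 = carrier SO3" using rot_in_SO3 rot_surj by fastforce
  have cS: "compact_space ?S" by (intro compact_space_subtopology) simp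
  have qr: "quotient_map ?S SO3_topology rot"
    by (rule continuous_imp_quotient_map)
      (use rc ri cS in \<open>auto simp: SO3_topology_def Hausdorff_space_subtopology\<close>)
  have qB: "quotient_map SO3_topology ?Q ?B"
    unfolding bicoset_space_def by (rule quotient_map_quotient_topology)
  have q: "quotient_map ?S ?Q (?B \<circ> rot)" using quotient_map_compose[OF qr qB] .
  obtain h where h: "continuous_map ?Q X h" "h ` topspace ?Q = F ` topspace ?S"
      "\<And>x. x \<in> topspace ?S \<Longrightarrow> h ((?B \<circ> rot) x) = F x"
    by (rule quotient_map_lift_exists[OF q Fc]) (use bic in auto)
  have top: "topspace ?Q = (?B \<circ> rot) ` sphere 0 1"
    using quotient_imp_surjective_map[OF q] by simp
  have inj: "inj_on h (topspace ?Q)"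
    unfolding top inj_on_def using h(3) bic by auto
  have cQ: "compact_space ?Q"
    using image_compactin[OF _ quotient_imp_continuous_map[OF q]] cS top
    by (metis compact_space_def topspace_euclidean_subtopology)
  have homeo: "homeomorphic_map ?Q X h"
    by (rule continuous_imp_homeomorphic_map) (use h inj cQ X Fs in auto)
  obtain M where M: "bicoset_structure SO3 G M" using bicoset_structure_exists[OF group_SO3 G(1)] by blast
  have M': "multivalued_topological_group (card G) ?Q M"
    by (rule bicoset_structure_multivalued_group[OF group_SO3 G topspace_SO3
        SO3_mult_continuous SO3_inv_continuous M])
  obtain N where "transported_structure ?Q h M N" "multivalued_topological_group (card G) X N"
    using transport_multivalued_group[OF M' homeo] by blast
  then show ?thesis unfolding carries_bicoset_structure_def using M M' homeo by blast
qed

text \<open>Conjugation by \<open>s\<close> carries orbits of \<open>\<Gamma>\<close> to orbits of the conjugate group, so the orbit map is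
  composed with the inverse conjugation.\<close>

lemma bicoset_orbit_map_conj:
  assumes s: "norm s = 1" and F: "bicoset_orbit_map X \<Gamma> F"
  shows "bicoset_orbit_map X ((\<lambda>g. s \<odot> g \<odot> qcnj s) ` \<Gamma>) (\<lambda>x. F (qcnj s \<odot> x \<odot> s))"
proof -
  let ?c = "\<lambda>x. qcnj s \<odot> x \<odot> s" and ?S = "top_of_set (sphere (0::quat) 1)"
  have cc: "continuous_map ?S ?S ?c"
    using s by (auto intro!: continuous_intros simp: norm_qmul)
  have im: "?c ` sphere 0 1 = sphere 0 1"
  proof -
    have "x \<in> ?c ` sphere 0 1" if "x \<in> sphere 0 1" for x
      by (rule image_eqI[of _ _ "s \<odot> x \<odot> qcnj s"])
        (use that s in \<open>simp_all add: norm_qmul qmul_assoc qmul_qcnj qmul_qcnj_cancel\<close>)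
    then show ?thesis using s by (auto simp: norm_qmul)
  qed
  have eq: "?c y = a \<odot> ?c x \<odot> b \<longleftrightarrow> y = (s \<odot> a \<odot> qcnj s) \<odot> x \<odot> (s \<odot> b \<odot> qcnj s)" for a b x y
  proof -
    have "?c y = a \<odot> ?c x \<odot> b \<longleftrightarrow> s \<odot> ?c y \<odot> qcnj s = s \<odot> (a \<odot> ?c x \<odot> b) \<odot> qcnj s"
    proof
      assume "s \<odot> ?c y \<odot> qcnj s = s \<odot> (a \<odot> ?c x \<odot> b) \<odot> qcnj s"
      then have "qcnj s \<odot> (s \<odot> ?c y \<odot> qcnj s) \<odot> s = qcnj s \<odot> (s \<odot> (a \<odot> ?c x \<odot> b) \<odot> qcnj s) \<odot> s" by simp
      then show "?c y = a \<odot> ?c x \<odot> b"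
        using s by (simp add: qmul_assoc qmul_qcnj qmul_qcnj_cancel)
    qed simp
    then show ?thesis using s by (simp add: qmul_assoc qmul_qcnj qmul_qcnj_cancel)
  qed
  have "continuous_map ?S X (F \<circ> ?c)"
    using continuous_map_compose[OF cc] F by (auto simp: bicoset_orbit_map_def)
  moreover have "(F \<circ> ?c) ` sphere 0 1 = topspace X"
    using im F by (simp only: bicoset_orbit_map_def image_comp[symmetric])
  moreover have "F (?c x) = F (?c y) \<longleftrightarrow>
      (\<exists>a\<in>(\<lambda>g. s \<odot> g \<odot> qcnj s) ` \<Gamma>. \<exists>b\<in>(\<lambda>g. s \<odot> g \<odot> qcnj s) ` \<Gamma>. y = a \<odot> x \<odot> b)"
    if "x \<in> sphere 0 1" "y \<in> sphere 0 1" for x y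
  proof -
    have "?c x \<in> sphere 0 1" "?c y \<in> sphere 0 1" using im that by blast+
    then have "F (?c x) = F (?c y) \<longleftrightarrow> (\<exists>a\<in>\<Gamma>. \<exists>b\<in>\<Gamma>. ?c y = a \<odot> ?c x \<odot> b)"
      using F by (auto simp: bicoset_orbit_map_def)
    then show ?thesis unfolding eq by blast
  qed
  ultimately show ?thesis unfolding bicoset_orbit_map_def comp_def by blast
qed

lemma spin_lift_conj:
  assumes s: "norm s = 1" and H: "H \<subseteq> carrier SO3"
  shows "spin_lift ((\<lambda>A. rot s \<otimes>\<^bsub>SO3\<^esub> A \<otimes>\<^bsub>SO3\<^esub> inv\<^bsub>SO3\<^esub> (rot s)) ` H) =
    (\<lambda>g. s \<odot> g \<odot> qcnj s) ` spin_lift H"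
proof -
  have eq: "rot s \<otimes>\<^bsub>SO3\<^esub> rot g \<otimes>\<^bsub>SO3\<^esub> inv\<^bsub>SO3\<^esub> (rot s) = rot (s \<odot> g \<odot> qcnj s)" for g
    using s by (simp add: SO3_simps SO3_inv_rot rot_qmul)
  show ?thesis
  proof
    show "(\<lambda>g. s \<odot> g \<odot> qcnj s) ` spin_lift H \<subseteq>
        spin_lift ((\<lambda>A. rot s \<otimes>\<^bsub>SO3\<^esub> A \<otimes>\<^bsub>SO3\<^esub> inv\<^bsub>SO3\<^esub> (rot s)) ` H)"
    proof
      fix q assume "q \<in> (\<lambda>g. s \<odot> g \<odot> qcnj s) ` spin_lift H"
      then obtain g where g: "norm g = 1" "rot g \<in> H" "q = s \<odot> g \<odot> qcnj s" unfolding spin_lift_def by blast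
      then have "norm q = 1" using s by (simp add: norm_qmul)
      then show "q \<in> spin_lift ((\<lambda>A. rot s \<otimes>\<^bsub>SO3\<^esub> A \<otimes>\<^bsub>SO3\<^esub> inv\<^bsub>SO3\<^esub> (rot s)) ` H)"
        unfolding spin_lift_def
      proof (intro CollectI conjI)
        show "rot q \<in> (\<lambda>A. rot s \<otimes>\<^bsub>SO3\<^esub> A \<otimes>\<^bsub>SO3\<^esub> inv\<^bsub>SO3\<^esub> (rot s)) ` H"
          by (rule image_eqI[OF _ g(2)]) (simp only: g(3) eq)
      qed
    qed
    show "spin_lift ((\<lambda>A. rot s \<otimes>\<^bsub>SO3\<^esub> A \<otimes>\<^bsub>SO3\<^esub> inv\<^bsub>SO3\<^esub> (rot s)) ` H) \<subseteq>
        (\<lambda>g. s \<odot> g \<odot> qcnj s) ` spin_lift H"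
    proof
      fix q assume "q \<in> spin_lift ((\<lambda>A. rot s \<otimes>\<^bsub>SO3\<^esub> A \<otimes>\<^bsub>SO3\<^esub> inv\<^bsub>SO3\<^esub> (rot s)) ` H)"
      then obtain A where A: "norm q = 1" "A \<in> H" "rot q = rot s ** A ** rot (qcnj s)"
        using s by (auto simp: spin_lift_def SO3_simps SO3_inv_rot)
      have "rot (qcnj s \<odot> q \<odot> s) = rot (qcnj s \<odot> s) ** A ** rot (qcnj s \<odot> s)"
        by (simp add: rot_qmul A matrix_mul_assoc)
      then have "rot (qcnj s \<odot> q \<odot> s) = A" using s by (simp add: qmul_qcnj rot_one)
      then have "qcnj s \<odot> q \<odot> s \<in> spin_lift H" using A s by (simp add: spin_lift_def norm_qmul)
      moreover have "q = s \<odot> (qcnj s \<odot> q \<odot> s) \<odot> qcnj s"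
        using s by (simp add: qmul_assoc qmul_qcnj qmul_qcnj_cancel)
      ultimately show "q \<in> (\<lambda>g. s \<odot> g \<odot> qcnj s) ` spin_lift H" by blast
    qed
  qed
qed

lemma group_hom_conj_SO3:
  assumes "Q \<in> carrier SO3"
  shows "group_hom SO3 SO3 (\<lambda>A. Q \<otimes>\<^bsub>SO3\<^esub> A \<otimes>\<^bsub>SO3\<^esub> inv\<^bsub>SO3\<^esub> Q)"
proof -
  interpret SO: group SO3 by (rule group_SO3)
  have "inv\<^bsub>SO3\<^esub> Q \<otimes>\<^bsub>SO3\<^esub> (Q \<otimes>\<^bsub>SO3\<^esub> C) = C" if "C \<in> carrier SO3" for C
    using that assms by (simp add: SO.m_assoc[symmetric])
  then show ?thesis
    using assms by unfold_locales (auto simp: hom_def SO.m_assoc)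
qed

lemma carries_bicoset_structure_conjugate:
  assumes H: "subgroup H SO3" "finite H" and X: "Hausdorff_space X"
    and F: "bicoset_orbit_map X (spin_lift H) F" and G: "conjugate_in SO3 H G"
  shows "carries_bicoset_structure X G"
proof -
  obtain Q where Q: "Q \<in> carrier SO3" "G = (\<lambda>A. Q \<otimes>\<^bsub>SO3\<^esub> A \<otimes>\<^bsub>SO3\<^esub> inv\<^bsub>SO3\<^esub> Q) ` H"
    using G by (auto simp: conjugate_in_def)
  obtain s where s: "norm s = 1" "rot s = Q" using rot_surj Q by blast
  have "bicoset_orbit_map X (spin_lift G) (\<lambda>x. F (qcnj s \<odot> x \<odot> s))"
    using bicoset_orbit_map_conj[OF s(1) F] spin_lift_conj[OF s(1), of H] subgroup.subset[OF H(1)]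
    by (simp add: Q(2) s(2))
  then show ?thesis
    using carries_bicoset_structure_if_orbit_map[OF _ _ X] group_hom.subgroup_img_is_subgroup[OF group_hom_conj_SO3[OF Q(1)] H(1)] H(2) Q(2)
    by blast
qed

section \<open>Power maps and foldings\<close>

text \<open>All orbit maps below are built from pieces of this kind: such maps compose, can be applied to the
  two coordinates of a pair separately, and restrict to surjections of unit spheres.\<close>

definition norm_onto_map :: "('a::real_normed_vector \<Rightarrow> 'b::real_normed_vector) \<Rightarrow> bool" where
  "norm_onto_map f \<longleftrightarrow> continuous_on UNIV f \<and> (\<forall>x. norm (f x) = norm x) \<and> surj f"

lemma norm_onto_map_compose:
  assumes "norm_onto_map f" "norm_onto_map g"
  shows "norm_onto_map (\<lambda>x. g (f x))"
proof -
  have "surj (g \<circ> f)" using assms comp_surj[of f g] unfolding norm_onto_map_def by simp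
  moreover have "continuous_on UNIV (g \<circ> f)"
    using assms unfolding norm_onto_map_def by (intro continuous_on_compose) (auto intro: continuous_on_subset)
  ultimately show ?thesis using assms unfolding norm_onto_map_def by (simp add: comp_def)
qed

lemma norm_onto_map_Pair:
  assumes "norm_onto_map f" "norm_onto_map g"
  shows "norm_onto_map (\<lambda>x. (f (fst x), g (snd x)))"
  unfolding norm_onto_map_def
proof (intro conjI allI)
  have "continuous_on UNIV f" "continuous_on UNIV g" using assms by (simp_all add: norm_onto_map_def)
  then show "continuous_on UNIV (\<lambda>x. (f (fst x), g (snd x)))"
    by (auto intro!: continuous_intros elim: continuous_on_compose2)
  show "norm (f (fst x), g (snd x)) = norm x" for x
    using assms by (simp add: norm_onto_map_def norm_prod_def)
  have "\<exists>x. y = (f (fst x), g (snd x))" for y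
  proof -
    obtain u v where "fst y = f u" "snd y = g v"
      using assms unfolding norm_onto_map_def surj_def by metis
    then show ?thesis by (intro exI[of _ "(u, v)"]) (simp add: prod_eq_iff)
  qed
  then show "surj (\<lambda>x. (f (fst x), g (snd x)))" unfolding surj_def by blast
qed

text \<open>The power map with the modulus left unchanged. For \<open>n > 1\<close> the value at \<open>0\<close> is \<open>0/0 = 0\<close>, which
  makes the map continuous there.\<close>

definition pw :: "nat \<Rightarrow> complex \<Rightarrow> complex" where
  "pw n z = z ^ n / of_real (norm z ^ (n - 1))"

lemma norm_pw [simp]: "n > 0 \<Longrightarrow> norm (pw n z) = norm z"
  by (cases n) (auto simp: pw_def norm_divide norm_mult norm_power)

lemma pw_zero [simp]: "n > 0 \<Longrightarrow> pw n 0 = 0"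
  using norm_pw[of n 0] by (simp del: norm_pw)

lemma pw_mult: "norm \<alpha> = 1 \<Longrightarrow> pw n (\<alpha> * z) = \<alpha> ^ n * pw n z"
  by (simp add: pw_def norm_mult power_mult_distrib)

lemma pw_minus: "pw n (- z) = (- 1) ^ n * pw n z"
  using pw_mult[of "- 1" n z] by simp

lemma pw_cnj: "pw n (cnj z) = cnj (pw n z)"
  by (simp add: pw_def)

lemma norm_eq_1_if_power:
  assumes "norm (\<mu> ^ n) = 1" "n > 0"
  shows "norm (\<mu> :: complex) = 1"
  using assms power_eq_iff_eq_base[of n "norm \<mu>" 1] by (simp add: norm_power)

text \<open>The power map is the quotient of the plane by the rotations through roots of unity. Admitting a
  factor \<open>\<epsilon>\<close> is useful because in \<open>\<real>P\<^sup>3\<close> values are compared up to a common sign.\<close>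

lemma pw_eq_iff:
  assumes n: "n > 0" and \<epsilon>: "norm \<epsilon> = 1"
  shows "pw n z' = \<epsilon> * pw n z \<longleftrightarrow> (\<exists>\<mu>. \<mu> ^ n = \<epsilon> \<and> z' = \<mu> * z)"
proof
  assume eq: "pw n z' = \<epsilon> * pw n z"
  then have nz: "norm z' = norm z" using norm_pw[OF n, of z'] norm_pw[OF n, of z] \<epsilon> by (simp add: norm_mult)
  show "\<exists>\<mu>. \<mu> ^ n = \<epsilon> \<and> z' = \<mu> * z"
  proof (cases "z = 0")
    case True
    obtain \<eta> where "\<epsilon> = \<eta> ^ n" using exists_complex_root[of n \<epsilon>] n by blast
    then show ?thesis using True nz by auto
  next
    case False
    have "z' ^ n = \<epsilon> * z ^ n" using eq False nz by (simp add: pw_def)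
    then have "(z' / z) ^ n = \<epsilon>" using False by (simp add: power_divide)
    then show ?thesis using False by (intro exI[of _ "z' / z"]) simp
  qed
next
  assume "\<exists>\<mu>. \<mu> ^ n = \<epsilon> \<and> z' = \<mu> * z"
  then show "pw n z' = \<epsilon> * pw n z" using pw_mult norm_eq_1_if_power[OF _ n] \<epsilon> by auto
qed

lemma norm_onto_map_pw:
  assumes n: "n > 0"
  shows "norm_onto_map (pw n)"
  unfolding norm_onto_map_def
proof (intro conjI allI)
  have "isCont (pw n) z" for z
  proof (cases "z = 0")
    case False
    then show ?thesis unfolding pw_def by (intro continuous_intros) auto
  next
    case True
    have "((\<lambda>z. norm (pw n z)) \<longlongrightarrow> 0) (at 0)"
      using n by (auto intro!: tendsto_eq_intros)
    then have "(pw n \<longlongrightarrow> 0) (at 0)" by (rule tendsto_norm_zero_cancel)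
    then show ?thesis using True n by (simp add: isCont_def)
  qed
  then show "continuous_on UNIV (pw n)" by (simp add: continuous_at_imp_continuous_on)
  show "norm (pw n x) = norm x" for x using n by simp
  show "surj (pw n)"
  proof -
    have "\<exists>z. u = pw n z" for u
    proof (cases "u = 0")
      case True
      then show ?thesis using n by (intro exI[of _ 0]) simp
    next
      case False
      obtain c where c: "sgn u = c ^ n" using exists_complex_root[of n "sgn u"] n by blast
      have ns: "norm (sgn u) = 1" using False by (simp add: norm_sgn)
      have nc: "norm c = 1" by (rule norm_eq_1_if_power[OF _ n]) (use ns c in metis)
      have "pw n (c * of_real (norm u)) = sgn u * pw n (of_real (norm u))" using pw_mult[OF nc, of n] c by metis
      also have "pw n (of_real (norm u)) = of_real (norm u)"
        using False n by (cases n) (simp_all add: pw_def)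
      finally show ?thesis by (intro exI[of _ "c * of_real (norm u)"]) (simp add: sgn_div_norm scaleR_conv_of_real False)
    qed
    then show ?thesis by (simp add: surj_def)
  qed
qed

lemma pw_2_eq_iff: "pw 2 z' = pw 2 z \<longleftrightarrow> z' = z \<or> z' = - z"
proof -
  have "(\<exists>\<mu>::complex. \<mu>\<^sup>2 = 1 \<and> z' = \<mu> * z) \<longleftrightarrow> z' = z \<or> z' = - z"
    by (auto simp: power2_eq_1_iff)
  then show ?thesis using pw_eq_iff[of 2 1 z' z] by simp
qed

lemma pw_2_cnj_eq_iff: "pw 2 z' = cnj (pw 2 z) \<longleftrightarrow> z' = cnj z \<or> z' = - cnj z"
  using pw_2_eq_iff[of z' "cnj z"] by (simp only: pw_cnj)

definition qpw :: "nat \<Rightarrow> quat \<Rightarrow> quat" where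
  "qpw n x = (pw n (fst x), pw n (snd x))"

lemma norm_onto_map_qpw: "n > 0 \<Longrightarrow> norm_onto_map (qpw n)"
  unfolding qpw_def[abs_def] by (intro norm_onto_map_Pair norm_onto_map_pw)

text \<open>The quotient by simultaneous complex conjugation of both coordinates: conjugation changes the
  sign of the plane of imaginary parts and fixes the real parts, and squaring in that plane forgets
  the sign.\<close>

definition conj_fold :: "quat \<Rightarrow> quat" where
  "conj_fold x = (Complex (Re (fst x)) (Re (snd x)), pw 2 (Complex (Im (fst x)) (Im (snd x))))"

lemma conj_fold_eq_iff:
  "conj_fold x' = conj_fold x \<longleftrightarrow> x' = x \<or> x' = (cnj (fst x), cnj (snd x))"
  by (simp add: conj_fold_def pw_2_eq_iff prod_eq_iff) (auto simp: complex_eq_iff)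

lemma norm_onto_map_conj_fold: "norm_onto_map conj_fold"
proof -
  define s :: "quat \<Rightarrow> quat" where
    "s = (\<lambda>x. (Complex (Re (fst x)) (Re (snd x)), Complex (Im (fst x)) (Im (snd x))))"
  have "s (s x) = x" for x by (simp add: s_def prod_eq_iff)
  then have "surj s" by (rule surjI)
  moreover have "continuous_on UNIV s"
    unfolding s_def Complex_eq by (intro continuous_intros)
  moreover have "norm (s x) = norm x" for x
    by (simp add: s_def norm_prod_def cmod_power2)
  ultimately have s: "norm_onto_map s" by (simp add: norm_onto_map_def)
  have id: "norm_onto_map (\<lambda>z::complex. z)" by (simp add: norm_onto_map_def)
  have "norm_onto_map (\<lambda>x. (\<lambda>x. (fst x, pw 2 (snd x))) (s x))"
    by (rule norm_onto_map_compose[OF s norm_onto_map_Pair[OF id norm_onto_map_pw]]) simp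
  moreover have "(\<lambda>x. (\<lambda>x. (fst x, pw 2 (snd x))) (s x)) = conj_fold"
    by (simp add: s_def conj_fold_def[abs_def])
  ultimately show ?thesis by simp
qed

text \<open>The quotient by the sign changes of an even number of the four real coordinates: squaring both
  complex coordinates forgets their signs, and what remains of the group is simultaneous complex
  conjugation.\<close>

definition even_sign_fold :: "quat \<Rightarrow> quat" where
  "even_sign_fold x = conj_fold (qpw 2 x)"

lemma norm_onto_map_even_sign_fold: "norm_onto_map even_sign_fold"
  unfolding even_sign_fold_def[abs_def]
  by (rule norm_onto_map_compose[OF norm_onto_map_qpw norm_onto_map_conj_fold]) simp

lemma even_sign_fold_eq_iff:
  "even_sign_fold (p', q') = even_sign_fold (p, q) \<longleftrightarrow>
     (p' = p \<or> p' = - p) \<and> (q' = q \<or> q' = - q) \<or>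
     (p' = cnj p \<or> p' = - cnj p) \<and> (q' = cnj q \<or> q' = - cnj q)"
  unfolding even_sign_fold_def conj_fold_eq_iff qpw_def prod.inject fst_conv snd_conv
    pw_2_eq_iff pw_2_cnj_eq_iff by blast

lemma pw_scaleR:
  assumes "r > 0" "n > 0"
  shows "pw n (r *\<^sub>R z) = r *\<^sub>R pw n z"
proof -
  have "pw n (of_real r * z) = of_real r * pw n z"
  proof (cases n)
    case (Suc m)
    then show ?thesis using assms by (simp add: pw_def norm_mult power_mult_distrib)
  qed (use assms in simp)
  then show ?thesis by (simp add: scaleR_conv_of_real)
qed

lemma qpw_scaleR: "r > 0 \<Longrightarrow> n > 0 \<Longrightarrow> qpw n (r *\<^sub>R x) = r *\<^sub>R qpw n x"
  by (simp add: qpw_def pw_scaleR)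

lemma conj_fold_scaleR:
  assumes "r > 0"
  shows "conj_fold (r *\<^sub>R x) = r *\<^sub>R conj_fold x"
proof -
  have "Complex (r * a) (r * b) = r *\<^sub>R Complex a b" for a b by (simp add: complex_eq_iff)
  then show ?thesis using assms by (simp add: conj_fold_def pw_scaleR)
qed

text \<open>For non-negative \<open>a, b\<close> the points \<open>s a + i b\<close> with \<open>s = \<plusminus>1\<close> fill a half plane, on which squaring
  is injective except that it folds the boundary line. So the sign \<open>s\<close> is visible in the square
  unless the point \<open>(a, b)\<close> lies on the boundary of the quadrant.\<close>

lemma pw_2_half_plane:
  assumes "s = 1 \<or> s = - 1" "s' = 1 \<or> s' = - 1" "a \<ge> 0" "b \<ge> 0" "a' \<ge> 0" "b' \<ge> 0"
    and "pw 2 (Complex (s * a) b) = pw 2 (Complex (s' * a') b')"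
  shows "a = a' \<and> b = b' \<and> (s' = s \<or> s' = - s \<and> (a = 0 \<or> b = 0))"
proof -
  have "s * a = s' * a' \<and> b = b' \<or> s * a = - (s' * a') \<and> b = - b'"
    using assms(7) unfolding pw_2_eq_iff by (auto simp: complex_eq_iff)
  then show ?thesis using assms(1-6) by auto
qed

lemma pw_2_flip:
  assumes "a = 0 \<or> b = 0"
  shows "pw 2 (Complex (- a) b) = pw 2 (Complex a b)"
  unfolding pw_2_eq_iff using assms by (auto simp: complex_eq_iff)

lemma pw_2_reflect: "pw 2 (Complex (- a) b) = cnj (pw 2 (Complex a b))"
  unfolding pw_2_cnj_eq_iff by (simp add: complex_eq_iff)

lemma complex_half_plane:
  "\<exists>s a b. (s = 1 \<or> s = - 1) \<and> a \<ge> 0 \<and> b \<ge> 0 \<and> pw 2 z = pw 2 (Complex (s * a) b)"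
proof -
  obtain w where w: "w = z \<or> w = - z" "Im w \<ge> 0" by (cases "Im z \<ge> 0") force+
  then have "pw 2 z = pw 2 w" unfolding pw_2_eq_iff by auto
  moreover have "w = Complex ((if Re w \<ge> 0 then 1 else - 1) * \<bar>Re w\<bar>) (Im w)" by (simp add: complex_eq_iff)
  ultimately show ?thesis using w(2)
    by (intro exI[of _ "if Re w \<ge> 0 then 1 else - 1"] exI[of _ "\<bar>Re w\<bar>"] exI[of _ "Im w"]) simp
qed

lemma even_sign_fold_scaleR: "r > 0 \<Longrightarrow> even_sign_fold (r *\<^sub>R x) = r *\<^sub>R even_sign_fold x"
  by (simp add: even_sign_fold_def qpw_scaleR conj_fold_scaleR)

lemma even_sign_fold_flip:
  assumes "a = 0 \<or> b = 0 \<or> c = 0 \<or> d = 0"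
  shows "even_sign_fold (Complex (- a) b, Complex c d) = even_sign_fold (Complex a b, Complex c d)"
  unfolding even_sign_fold_eq_iff using assms by (auto simp: complex_eq_iff)

text \<open>As for squaring in the half plane: the points with non-negative coordinates form a chamber of
  the group of all sign changes, and one odd sign change is visible unless a coordinate vanishes.\<close>

lemma even_sign_fold_separates:
  assumes "s = 1 \<or> s = - 1" "s' = 1 \<or> s' = - 1" "a \<ge> 0" "b \<ge> 0" "c \<ge> 0" "d \<ge> 0"
    "a' \<ge> 0" "b' \<ge> 0" "c' \<ge> 0" "d' \<ge> 0"
    and "even_sign_fold (Complex (s * a) b, Complex c d) = even_sign_fold (Complex (s' * a') b', Complex c' d')"
  shows "a = a' \<and> b = b' \<and> c = c' \<and> d = d' \<and> (s' = s \<or> s' = - s \<and> (a = 0 \<or> b = 0 \<or> c = 0 \<or> d = 0))"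
proof -
  have "(s * a = s' * a' \<and> b = b' \<or> s * a = - (s' * a') \<and> b = - b') \<and> (c = c' \<and> d = d' \<or> c = - c' \<and> d = - d') \<or>
    (s * a = s' * a' \<and> b = - b' \<or> s * a = - (s' * a') \<and> b = b') \<and> (c = c' \<and> d = - d' \<or> c = - c' \<and> d = d')"
    using assms(11) unfolding even_sign_fold_eq_iff by (simp add: complex_eq_iff)
  then show ?thesis using assms(1-10) by (elim disjE conjE; simp)
qed

lemma even_sign_fold_cover:
  "\<exists>s a b c d. (s = 1 \<or> s = - 1) \<and> a \<ge> 0 \<and> b \<ge> 0 \<and> c \<ge> 0 \<and> d \<ge> 0 \<and>
     even_sign_fold z = even_sign_fold (Complex (s * a) b, Complex c d)"
proof -
  obtain p q where z: "z = (p, q)" by (cases z)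
  obtain p1 q1 where 1: "even_sign_fold z = even_sign_fold (p1, q1)" "Re q1 \<ge> 0" "Im q1 \<ge> 0"
  proof -
    consider "Re q \<ge> 0" "Im q \<ge> 0" | "Re q \<le> 0" "Im q \<le> 0" | "Re q \<ge> 0" "Im q \<le> 0" | "Re q \<le> 0" "Im q \<ge> 0"
      by linarith
    then show ?thesis
    proof cases
      case 1
      then show ?thesis using that[of p q] z by simp
    next
      case 2
      then show ?thesis using that[of p "- q"] unfolding z even_sign_fold_eq_iff by simp
    next
      case 3
      then show ?thesis using that[of "cnj p" "cnj q"] unfolding z even_sign_fold_eq_iff by simp
    next
      case 4
      then show ?thesis using that[of "cnj p" "- cnj q"] unfolding z even_sign_fold_eq_iff by simp
    qed
  qed
  obtain w where w: "w = p1 \<or> w = - p1" "Im w \<ge> 0" by (cases "Im p1 \<ge> 0") force+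
  then have "even_sign_fold z = even_sign_fold (w, q1)" unfolding 1(1) even_sign_fold_eq_iff by auto
  moreover have "w = Complex ((if Re w \<ge> 0 then 1 else - 1) * \<bar>Re w\<bar>) (Im w)" "q1 = Complex (Re q1) (Im q1)"
    by (simp_all add: complex_eq_iff)
  ultimately have "even_sign_fold z = even_sign_fold
      (Complex ((if Re w \<ge> 0 then 1 else - 1) * \<bar>Re w\<bar>) (Im w), Complex (Re q1) (Im q1))" by metis
  then show ?thesis using w(2) 1(2,3)
    by (intro exI[of _ "if Re w \<ge> 0 then 1 else - 1"] exI[of _ "\<bar>Re w\<bar>"] exI[of _ "Im w"]
        exI[of _ "Re q1"] exI[of _ "Im q1"]) simp
qed

text \<open>In these coordinates the exchange of the two complex coordinates becomes the sign change of the
  second one, see \<open>rotate45_symmetries\<close>.\<close>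

definition rotate45 :: "quat \<Rightarrow> quat" where
  "rotate45 x = ((fst x + snd x) / sqrt 2, (fst x - snd x) / sqrt 2)"

lemma rotate45_rotate45 [simp]: "rotate45 (rotate45 x) = x"
proof -
  have "complex_of_real (sqrt 2) * complex_of_real (sqrt 2) = 2"
    by (metis of_real_mult of_real_numeral real_sqrt_mult_self abs_numeral)
  then show ?thesis by (simp add: rotate45_def prod_eq_iff field_simps)
qed

lemma rotate45_inject: "rotate45 x = rotate45 y \<longleftrightarrow> x = y"
  by (metis rotate45_rotate45)

lemma norm_onto_map_rotate45: "norm_onto_map rotate45"
proof -
  have "(norm (rotate45 x))\<^sup>2 = (norm x)\<^sup>2" for x
    unfolding norm_quat_squared by (simp add: rotate45_def power2_eq_square field_simps)
  then have "norm (rotate45 x) = norm x" for x by (simp add: power2_eq_iff_nonneg)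
  moreover have "continuous_on UNIV rotate45"
    unfolding rotate45_def[abs_def] by (intro continuous_intros) auto
  moreover have "surj rotate45" by (rule surjI) (rule rotate45_rotate45)
  ultimately show ?thesis by (simp add: norm_onto_map_def)
qed

lemma rotate45_symmetries:
  "rotate45 (v, u) = (fst (rotate45 (u, v)), - snd (rotate45 (u, v)))"
  "rotate45 (- x) = - rotate45 x"
  "rotate45 (cnj u, cnj v) = (cnj (fst (rotate45 (u, v))), cnj (snd (rotate45 (u, v))))"
  by (simp_all add: rotate45_def prod_eq_iff field_simps)

text \<open>The quotient by the four-group generated by the exchange of the two complex coordinates and by
  simultaneous complex conjugation. After the rotation the exchange is a sign change of the second
  coordinate, which is forgotten by squaring.\<close>

definition swap_conj_fold :: "quat \<Rightarrow> quat" where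
  "swap_conj_fold x = conj_fold (fst (rotate45 x), pw 2 (snd (rotate45 x)))"

lemma norm_onto_map_swap_conj_fold: "norm_onto_map swap_conj_fold"
proof -
  have id: "norm_onto_map (\<lambda>z::complex. z)" by (simp add: norm_onto_map_def)
  have pw: "norm_onto_map (pw 2)" by (rule norm_onto_map_pw) simp
  show ?thesis
    unfolding swap_conj_fold_def[abs_def]
    by (rule norm_onto_map_compose[OF norm_onto_map_compose[OF norm_onto_map_rotate45
        norm_onto_map_Pair[OF id pw]] norm_onto_map_conj_fold])
qed

lemma swap_conj_fold_eq_iff:
  "swap_conj_fold z = swap_conj_fold (u, v) \<longleftrightarrow> z \<in> {(u, v), (v, u), (cnj u, cnj v), (cnj v, cnj u)}"
proof -
  obtain p q where pq: "rotate45 (u, v) = (p, q)" by (cases "rotate45 (u, v)")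
  obtain p' q' where pq': "rotate45 z = (p', q')" by (cases "rotate45 z")
  have "swap_conj_fold z = swap_conj_fold (u, v) \<longleftrightarrow>
      p' = p \<and> (q' = q \<or> q' = - q) \<or> p' = cnj p \<and> (q' = cnj q \<or> q' = - cnj q)"
    unfolding swap_conj_fold_def pq pq' fst_conv snd_conv conj_fold_eq_iff prod.inject
      pw_2_eq_iff pw_2_cnj_eq_iff ..
  also have "\<dots> \<longleftrightarrow> rotate45 z \<in> rotate45 ` {(u, v), (v, u), (cnj u, cnj v), (cnj v, cnj u)}"
    unfolding pq' by (auto simp: rotate45_symmetries(3) rotate45_symmetries(1)[of v u]
        rotate45_symmetries(1)[of "cnj v" "cnj u"] pq)
  also have "\<dots> \<longleftrightarrow> z \<in> {(u, v), (v, u), (cnj u, cnj v), (cnj v, cnj u)}"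
    by (simp only: image_iff rotate45_inject) blast
  finally show ?thesis .
qed

section \<open>Realising orbit maps in the sphere and in projective space\<close>

definition quat_vec :: "quat \<Rightarrow> real^4" where
  "quat_vec x = vector [Re (fst x), Im (fst x), Re (snd x), Im (snd x)]"

lemma vector_4 [simp]:
  "(vector [a, b, c, d] :: 'a::zero^4) $ 1 = a" "(vector [a, b, c, d] :: 'a^4) $ 2 = b"
  "(vector [a, b, c, d] :: 'a^4) $ 3 = c" "(vector [a, b, c, d] :: 'a^4) $ 4 = d"
  by (simp_all add: vector_def)

lemma quat_vec_inject: "quat_vec x = quat_vec y \<longleftrightarrow> x = y"
  by (auto simp: quat_vec_def vec_eq_iff forall_4 prod_eq_iff complex_eq_iff)

lemma quat_vec_minus: "quat_vec (- x) = - quat_vec x"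
  by (simp add: quat_vec_def vec_eq_iff forall_4)

lemma norm_onto_map_quat_vec: "norm_onto_map quat_vec"
  unfolding norm_onto_map_def
proof (intro conjI allI)
  have "\<forall>i. continuous_on UNIV (\<lambda>x. quat_vec x $ i)"
    unfolding forall_4 quat_vec_def vector_4 by (intro conjI continuous_intros)
  then have "continuous_on UNIV (\<lambda>x. \<chi> i. quat_vec x $ i)"
    by (intro continuous_on_vec_lambda) auto
  then show "continuous_on UNIV quat_vec" by simp
  show "norm (quat_vec x) = norm x" for x
    by (simp add: norm_vec_def L2_set_def sum_4 quat_vec_def norm_prod_def cmod_power2)
  have "quat_vec (Complex (y$1) (y$2), Complex (y$3) (y$4)) = y" for y
    by (simp add: quat_vec_def vec_eq_iff forall_4)
  then show "surj quat_vec" by (rule surjI)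
qed

lemma norm_onto_map_sphere:
  assumes "norm_onto_map f"
  shows "f ` sphere 0 1 = sphere 0 1" "continuous_on S f"
proof -
  have "y \<in> f ` sphere 0 1" if "y \<in> sphere 0 1" for y
    using assms that unfolding norm_onto_map_def surj_def by (metis dist_0_norm imageI mem_sphere)
  then show "f ` sphere 0 1 = sphere 0 1" using assms by (auto simp: norm_onto_map_def)
  show "continuous_on S f" using assms continuous_on_subset unfolding norm_onto_map_def by blast
qed

text \<open>An orbit map with values in the unit sphere of the quaternions, moved to the standard model of
  the sphere.\<close>

lemma bicoset_orbit_map_S3:
  assumes c: "continuous_on (sphere 0 1) f" and onto: "f ` sphere 0 1 = sphere 0 1"
    and fib: "\<And>x y. norm x = 1 \<Longrightarrow> norm y = 1 \<Longrightarrow> f x = f y \<longleftrightarrow> (\<exists>a\<in>\<Gamma>. \<exists>b\<in>\<Gamma>. y = a \<odot> x \<odot> b)"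
  shows "bicoset_orbit_map S3 \<Gamma> (\<lambda>x. quat_vec (f x))"
proof -
  note q = norm_onto_map_sphere[OF norm_onto_map_quat_vec]
  have im: "(\<lambda>x. quat_vec (f x)) ` sphere 0 1 = sphere 0 1"
    using q(1) onto by (metis image_image)
  moreover have "continuous_on (sphere 0 1) (\<lambda>x. quat_vec (f x))"
    using continuous_on_compose2[OF q(2)[of UNIV] c] by simp
  ultimately have "continuous_map (top_of_set (sphere 0 1)) S3 (\<lambda>x. quat_vec (f x))"
    unfolding S3_def by (simp add: image_subset_iff_funcset[symmetric])
  then show ?thesis
    unfolding bicoset_orbit_map_def using im fib by (simp add: S3_def quat_vec_inject)
qed

lemma Hausdorff_S3: "Hausdorff_space S3"
  by (simp add: S3_def Hausdorff_space_subtopology)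

lemma antipodal_pair_eq_iff: "{x, - x} = {y, - y} \<longleftrightarrow> x = y \<or> x = - (y :: 'a::real_normed_vector)"
  by (auto simp: doubleton_eq_iff)

lemma equal_up_to_sign_sym: "u = v \<or> u = - v \<longleftrightarrow> v = u \<or> v = - (u :: 'a::group_add)"
  by (metis minus_minus)

text \<open>The matrix of products \<open>x\<^sub>i x\<^sub>j\<close> determines \<open>x\<close> exactly up to sign, so it embeds \<open>\<real>P\<^sup>3\<close>
  continuously and injectively into a Hausdorff space.\<close>

lemma Hausdorff_RP3: "Hausdorff_space RP3"
proof -
  let ?q = "\<lambda>x::real^4. {x, - x}"
  have q: "quotient_map S3 RP3 ?q" unfolding RP3_def by (rule quotient_map_quotient_topology)
  define m :: "real^4 \<Rightarrow> real^4^4" where "m x = (\<chi> i j. x$i * x$j)" for x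
  have "continuous_on (sphere 0 1) m" unfolding m_def by (intro continuous_intros)
  then have mc: "continuous_map S3 euclidean m" by (simp add: S3_def)
  obtain g where g: "continuous_map RP3 euclidean g" "\<And>x. x \<in> topspace S3 \<Longrightarrow> g (?q x) = m x"
    by (rule quotient_map_lift_exists[OF q mc]) (auto simp: antipodal_pair_eq_iff m_def)
  have inj: "x = y \<or> x = - y" if mxy: "m x = m y" and nx: "norm x = 1" for x y
  proof -
    have e: "x$i * x$j = y$i * y$j" for i j using mxy by (simp add: m_def vec_eq_iff)
    obtain i where i: "x$i \<noteq> 0" using nx by (metis norm_zero vec_eq_iff zero_index zero_neq_one)
    have "(x$i)\<^sup>2 = (y$i)\<^sup>2" using e[of i i] by (simp add: power2_eq_square)
    then consider "y$i = x$i" | "y$i = - x$i" by (auto simp: power2_eq_iff)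
    then show ?thesis
    proof cases
      case 1
      then have "x$j = y$j" for j using e[of i j] i by simp
      then show ?thesis by (simp add: vec_eq_iff)
    next
      case 2
      have "x$j = - y$j" for j
      proof -
        have "x$i * (x$j + y$j) = 0" using e[of i j] 2 by (simp add: algebra_simps)
        then show ?thesis using i by (simp add: eq_neg_iff_add_eq_0)
      qed
      then show ?thesis by (simp add: vec_eq_iff)
    qed
  qed
  have top: "topspace RP3 = ?q ` sphere 0 1"
    by (simp add: RP3_def topspace_quotient_topology S3_def)
  have "inj_on g (topspace RP3)"
    unfolding top inj_on_def using g(2) inj by (auto simp: S3_def antipodal_pair_eq_iff)
  then show ?thesis using Hausdorff_space_injective_preimage[OF _ g(1)] by simp
qed

lemma bicoset_orbit_map_RP3:
  assumes f: "norm_onto_map f"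
    and fib: "\<And>x y. norm x = 1 \<Longrightarrow> norm y = 1 \<Longrightarrow>
        (f y = f x \<or> f y = - f x) \<longleftrightarrow> (\<exists>a\<in>\<Gamma>. \<exists>b\<in>\<Gamma>. y = a \<odot> x \<odot> b)"
  shows "bicoset_orbit_map RP3 \<Gamma> (\<lambda>x. {quat_vec (f x), - quat_vec (f x)})"
proof -
  let ?q = "\<lambda>x::real^4. {x, - x}"
  have q: "quotient_map S3 RP3 ?q" unfolding RP3_def by (rule quotient_map_quotient_topology)
  have fv: "norm_onto_map (\<lambda>x. quat_vec (f x))" by (rule norm_onto_map_compose[OF f norm_onto_map_quat_vec])
  note s = norm_onto_map_sphere[OF fv]
  have "continuous_map (top_of_set (sphere 0 1)) S3 (\<lambda>x. quat_vec (f x))"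
    using s unfolding S3_def by (simp add: image_subset_iff_funcset[symmetric])
  from continuous_map_compose[OF this quotient_imp_continuous_map[OF q]]
  have "continuous_map (top_of_set (sphere 0 1)) RP3 (\<lambda>x. {quat_vec (f x), - quat_vec (f x)})"
    by (simp add: comp_def)
  moreover
  have "?q ` (\<lambda>x. quat_vec (f x)) ` sphere 0 1 = topspace RP3"
    unfolding s(1) by (simp add: RP3_def topspace_quotient_topology S3_def)
  then have "(\<lambda>x. {quat_vec (f x), - quat_vec (f x)}) ` sphere 0 1 = topspace RP3"
    by (simp only: image_image)
  moreover have "{quat_vec (f x), - quat_vec (f x)} = {quat_vec (f y), - quat_vec (f y)} \<longleftrightarrow>
      (f y = f x \<or> f y = - f x)" for x y
    unfolding antipodal_pair_eq_iff unfolding quat_vec_minus[symmetric] quat_vec_inject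
    by (rule equal_up_to_sign_sym)
  ultimately show ?thesis unfolding bicoset_orbit_map_def using fib by simp
qed

section \<open>Finite groups of unit quaternions\<close>

definition unit_quat_group :: "quat set \<Rightarrow> bool" where
  "unit_quat_group \<Gamma> \<longleftrightarrow> finite \<Gamma> \<and> qone \<in> \<Gamma> \<and>
     (\<forall>x\<in>\<Gamma>. norm x = 1 \<and> - x \<in> \<Gamma> \<and> qcnj x \<in> \<Gamma>) \<and> (\<forall>x\<in>\<Gamma>. \<forall>y\<in>\<Gamma>. x \<odot> y \<in> \<Gamma>)"

lemma unit_quat_groupD:
  assumes "unit_quat_group \<Gamma>"
  shows "finite \<Gamma>" "qone \<in> \<Gamma>" "x \<in> \<Gamma> \<Longrightarrow> norm x = 1" "x \<in> \<Gamma> \<Longrightarrow> - x \<in> \<Gamma>"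
    "x \<in> \<Gamma> \<Longrightarrow> qcnj x \<in> \<Gamma>" "x \<in> \<Gamma> \<Longrightarrow> y \<in> \<Gamma> \<Longrightarrow> x \<odot> y \<in> \<Gamma>"
  using assms unfolding unit_quat_group_def by blast+

text \<open>Because a group of unit quaternions is closed under negation here, it is the full preimage of its
  image in \<open>SO(3)\<close>.\<close>

lemma rot_image_unit_quat_group:
  assumes "unit_quat_group \<Gamma>"
  shows "subgroup (rot ` \<Gamma>) SO3" "finite (rot ` \<Gamma>)" "spin_lift (rot ` \<Gamma>) = \<Gamma>"
proof -
  note g = unit_quat_groupD[OF assms]
  interpret SO: group SO3 by (rule group_SO3)
  show "finite (rot ` \<Gamma>)" using g by simp
  show "subgroup (rot ` \<Gamma>) SO3"
  proof (rule SO.subgroupI)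
    show "rot ` \<Gamma> \<subseteq> carrier SO3" using g(3) rot_in_SO3 by blast
    show "rot ` \<Gamma> \<noteq> {}" using g(2) by blast
    fix a assume "a \<in> rot ` \<Gamma>"
    then obtain x where x: "x \<in> \<Gamma>" "a = rot x" by blast
    have "inv\<^bsub>SO3\<^esub> a = rot (qcnj x)" unfolding x(2) by (rule SO3_inv_rot[OF g(3)[OF x(1)]])
    then show "inv\<^bsub>SO3\<^esub> a \<in> rot ` \<Gamma>" using g(5)[OF x(1)] by blast
    fix b assume "b \<in> rot ` \<Gamma>"
    then obtain y where y: "y \<in> \<Gamma>" "b = rot y" by blast
    show "a \<otimes>\<^bsub>SO3\<^esub> b \<in> rot ` \<Gamma>"
      using g(6)[OF x(1) y(1)] by (simp add: SO3_simps x(2) y(2) rot_qmul[symmetric])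
  qed
  show "spin_lift (rot ` \<Gamma>) = \<Gamma>"
  proof
    show "\<Gamma> \<subseteq> spin_lift (rot ` \<Gamma>)" using g(3) unfolding spin_lift_def by blast
    show "spin_lift (rot ` \<Gamma>) \<subseteq> \<Gamma>"
    proof
      fix q assume "q \<in> spin_lift (rot ` \<Gamma>)"
      then obtain x where "norm q = 1" "x \<in> \<Gamma>" "rot x = rot q" unfolding spin_lift_def by force
      then show "q \<in> \<Gamma>" using rot_eq_iff[of x q] g(3)[of x] g(4)[of x] by blast
    qed
  qed
qed

section \<open>Cyclic groups\<close>

definition cyc_lift :: "nat \<Rightarrow> quat set" where
  "cyc_lift n = (\<lambda>\<zeta>. (\<zeta>, 0)) ` {\<zeta>. \<zeta> ^ (2 * n) = 1}"

lemma cyc_sandwich: "(\<alpha>, 0) \<odot> x \<odot> (\<beta>, 0) = (\<alpha> * \<beta> * fst x, \<alpha> * cnj \<beta> * snd x)"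
  by (simp add: qmul_def)

lemma root_of_unity_cnj:
  assumes "norm (\<zeta> :: complex) = 1"
  shows "\<zeta> * cnj \<zeta> = 1"
  using assms complex_norm_square[of \<zeta>] by simp

lemma unit_quat_group_cyc_lift:
  assumes n: "n > 0"
  shows "unit_quat_group (cyc_lift n)"
proof -
  have "norm \<zeta> = 1" if "\<zeta> ^ (2 * n) = 1" for \<zeta> :: complex
    using norm_eq_1_if_power[of \<zeta> "2 * n"] that n by simp
  moreover have "finite {\<zeta>::complex. \<zeta> ^ (2 * n) = 1}" using finite_roots_unity[of "2 * n"] n by simp
  moreover have "cnj \<zeta> ^ (2 * n) = 1" if "\<zeta> ^ (2 * n) = 1" for \<zeta> :: complex
    using that by (metis complex_cnj_one complex_cnj_power)
  ultimately show ?thesis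
    unfolding unit_quat_group_def cyc_lift_def
    by (auto simp: norm_Pair qcnj_def qmul_def power_mult_distrib image_iff)
qed

text \<open>Two-sided multiplication by \<open>\<alpha>\<close> and \<open>\<beta>\<close> multiplies the complex coordinates by \<open>\<mu> = \<alpha> \<beta>\<close> and
  \<open>\<nu> = \<alpha> \<beta>\<^sup>*\<close>. Every pair with \<open>\<mu>\<^sup>n = \<nu>\<^sup>n = \<plusminus>1\<close> is of this form, with \<open>\<beta>\<close> a square root of
  \<open>\<mu> \<nu>\<^sup>*\<close>, and these pairs are what the power map forgets up to a common sign.\<close>

lemma qpw_fiber:
  assumes n: "n > 0"
  shows "(qpw n y = qpw n x \<or> qpw n y = - qpw n x) \<longleftrightarrow>
    (\<exists>a\<in>cyc_lift n. \<exists>b\<in>cyc_lift n. y = a \<odot> x \<odot> b)"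
proof
  assume "qpw n y = qpw n x \<or> qpw n y = - qpw n x"
  then obtain \<epsilon> :: complex where \<epsilon>: "\<epsilon> = 1 \<or> \<epsilon> = - 1"
      "pw n (fst y) = \<epsilon> * pw n (fst x)" "pw n (snd y) = \<epsilon> * pw n (snd x)"
    unfolding qpw_def by (metis fst_conv snd_conv fst_uminus snd_uminus mult_1 mult_minus1)
  then have n\<epsilon>: "norm \<epsilon> = 1" by auto
  obtain \<mu> \<nu> where \<mu>\<nu>: "\<mu> ^ n = \<epsilon>" "fst y = \<mu> * fst x" "\<nu> ^ n = \<epsilon>" "snd y = \<nu> * snd x"
    using \<epsilon>(2,3) pw_eq_iff[OF n n\<epsilon>] by blast
  have n1: "norm \<mu> = 1" "norm \<nu> = 1"
    using norm_eq_1_if_power[OF _ n] \<mu>\<nu>(1,3) n\<epsilon> by auto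
  define \<beta> where "\<beta> = csqrt (\<mu> * cnj \<nu>)"
  have b2: "\<beta>\<^sup>2 = \<mu> * cnj \<nu>" by (simp add: \<beta>_def)
  then have nb: "norm \<beta> = 1"
    using n1 by (intro norm_eq_1_if_power[of \<beta> 2]) (simp_all add: norm_mult)
  define \<alpha> where "\<alpha> = \<mu> * cnj \<beta>"
  have ab: "\<alpha> * \<beta> = \<mu>" using root_of_unity_cnj[OF nb] by (simp add: \<alpha>_def mult.assoc mult.commute[of "cnj \<beta>"])
  have "\<alpha> * cnj \<beta> = \<mu> * cnj (\<beta>\<^sup>2)" by (simp add: \<alpha>_def power2_eq_square mult.assoc)
  also have "\<dots> = (\<mu> * cnj \<mu>) * \<nu>" by (simp add: b2)
  finally have ab': "\<alpha> * cnj \<beta> = \<nu>" using root_of_unity_cnj[OF n1(1)] by simp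
  have ee: "\<epsilon> * cnj \<epsilon> = 1" "\<epsilon> * \<epsilon> = 1" using \<epsilon>(1) by auto
  have bn: "\<beta> ^ (2 * n) = 1"
    by (simp add: power_mult b2 power_mult_distrib \<mu>\<nu> ee complex_cnj_power[symmetric] del: complex_cnj_power)
  have "\<alpha> ^ (2 * n) = (\<mu> ^ n)\<^sup>2 * cnj (\<beta> ^ (2 * n))"
    by (simp add: \<alpha>_def power_mult_distrib power_mult[symmetric] mult.commute)
  then have an: "\<alpha> ^ (2 * n) = 1" using ee by (simp add: bn \<mu>\<nu> power2_eq_square)
  have "y = (\<alpha>, 0) \<odot> x \<odot> (\<beta>, 0)" unfolding cyc_sandwich ab ab' by (simp add: prod_eq_iff \<mu>\<nu>)
  then show "\<exists>a\<in>cyc_lift n. \<exists>b\<in>cyc_lift n. y = a \<odot> x \<odot> b" using an bn unfolding cyc_lift_def by blast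
next
  assume "\<exists>a\<in>cyc_lift n. \<exists>b\<in>cyc_lift n. y = a \<odot> x \<odot> b"
  then obtain \<alpha> \<beta> where ab: "\<alpha> ^ (2 * n) = 1" "\<beta> ^ (2 * n) = 1" "y = (\<alpha>, 0) \<odot> x \<odot> (\<beta>, 0)"
    unfolding cyc_lift_def by blast
  have n1: "norm \<alpha> = 1" "norm \<beta> = 1" using ab n by (auto intro: norm_eq_1_if_power[of _ "2 * n"])
  have s: "\<alpha> ^ n = 1 \<or> \<alpha> ^ n = - 1" "\<beta> ^ n = 1 \<or> \<beta> ^ n = - 1"
    using ab by (simp_all add: mult.commute[of 2] power_mult power2_eq_1_iff)
  have cb: "cnj \<beta> ^ n = \<beta> ^ n" using s(2) by (metis complex_cnj_power complex_cnj_one complex_cnj_minus)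
  have "pw n (fst y) = \<alpha> ^ n * \<beta> ^ n * pw n (fst x)" "pw n (snd y) = \<alpha> ^ n * cnj (\<beta> ^ n) * pw n (snd x)"
    using n1 unfolding ab(3) cyc_sandwich by (simp_all add: pw_mult norm_mult power_mult_distrib)
  then show "qpw n y = qpw n x \<or> qpw n y = - qpw n x"
    using s by (auto simp: qpw_def cb)
qed

lemma cyclic_orbit_map:
  assumes "n > 0"
  shows "bicoset_orbit_map RP3 (cyc_lift n) (\<lambda>x. {quat_vec (qpw n x), - quat_vec (qpw n x)})"
  by (rule bicoset_orbit_map_RP3[OF norm_onto_map_qpw[OF assms] qpw_fiber[OF assms]])

section \<open>Dihedral groups\<close>

abbreviation qJ :: quat where "qJ \<equiv> (0, 1)"

definition dih_lift :: "nat \<Rightarrow> quat set" where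
  "dih_lift n = cyc_lift n \<union> (\<lambda>a. a \<odot> qJ) ` cyc_lift n"

lemma qJ_mult: "qJ \<odot> x = (- cnj (snd x), cnj (fst x))" "x \<odot> qJ = (- snd x, fst x)"
  by (simp_all add: qmul_def)

lemma qJ_cyc:
  assumes "a \<in> cyc_lift n"
  shows "qJ \<odot> a = qcnj a \<odot> qJ"
  using assms by (auto simp: cyc_lift_def qmul_def qcnj_def)

lemma unit_quat_group_dih_lift:
  assumes n: "n > 0"
  shows "unit_quat_group (dih_lift n)"
proof -
  note g = unit_quat_groupD[OF unit_quat_group_cyc_lift[OF n]]
  have JJ: "qJ \<odot> qJ = - qone" by (simp add: qmul_def)
  have Jc: "qcnj qJ = - qJ" by (simp add: qcnj_def)
  have nJ: "norm qJ = 1" by (simp add: norm_Pair)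
  have m: "a \<odot> qJ \<odot> b = a \<odot> qcnj b \<odot> qJ" "a \<odot> (b \<odot> qJ) = a \<odot> b \<odot> qJ"
    "a \<odot> qJ \<odot> (b \<odot> qJ) = - (a \<odot> qcnj b)" if "b \<in> cyc_lift n" for a b
  proof -
    show 1: "a \<odot> qJ \<odot> b = a \<odot> qcnj b \<odot> qJ" by (simp add: qmul_assoc qJ_cyc[OF that])
    show "a \<odot> (b \<odot> qJ) = a \<odot> b \<odot> qJ" by (simp add: qmul_assoc)
    have "a \<odot> qJ \<odot> (b \<odot> qJ) = (a \<odot> qJ \<odot> b) \<odot> qJ" by (simp add: qmul_assoc)
    also have "\<dots> = (a \<odot> qcnj b) \<odot> (qJ \<odot> qJ)" unfolding 1 by (simp add: qmul_assoc)
    finally show "a \<odot> qJ \<odot> (b \<odot> qJ) = - (a \<odot> qcnj b)" unfolding JJ qmul_minus qmul_one .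
  qed
  have c: "qcnj (a \<odot> qJ) = (- a) \<odot> qJ" if "a \<in> cyc_lift n" for a
    unfolding qcnj_qmul Jc qmul_minus using qJ_cyc[OF g(5)[OF that]] by (simp only: qcnj_qcnj)
  show ?thesis
    unfolding unit_quat_group_def
  proof (intro conjI ballI)
    show "finite (dih_lift n)" "qone \<in> dih_lift n" using g(1,2) by (simp_all add: dih_lift_def)
    fix x assume "x \<in> dih_lift n"
    then consider a where "a \<in> cyc_lift n" "x = a" | a where "a \<in> cyc_lift n" "x = a \<odot> qJ"
      unfolding dih_lift_def by blast
    note x = this
    from x show "norm x = 1" by cases (simp_all add: g(3) norm_qmul nJ)
    have mem: "a \<in> dih_lift n" "a \<odot> qJ \<in> dih_lift n" if "a \<in> cyc_lift n" for a
      using that unfolding dih_lift_def by blast+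
    have "- (a \<odot> qJ) = (- a) \<odot> qJ" for a by (simp only: qmul_minus)
    with x show "- x \<in> dih_lift n" by cases (metis mem g(4))+
    from x show "qcnj x \<in> dih_lift n" by cases (metis mem g(4,5) c)+
    fix y assume "y \<in> dih_lift n"
    then consider b where "b \<in> cyc_lift n" "y = b" | b where "b \<in> cyc_lift n" "y = b \<odot> qJ"
      unfolding dih_lift_def by blast
    then show "x \<odot> y \<in> dih_lift n"
      by (cases; cases rule: x) (metis mem g(4,5,6) m)+
  qed
qed

text \<open>Since \<open>j\<close> normalises the roots of unity, it can be moved next to \<open>x\<close> from either side.\<close>

lemma dih_sandwich:
  assumes n: "n > 0"
  shows "(\<exists>a\<in>dih_lift n. \<exists>b\<in>dih_lift n. y = a \<odot> x \<odot> b) \<longleftrightarrow>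
    (\<exists>x'\<in>{x, qJ \<odot> x, x \<odot> qJ, qJ \<odot> x \<odot> qJ}. \<exists>a\<in>cyc_lift n. \<exists>b\<in>cyc_lift n. y = a \<odot> x' \<odot> b)"
proof -
  note g = unit_quat_groupD[OF unit_quat_group_cyc_lift[OF n]]
  have alt: "(\<lambda>a. a \<odot> qJ) ` cyc_lift n = (\<lambda>b. qJ \<odot> b) ` cyc_lift n"
  proof
    show "(\<lambda>a. a \<odot> qJ) ` cyc_lift n \<subseteq> (\<lambda>b. qJ \<odot> b) ` cyc_lift n"
    proof
      fix z assume "z \<in> (\<lambda>a. a \<odot> qJ) ` cyc_lift n"
      then obtain a where a: "a \<in> cyc_lift n" "z = a \<odot> qJ" by blast
      then have "z = qJ \<odot> qcnj a" using qJ_cyc[OF g(5)[OF a(1)]] by simp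
      then show "z \<in> (\<lambda>b. qJ \<odot> b) ` cyc_lift n" using g(5)[OF a(1)] by blast
    qed
    show "(\<lambda>b. qJ \<odot> b) ` cyc_lift n \<subseteq> (\<lambda>a. a \<odot> qJ) ` cyc_lift n"
      using qJ_cyc g(5) by blast
  qed
  have "(\<exists>a\<in>dih_lift n. \<exists>b\<in>dih_lift n. y = a \<odot> x \<odot> b) \<longleftrightarrow>
    (\<exists>a\<in>cyc_lift n \<union> (\<lambda>a. a \<odot> qJ) ` cyc_lift n. \<exists>b\<in>cyc_lift n \<union> (\<lambda>b. qJ \<odot> b) ` cyc_lift n. y = a \<odot> x \<odot> b)"
    unfolding dih_lift_def alt ..
  also have "\<dots> \<longleftrightarrow> (\<exists>x'\<in>{x, qJ \<odot> x, x \<odot> qJ, qJ \<odot> x \<odot> qJ}. \<exists>a\<in>cyc_lift n. \<exists>b\<in>cyc_lift n. y = a \<odot> x' \<odot> b)"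
    unfolding bex_Un bex_simps(7) by (simp only: qmul_assoc bex_simps) blast
  finally show ?thesis .
qed

text \<open>For even \<open>n\<close> the sign in \<open>j (z + w j) = - w\<^sup>* + z\<^sup>* j\<close> disappears under the power map; what is left
  is the exchange of the coordinates, with or without conjugation.\<close>

lemma qpw_qJ:
  assumes "even n"
  shows "qpw n (qJ \<odot> x) = (cnj (snd (qpw n x)), cnj (fst (qpw n x)))"
    "qpw n (x \<odot> qJ) = (snd (qpw n x), fst (qpw n x))"
  using assms by (simp_all add: qJ_mult qpw_def pw_minus pw_cnj)

lemma qpw_qJ_odd:
  assumes "odd n"
  shows "qpw n (qJ \<odot> x) = qJ \<odot> qpw n x" "qpw n (x \<odot> qJ) = qpw n x \<odot> qJ"
  using assms by (simp_all add: qJ_mult qpw_def pw_minus pw_cnj)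

text \<open>After the power map the dihedral group acts by sign, exchange and conjugation; in the rotated
  coordinates \<open>p, q\<close> these are all even sign changes of the real coordinates.\<close>

lemma dihedral_even_orbit_map:
  assumes n: "n > 0" "even n"
  shows "bicoset_orbit_map S3 (dih_lift n) (\<lambda>x. quat_vec (even_sign_fold (rotate45 (qpw n x))))"
proof -
  have N: "norm_onto_map (\<lambda>x. even_sign_fold (rotate45 (qpw n x)))"
    by (rule norm_onto_map_compose[OF norm_onto_map_compose[OF norm_onto_map_qpw[OF n(1)]
        norm_onto_map_rotate45] norm_onto_map_even_sign_fold])
  have "even_sign_fold (rotate45 (qpw n x)) = even_sign_fold (rotate45 (qpw n y)) \<longleftrightarrow>
      (\<exists>a\<in>dih_lift n. \<exists>b\<in>dih_lift n. y = a \<odot> x \<odot> b)" for x y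
  proof -
    obtain u v where uv: "qpw n x = (u, v)" by (cases "qpw n x")
    obtain p q where pq: "rotate45 (u, v) = (p, q)" by (cases "rotate45 (u, v)")
    obtain p' q' where pq': "rotate45 (qpw n y) = (p', q')" by (cases "rotate45 (qpw n y)")
    have r: "qpw n y = z \<or> qpw n y = - z \<longleftrightarrow> (p', q') = rotate45 z \<or> (p', q') = - rotate45 z" for z
      unfolding pq'[symmetric] rotate45_symmetries(2)[symmetric] rotate45_inject ..
    have "(\<exists>a\<in>dih_lift n. \<exists>b\<in>dih_lift n. y = a \<odot> x \<odot> b) \<longleftrightarrow>
        (\<exists>x'\<in>{x, qJ \<odot> x, x \<odot> qJ, qJ \<odot> x \<odot> qJ}. qpw n y = qpw n x' \<or> qpw n y = - qpw n x')"
      unfolding dih_sandwich[OF n(1)] qpw_fiber[OF n(1)] ..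
    also have "\<dots> \<longleftrightarrow> (\<exists>z\<in>{(u, v), (cnj v, cnj u), (v, u), (cnj u, cnj v)}. qpw n y = z \<or> qpw n y = - z)"
      by (simp add: qpw_qJ[OF n(2)] qmul_assoc uv)
    also have "\<dots> \<longleftrightarrow> (\<exists>z\<in>{(p, q), (cnj p, - cnj q), (p, - q), (cnj p, cnj q)}. (p', q') = z \<or> (p', q') = - z)"
      unfolding r by (simp add: rotate45_symmetries(3) rotate45_symmetries(1)[of "cnj v"]
          rotate45_symmetries(1)[of v] pq)
    also have "\<dots> \<longleftrightarrow> even_sign_fold (p', q') = even_sign_fold (p, q)"
      unfolding even_sign_fold_eq_iff by auto
    finally show ?thesis unfolding pq' uv pq by (simp only: eq_commute)
  qed
  then show ?thesis by (intro bicoset_orbit_map_S3 norm_onto_map_sphere[OF N]) auto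
qed

lemma cyc_lift_2: "cyc_lift 2 = {qone, - qone, (\<i>, 0), - (\<i>, 0)}"
proof -
  have "\<zeta> ^ 4 = 1 \<longleftrightarrow> \<zeta> = 1 \<or> \<zeta> = - 1 \<or> \<zeta> = \<i> \<or> \<zeta> = - \<i>" for \<zeta> :: complex
  proof -
    have "\<zeta> ^ 4 - 1 = (\<zeta> - 1) * (\<zeta> + 1) * (\<zeta> - \<i>) * (\<zeta> + \<i>)"
      by (simp add: algebra_simps power4_eq_xxxx)
    then show ?thesis by (auto simp: eq_neg_iff_add_eq_0)
  qed
  then have "{\<zeta>::complex. \<zeta> ^ 4 = 1} = {1, - 1, \<i>, - \<i>}" by auto
  then show ?thesis by (simp add: cyc_lift_def)
qed

text \<open>For odd \<open>n\<close> the power map commutes with multiplication by \<open>j\<close>. So the residual group is generated by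
  \<open>j\<close> on both sides; conjugation with a quaternion \<open>s\<close> such that \<open>s j = i s\<close> turns it into the group
  of fourth roots of unity, whose orbit map is known.\<close>

lemma dihedral_odd_orbit_map:
  assumes n: "odd n"
  shows "\<exists>F. bicoset_orbit_map RP3 (dih_lift n) F"
proof -
  have n0: "n > 0" using n by (cases n) auto
  \<comment> \<open>This is \<open>(i + j) / \<surd>2\<close>, the half turn about the bisector of the first two axes.\<close>
  define s :: quat where "s = (\<i> / sqrt 2, 1 / sqrt 2)"
  have ss: "complex_of_real (sqrt 2) * complex_of_real (sqrt 2) = 2"
    by (metis of_real_mult of_real_numeral real_sqrt_mult_self abs_numeral)
  have s: "norm s = 1" by (simp add: s_def norm_Pair norm_divide power_divide)
  have sJ: "s \<odot> qJ = (\<i>, 0) \<odot> s" by (simp add: s_def qmul_def)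
  let ?c = "\<lambda>x. s \<odot> x \<odot> qcnj s"
  have cm: "?c (x \<odot> y) = ?c x \<odot> ?c y" for x y
    using qmul_qcnj_cancel(1)[OF s] by (simp add: qmul_assoc)
  have cJ: "?c qJ = (\<i>, 0)" unfolding sJ using qmul_qcnj_cancel(3)[OF s] by simp
  have c1: "?c qone = qone" using qmul_qcnj[OF s] by simp
  have cmin: "?c (- x) = - ?c x" for x by simp
  have cinj: "?c x = ?c y \<longleftrightarrow> x = y" for x y
    by (metis qmul_qcnj_cancel(1,4)[OF s])
  have N: "norm_onto_map ?c"
    unfolding norm_onto_map_def
  proof (intro conjI allI)
    show "continuous_on UNIV ?c" by (intro continuous_intros)
    show "norm (?c x) = norm x" for x using s by (simp add: norm_qmul)
    show "surj ?c"
    proof (rule surjI)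
      show "?c (qcnj s \<odot> x \<odot> s) = x" for x
        using s by (simp add: qmul_assoc qmul_qcnj qmul_qcnj_cancel)
    qed
  qed
  define F where "F = (\<lambda>x. qpw 2 (?c (qpw n x)))"
  have NF: "norm_onto_map F"
    unfolding F_def
    by (rule norm_onto_map_compose[OF norm_onto_map_compose[OF norm_onto_map_qpw[OF n0] N] norm_onto_map_qpw]) simp
  have "(F y = F x \<or> F y = - F x) \<longleftrightarrow> (\<exists>a\<in>dih_lift n. \<exists>b\<in>dih_lift n. y = a \<odot> x \<odot> b)" for x y
  proof -
    let ?u = "qpw n x"
    have "(F y = F x \<or> F y = - F x) \<longleftrightarrow>
        (\<exists>a\<in>cyc_lift 2. \<exists>b\<in>cyc_lift 2. ?c (qpw n y) = a \<odot> ?c ?u \<odot> b)"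
      unfolding F_def by (rule qpw_fiber) simp
    also have "cyc_lift 2 = ?c ` {qone, - qone, qJ, - qJ}"
      unfolding cyc_lift_2 image_insert image_empty cmin cJ c1 ..
    also have "(\<exists>a\<in>?c ` {qone, - qone, qJ, - qJ}. \<exists>b\<in>?c ` {qone, - qone, qJ, - qJ}. ?c (qpw n y) = a \<odot> ?c ?u \<odot> b)
      \<longleftrightarrow> (\<exists>a\<in>{qone, - qone, qJ, - qJ}. \<exists>b\<in>{qone, - qone, qJ, - qJ}. qpw n y = a \<odot> ?u \<odot> b)"
      unfolding bex_simps(7) cm[symmetric] cinj ..
    also have "\<dots> \<longleftrightarrow> (\<exists>z\<in>{?u, qJ \<odot> ?u, ?u \<odot> qJ, qJ \<odot> ?u \<odot> qJ}. qpw n y = z \<or> qpw n y = - z)"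
      unfolding bex_simps qmul_minus qmul_one minus_minus by blast
    also have "\<dots> \<longleftrightarrow> (\<exists>x'\<in>{x, qJ \<odot> x, x \<odot> qJ, qJ \<odot> x \<odot> qJ}. qpw n y = qpw n x' \<or> qpw n y = - qpw n x')"
      by (simp only: bex_simps qpw_qJ_odd[OF n])
    also have "\<dots> \<longleftrightarrow> (\<exists>a\<in>dih_lift n. \<exists>b\<in>dih_lift n. y = a \<odot> x \<odot> b)"
      unfolding dih_sandwich[OF n0] qpw_fiber[OF n0] ..
    finally show ?thesis .
  qed
  then have "bicoset_orbit_map RP3 (dih_lift n) (\<lambda>x. {quat_vec (F x), - quat_vec (F x)})"
    by (rule bicoset_orbit_map_RP3[OF NF])
  then show ?thesis by blast
qed

section \<open>Cyclic and dihedral rotation groups up to conjugacy\<close>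

lemma imq_axis: "imq (axis 1 1) = (\<i>, 0)" "imq (axis 2 1) = qJ"
  by (simp_all add: imq_def axis_def complex_eq_iff)

lemma inner_imq: "imq u \<bullet> imq v = u \<bullet> v"
  by (simp add: imq_def inner_quat inner_vec_def sum_3)

lemma inner_rot:
  assumes "norm q = 1"
  shows "(rot q *v u) \<bullet> (rot q *v v) = u \<bullet> v"
  using assms by (simp add: inner_imq[symmetric] imq_rot inner_qmul_left inner_qmul_right)

lemma norm_rot:
  assumes "norm q = 1"
  shows "norm (rot q *v u) = norm u"
  using inner_rot[OF assms, of u u] by (simp add: norm_eq_sqrt_inner)

lemma rot_cancel:
  assumes "norm q = 1"
  shows "rot q *v (rot (qcnj q) *v u) = u" "rot (qcnj q) *v (rot q *v u) = u"
  using qmul_qcnj[OF assms] by (simp_all add: matrix_vector_mul_assoc rot_qmul[symmetric] rot_one)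

lemma rot_about_e1:
  assumes "norm \<alpha> = 1"
  shows "rot (\<alpha>, 0) *v vector [x, y, z] =
    vector [x, Re (\<alpha>\<^sup>2) * y - Im (\<alpha>\<^sup>2) * z, Im (\<alpha>\<^sup>2) * y + Re (\<alpha>\<^sup>2) * z]"
proof -
  have "(Re \<alpha>)\<^sup>2 + (Im \<alpha>)\<^sup>2 = 1" using cmod_power2[of \<alpha>] assms by simp
  then show ?thesis
    by (simp add: vec_eq_iff forall_3 rot_def Let_def vector_3 matrix_vector_mult_def sum_3
        Re_power2 Im_power2 algebra_simps)
qed

lemma axis_eq_vector: "(axis 1 1 :: real^3) = vector [1, 0, 0]" "(axis 2 1 :: real^3) = vector [0, 1, 0]"
  by (simp_all add: vec_eq_iff forall_3 vector_3 axis_def)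

text \<open>First move the first axis to \<open>u\<close>. The image of the second axis can then be turned to \<open>w\<close> by a
  rotation about the first axis.\<close>

lemma rot_frame:
  assumes u: "norm u = 1" and w: "norm w = 1" and uw: "u \<bullet> w = 0"
  shows "\<exists>s. norm s = 1 \<and> rot s *v axis 1 1 = u \<and> rot s *v axis 2 1 = w"
proof -
  obtain p where p: "norm p = 1" "rot p *v axis 1 1 = u"
    using rot_transitive[of "axis 1 1" u] u norm_axis_1 by blast
  define w' where "w' = rot (qcnj p) *v w"
  have "w' \<bullet> (rot (qcnj p) *v u) = w \<bullet> u" unfolding w'_def using p by (intro inner_rot) simp
  then have "w' \<bullet> axis 1 1 = 0" using uw by (simp add: p(2)[symmetric] rot_cancel[OF p(1)] inner_commute)
  then have w1: "w'$1 = 0" by (simp add: inner_axis)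
  have "norm w' = 1" using norm_rot[of "qcnj p" w] p w by (simp add: w'_def)
  then have n: "(w'$2)\<^sup>2 + (w'$3)\<^sup>2 = 1" using w1 by (simp add: norm_vec_def L2_set_def sum_3)
  define \<alpha> where "\<alpha> = csqrt (Complex (w'$2) (w'$3))"
  have a2: "\<alpha>\<^sup>2 = Complex (w'$2) (w'$3)" by (simp add: \<alpha>_def)
  have na: "norm \<alpha> = 1" by (rule norm_eq_1_if_power[of _ 2]) (simp_all add: a2 cmod_def n)
  have "rot (\<alpha>, 0) *v axis 1 1 = axis 1 1"
    unfolding axis_eq_vector rot_about_e1[OF na] by simp
  moreover have "rot (\<alpha>, 0) *v axis 2 1 = w'"
    unfolding axis_eq_vector rot_about_e1[OF na] by (simp add: a2 vec_eq_iff forall_3 vector_3 w1)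
  ultimately have "rot (p \<odot> (\<alpha>, 0)) *v axis 1 1 = u" "rot (p \<odot> (\<alpha>, 0)) *v axis 2 1 = w"
    by (simp_all add: rot_qmul matrix_vector_mul_assoc[symmetric] p(2)) (simp add: w'_def rot_cancel[OF p(1)])
  then show ?thesis using p(1) na by (intro exI[of _ "p \<odot> (\<alpha>, 0)"]) (simp add: norm_qmul norm_Pair)
qed

lemma SO3_pow_rot:
  assumes "norm q = 1"
  shows "rot q [^]\<^bsub>SO3\<^esub> k = rot (((\<odot>) q ^^ k) qone)"
proof (induction k)
  case 0
  show ?case by (simp add: rot_one SO3_simps)
next
  case (Suc k)
  interpret SO: group SO3 by (rule group_SO3)
  have "rot q [^]\<^bsub>SO3\<^esub> Suc k = rot q \<otimes>\<^bsub>SO3\<^esub> rot q [^]\<^bsub>SO3\<^esub> k"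
    using SO.nat_pow_Suc2[OF rot_in_SO3[OF assms]] .
  then show ?case by (simp add: Suc rot_qmul SO3_simps)
qed

lemma funpow_qmul_complex: "((\<odot>) (\<alpha>, 0) ^^ k) qone = (\<alpha> ^ k, 0)"
  by (induction k) (simp_all add: qmul_def)

text \<open>A rotation about the first axis depends only on the square of the unit complex number that lifts
  it, and the squares of \<open>2n\<close>-th roots of unity are \<open>n\<close>-th roots of unity.\<close>

lemma card_rot_cyc_lift:
  assumes "n > 0"
  shows "card (rot ` cyc_lift n) \<le> n"
proof -
  have "rot ` cyc_lift n \<subseteq> (\<lambda>\<eta>. rot (csqrt \<eta>, 0)) ` {\<eta>. \<eta> ^ n = 1}"
  proof
    fix A assume "A \<in> rot ` cyc_lift n"
    then obtain \<zeta> where z: "\<zeta> ^ (2 * n) = 1" "A = rot (\<zeta>, 0)" unfolding cyc_lift_def by blast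
    have "(csqrt (\<zeta>\<^sup>2))\<^sup>2 = \<zeta>\<^sup>2" by simp
    then have "csqrt (\<zeta>\<^sup>2) = \<zeta> \<or> csqrt (\<zeta>\<^sup>2) = - \<zeta>" by (simp only: power2_eq_iff)
    then have "A = rot (csqrt (\<zeta>\<^sup>2), 0)" using rot_minus[of "(\<zeta>, 0)"] z(2) by auto
    moreover have "(\<zeta>\<^sup>2) ^ n = 1" using z(1) by (simp add: power_mult)
    ultimately show "A \<in> (\<lambda>\<eta>. rot (csqrt \<eta>, 0)) ` {\<eta>. \<eta> ^ n = 1}" by blast
  qed
  then have "card (rot ` cyc_lift n) \<le> card {\<eta>::complex. \<eta> ^ n = 1}"
    using finite_roots_unity[of n] assms by (intro surj_card_le) simp_all
  then show ?thesis using card_roots_unity_eq[OF assms] by simp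
qed

text \<open>The generated group has \<open>n\<close> elements, all of which lift to \<open>2n\<close>-th roots of unity; by counting
  there is nothing else.\<close>

lemma generate_axial_e1:
  assumes n: "n > 0" and A: "A \<in> carrier SO3" "A *v axis 1 1 = axis 1 1" "group.ord SO3 A = n"
  shows "generate SO3 {A} = rot ` cyc_lift n"
proof -
  interpret SO: group SO3 by (rule group_SO3)
  obtain \<alpha> where \<alpha>: "cmod \<alpha> = 1" "A = rot (\<alpha>, 0)" using SO3_fixing_e1 A by blast
  have nn: "norm (\<alpha>, 0::complex) = 1" using \<alpha>(1) by (simp add: norm_Pair)
  have pow: "A [^]\<^bsub>SO3\<^esub> k = rot (\<alpha> ^ k, 0)" for k :: nat
    unfolding \<alpha>(2) SO3_pow_rot[OF nn] funpow_qmul_complex ..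
  have "rot (\<alpha> ^ n, 0) = mat 1" using SO.pow_ord_eq_1[OF A(1)] by (simp add: A(3) pow SO3_simps)
  then have "(\<alpha> ^ n, 0) = qone \<or> (\<alpha> ^ n, 0) = - qone"
    using \<alpha>(1) by (intro rot_eq_one) (simp_all add: norm_Pair norm_power)
  then have "\<alpha> ^ n = 1 \<or> \<alpha> ^ n = - 1" by auto
  then have "(\<alpha> ^ n)\<^sup>2 = 1" by auto
  then have r: "\<alpha> ^ (2 * n) = 1" by (simp add: power_mult[symmetric] mult.commute)
  have "generate SO3 {A} = {A [^]\<^bsub>SO3\<^esub> k | k. k \<in> (UNIV :: nat set)}"
    using SO.generate_pow_nat[OF A(1)] A(3) n by simp
  moreover have "(\<alpha> ^ k) ^ (2 * n) = 1" for k
    by (metis r power_mult mult.commute power_one)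
  ultimately have sub: "generate SO3 {A} \<subseteq> rot ` cyc_lift n"
    unfolding cyc_lift_def pow by blast
  have fin: "finite (rot ` cyc_lift n)" using rot_image_unit_quat_group(2)[OF unit_quat_group_cyc_lift[OF n]] .
  have "card (generate SO3 {A}) = n" using SO.generate_pow_card[OF A(1)] A(3) by simp
  then show ?thesis
    using card_subset_eq[OF fin sub] card_rot_cyc_lift[OF n] card_mono[OF fin sub] by simp
qed

lemma SO3_conj:
  assumes s: "norm s = 1" and A: "A \<in> carrier SO3"
  shows "rot (qcnj s) ** A ** rot s \<in> carrier SO3"
    "rot s \<otimes>\<^bsub>SO3\<^esub> (rot (qcnj s) ** A ** rot s) \<otimes>\<^bsub>SO3\<^esub> inv\<^bsub>SO3\<^esub> (rot s) = A"
    "(rot (qcnj s) ** A ** rot s) *v u = rot (qcnj s) *v (A *v (rot s *v u))"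
proof -
  interpret SO: group SO3 by (rule group_SO3)
  have "rot (qcnj s) \<in> carrier SO3" "rot s \<in> carrier SO3" using s by (simp_all add: rot_in_SO3)
  then show "rot (qcnj s) ** A ** rot s \<in> carrier SO3"
    using A SO.m_closed by (simp add: SO3_simps[symmetric] del: SO3_simps)
  have "rot s ** (rot (qcnj s) ** A ** rot s) ** rot (qcnj s) = rot (s \<odot> qcnj s) ** A ** rot (s \<odot> qcnj s)"
    by (simp add: rot_qmul matrix_mul_assoc)
  also have "\<dots> = A" using s by (simp add: qmul_qcnj rot_one)
  finally show "rot s \<otimes>\<^bsub>SO3\<^esub> (rot (qcnj s) ** A ** rot s) \<otimes>\<^bsub>SO3\<^esub> inv\<^bsub>SO3\<^esub> (rot s) = A"
    using s by (simp add: SO3_simps SO3_inv_rot)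
  show "(rot (qcnj s) ** A ** rot s) *v u = rot (qcnj s) *v (A *v (rot s *v u))"
    by (simp add: matrix_vector_mul_assoc matrix_mul_assoc)
qed

lemma ord_conj_SO3:
  assumes Q: "Q \<in> carrier SO3" and B: "B \<in> carrier SO3"
  shows "group.ord SO3 (Q \<otimes>\<^bsub>SO3\<^esub> B \<otimes>\<^bsub>SO3\<^esub> inv\<^bsub>SO3\<^esub> Q) = group.ord SO3 B"
proof -
  interpret SO: group SO3 by (rule group_SO3)
  let ?h = "\<lambda>A. Q \<otimes>\<^bsub>SO3\<^esub> A \<otimes>\<^bsub>SO3\<^esub> inv\<^bsub>SO3\<^esub> Q"
  interpret h: group_hom SO3 SO3 ?h by (rule group_hom_conj_SO3[OF Q])
  have one: "?h C = \<one>\<^bsub>SO3\<^esub> \<longleftrightarrow> C = \<one>\<^bsub>SO3\<^esub>" if C: "C \<in> carrier SO3" for C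
  proof
    assume "?h C = \<one>\<^bsub>SO3\<^esub>"
    then have "inv\<^bsub>SO3\<^esub> Q \<otimes>\<^bsub>SO3\<^esub> ?h C \<otimes>\<^bsub>SO3\<^esub> Q = \<one>\<^bsub>SO3\<^esub>" using Q by simp
    moreover have "inv\<^bsub>SO3\<^esub> Q \<otimes>\<^bsub>SO3\<^esub> ?h C \<otimes>\<^bsub>SO3\<^esub> Q =
       (inv\<^bsub>SO3\<^esub> Q \<otimes>\<^bsub>SO3\<^esub> Q) \<otimes>\<^bsub>SO3\<^esub> C \<otimes>\<^bsub>SO3\<^esub> (inv\<^bsub>SO3\<^esub> Q \<otimes>\<^bsub>SO3\<^esub> Q)"
      using Q C by (simp only: SO.m_assoc SO.m_closed SO.inv_closed)
    ultimately show "C = \<one>\<^bsub>SO3\<^esub>" using Q C by simp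
  qed (use Q in simp)
  have "(?h B [^]\<^bsub>SO3\<^esub> k = \<one>\<^bsub>SO3\<^esub>) \<longleftrightarrow> SO.ord B dvd k" for k :: nat
    using h.hom_nat_pow[OF B, of k] one[of "B [^]\<^bsub>SO3\<^esub> k"] SO.pow_eq_id[OF B, of k] B by simp
  then show ?thesis using SO.ord_unique[of "?h B" "SO.ord B"] Q B by simp
qed

text \<open>Up to conjugation the axis is the first one, and the lift \<open>\<alpha>\<close> satisfies \<open>\<alpha>\<^sup>2 = \<plusminus>1\<close>. The sign is
  negative because the rotation is not the identity, so the lift is the imaginary unit of the axis.\<close>

lemma order_2_rotation:
  assumes w: "norm w = 1" and B: "B \<in> carrier SO3" "B *v w = w" "group.ord SO3 B = 2"
  shows "B = rot (imq w)"
proof -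
  interpret SO: group SO3 by (rule group_SO3)
  obtain s where s: "norm s = 1" "rot s *v axis 1 1 = w"
    using rot_transitive[of "axis 1 1" w] w norm_axis_1 by blast
  define C where "C = rot (qcnj s) ** B ** rot s"
  note C = SO3_conj[OF s(1) B(1), folded C_def]
  have "C *v axis 1 1 = axis 1 1"
    unfolding C(3) s(2) B(2) by (simp add: s(2)[symmetric] rot_cancel[OF s(1)])
  then obtain \<alpha> where \<alpha>: "cmod \<alpha> = 1" "C = rot (\<alpha>, 0)" using SO3_fixing_e1 C(1) by blast
  have ordC: "SO.ord C = 2"
    using ord_conj_SO3[OF rot_in_SO3[OF s(1)] C(1)] unfolding C(2) B(3) by simp
  have nn: "norm (\<alpha>, 0::complex) = 1" using \<alpha>(1) by (simp add: norm_Pair)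
  have "C [^]\<^bsub>SO3\<^esub> (2::nat) = \<one>\<^bsub>SO3\<^esub>" using SO.pow_ord_eq_1[OF C(1)] by (simp add: ordC)
  then have "rot (\<alpha>\<^sup>2, 0) = mat 1"
    unfolding \<alpha>(2) SO3_pow_rot[OF nn] funpow_qmul_complex by (simp add: SO3_simps)
  then have "(\<alpha>\<^sup>2, 0) = qone \<or> (\<alpha>\<^sup>2, 0) = - qone"
    using \<alpha>(1) by (intro rot_eq_one) (simp_all add: norm_Pair norm_power)
  then consider "\<alpha>\<^sup>2 = 1" | "\<alpha>\<^sup>2 = - 1" by auto
  then show ?thesis
  proof cases
    case 1
    then have "\<alpha> = 1 \<or> \<alpha> = - 1" by (simp add: power2_eq_1_iff)
    then have "C = \<one>\<^bsub>SO3\<^esub>" using \<alpha>(2) rot_one rot_minus[of qone] by (auto simp: SO3_simps)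
    then have "SO.ord C = 1" by simp
    then show ?thesis using ordC by simp
  next
    case 2
    then have "(\<alpha> - \<i>) * (\<alpha> + \<i>) = 0" by (simp add: algebra_simps power2_eq_square)
    then have "\<alpha> = \<i> \<or> \<alpha> = - \<i>" by (simp add: eq_neg_iff_add_eq_0)
    then have "C = rot (\<i>, 0)" using \<alpha>(2) rot_minus[of "(\<i>, 0)"] by auto
    then have "B = rot (s \<odot> (\<i>, 0) \<odot> qcnj s)"
      using C(2) s(1) by (simp add: SO3_simps SO3_inv_rot rot_qmul)
    also have "s \<odot> (\<i>, 0) \<odot> qcnj s = imq w" unfolding s(2)[symmetric] imq_rot imq_axis ..
    finally show ?thesis .
  qed
qed

lemma unit_axis:
  assumes "axial_rotation v n A"
  shows "norm (sgn v) = 1" "A \<in> carrier SO3" "A *v sgn v = sgn v" "group.ord SO3 A = n"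
  using assms unfolding axial_rotation_def
  by (simp_all add: norm_sgn sgn_div_norm matrix_vector_mult_scaleR)

lemma conjugate_generate:
  assumes s: "norm s = 1" and K: "K \<subseteq> carrier SO3"
  shows "conjugate_in SO3 (generate SO3 ((\<lambda>A. rot (qcnj s) ** A ** rot s) ` K)) (generate SO3 K)"
proof -
  let ?h = "\<lambda>A. rot s \<otimes>\<^bsub>SO3\<^esub> A \<otimes>\<^bsub>SO3\<^esub> inv\<^bsub>SO3\<^esub> (rot s)"
  let ?K = "(\<lambda>A. rot (qcnj s) ** A ** rot s) ` K"
  have Q: "rot s \<in> carrier SO3" using rot_in_SO3[OF s] .
  interpret h: group_hom SO3 SO3 ?h by (rule group_hom_conj_SO3[OF Q])
  have "?K \<subseteq> carrier SO3" using SO3_conj(1)[OF s] K by blast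
  moreover have "?h ` ?K = K"
  proof -
    have "?h (rot (qcnj s) ** A ** rot s) = A" if "A \<in> K" for A using SO3_conj(2)[OF s] K that by blast
    then show ?thesis unfolding image_image by (simp cong: image_cong)
  qed
  ultimately have "generate SO3 K = ?h ` generate SO3 ?K" using h.generate_img by metis
  then show ?thesis unfolding conjugate_in_def using Q by blast
qed

lemma cyclic_rotation_group_conj:
  assumes G: "cyclic_rotation_group n G" and n: "n > 0"
  shows "conjugate_in SO3 (rot ` cyc_lift n) G"
proof -
  obtain v A where vA: "axial_rotation v n A" "G = generate SO3 {A}"
    using G unfolding cyclic_rotation_group_def by blast
  note a = unit_axis[OF vA(1)]
  obtain s where s: "norm s = 1" "rot s *v axis 1 1 = sgn v"
    using rot_transitive[of "axis 1 1" "sgn v"] a(1) norm_axis_1 by blast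
  define B where "B = rot (qcnj s) ** A ** rot s"
  note B = SO3_conj[OF s(1) a(2), folded B_def]
  have "B *v axis 1 1 = axis 1 1"
    unfolding B(3) s(2) a(3) by (simp add: s(2)[symmetric] rot_cancel[OF s(1)])
  moreover have "group.ord SO3 B = n"
    using ord_conj_SO3[OF rot_in_SO3[OF s(1)] B(1)] unfolding B(2) a(4) by simp
  ultimately have "generate SO3 {B} = rot ` cyc_lift n" by (rule generate_axial_e1[OF n B(1)])
  then show ?thesis using conjugate_generate[OF s(1), of "{A}"] a(2) by (simp add: vA(2) B_def)
qed

lemma dihedral_rotation_group_conj:
  assumes G: "dihedral_rotation_group n G" and n: "n > 0"
  shows "conjugate_in SO3 (rot ` dih_lift n) G"
proof -
  interpret SO: group SO3 by (rule group_SO3)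
  obtain v w A A' where vA: "axial_rotation v n A" "axial_rotation w 2 A'" "v \<bullet> w = 0"
      "G = generate SO3 {A, A'}"
    using G unfolding dihedral_rotation_group_def by blast
  note a = unit_axis[OF vA(1)] and a' = unit_axis[OF vA(2)]
  have "sgn v \<bullet> sgn w = 0" using vA(3) by (simp add: sgn_div_norm)
  then obtain s where s: "norm s = 1" "rot s *v axis 1 1 = sgn v" "rot s *v axis 2 1 = sgn w"
    using rot_frame[OF a(1) a'(1)] by blast
  define B B' where BB: "B = rot (qcnj s) ** A ** rot s" "B' = rot (qcnj s) ** A' ** rot s"
  note B = SO3_conj[OF s(1) a(2), folded BB] and B' = SO3_conj[OF s(1) a'(2), folded BB]
  have "B *v axis 1 1 = axis 1 1"
    unfolding B(3) s(2) a(3) by (simp add: s(2)[symmetric] rot_cancel[OF s(1)])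
  moreover have "group.ord SO3 B = n"
    using ord_conj_SO3[OF rot_in_SO3[OF s(1)] B(1)] unfolding B(2) a(4) by simp
  ultimately have gB: "generate SO3 {B} = rot ` cyc_lift n" by (rule generate_axial_e1[OF n B(1)])
  have "B' *v axis 2 1 = axis 2 1"
    unfolding B'(3) s(3) a'(3) by (simp add: s(3)[symmetric] rot_cancel[OF s(1)])
  moreover have "group.ord SO3 B' = 2"
    using ord_conj_SO3[OF rot_in_SO3[OF s(1)] B'(1)] unfolding B'(2) a'(4) by simp
  ultimately have B'J: "B' = rot qJ"
    using order_2_rotation[of "axis 2 1" B'] B'(1) norm_axis_1 by (simp add: imq_axis)
  have "generate SO3 {B, B'} = rot ` dih_lift n"
  proof
    have "B \<in> rot ` cyc_lift n" using gB generate.incl[of B "{B}" SO3] by simp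
    moreover have "B' \<in> rot ` dih_lift n"
    proof -
      have "qone \<odot> qJ \<in> dih_lift n"
        using unit_quat_groupD(2)[OF unit_quat_group_cyc_lift[OF n]] unfolding dih_lift_def by blast
      then show ?thesis unfolding B'J by simp
    qed
    ultimately have "{B, B'} \<subseteq> rot ` dih_lift n" unfolding dih_lift_def by blast
    then show "generate SO3 {B, B'} \<subseteq> rot ` dih_lift n"
      using SO.generate_subgroup_incl rot_image_unit_quat_group(1)[OF unit_quat_group_dih_lift[OF n]] by blast
    have c: "rot a \<in> generate SO3 {B, B'}" if "a \<in> cyc_lift n" for a
      using SO.mono_generate[of "{B}" "{B, B'}"] gB that by blast
    moreover have "rot (a \<odot> qJ) \<in> generate SO3 {B, B'}" if "a \<in> cyc_lift n" for a
      using generate.eng[OF c[OF that] generate.incl[of B']] by (simp add: SO3_simps rot_qmul B'J)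
    ultimately show "rot ` dih_lift n \<subseteq> generate SO3 {B, B'}" unfolding dih_lift_def by blast
  qed
  then show ?thesis using conjugate_generate[OF s(1), of "{A, A'}"] a(2) a'(2) by (simp add: vA(4) BB)
qed

lemma carries_bicoset_structure_unit_quat_group:
  assumes "unit_quat_group \<Gamma>" "Hausdorff_space X" "bicoset_orbit_map X \<Gamma> F" "conjugate_in SO3 (rot ` \<Gamma>) G"
  shows "carries_bicoset_structure X G"
  using carries_bicoset_structure_conjugate[OF _ _ assms(2) _ assms(4)] assms(3)
    rot_image_unit_quat_group[OF assms(1)] by simp

lemma cyclic_carries:
  assumes "cyclic_rotation_group n G" "n > 0"
  shows "carries_bicoset_structure RP3 G"
  using carries_bicoset_structure_unit_quat_group[OF unit_quat_group_cyc_lift Hausdorff_RP3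
      cyclic_orbit_map cyclic_rotation_group_conj] assms by blast

lemma dihedral_even_carries:
  assumes "dihedral_rotation_group n G" "n > 0" "even n"
  shows "carries_bicoset_structure S3 G"
  using carries_bicoset_structure_unit_quat_group[OF unit_quat_group_dih_lift Hausdorff_S3
      dihedral_even_orbit_map dihedral_rotation_group_conj] assms by blast

lemma dihedral_odd_carries:
  assumes "dihedral_rotation_group n G" "odd n"
  shows "carries_bicoset_structure RP3 G"
proof -
  have "n > 0" using assms(2) by (cases n) auto
  then show ?thesis
    using carries_bicoset_structure_unit_quat_group[OF unit_quat_group_dih_lift Hausdorff_RP3
      _ dihedral_rotation_group_conj] assms dihedral_odd_orbit_map by blast
qed

section \<open>Chambers of finite reflection groups\<close>

text \<open>A finite set \<open>W\<close> of isometries that permutes a set \<open>\<Phi>\<close> of unit roots, with simple roots \<open>\<alpha>\<close> and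
  weights \<open>\<omega>\<close> dual to them up to positive factors. The elements of \<open>W\<close> are names of maps rather than
  maps, so that they can carry data such as sign characters. The operation \<open>mulr\<close> composes with a
  simple reflection from the right; existence and uniqueness of representatives in the chamber both
  rest on it. The assumption \<open>root_sign\<close> says that no wall
  cuts through the chamber, which is the cone spanned by the weights.\<close>

locale reflection_chamber =
  fixes W :: "'w set" and act :: "'w \<Rightarrow> 'a::euclidean_space \<Rightarrow> 'a" and \<Phi> :: "'a set"
    and \<alpha> \<omega> :: "'i::finite \<Rightarrow> 'a" and mulr :: "'w \<Rightarrow> 'i \<Rightarrow> 'w"
  assumes finW: "finite W" and neW: "W \<noteq> {}" and finPhi: "finite \<Phi>"
    and orth: "w \<in> W \<Longrightarrow> orthogonal_transformation (act w)"
    and act_root: "w \<in> W \<Longrightarrow> \<beta> \<in> \<Phi> \<Longrightarrow> act w \<beta> \<in> \<Phi>"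
    and unit_root: "\<beta> \<in> \<Phi> \<Longrightarrow> norm \<beta> = 1"
    and simple_root: "\<alpha> i \<in> \<Phi>"
    and dual: "i \<noteq> j \<Longrightarrow> \<alpha> i \<bullet> \<omega> j = 0" and dual_pos: "\<alpha> i \<bullet> \<omega> i > 0"
    and nondegenerate: "(\<And>i. x \<bullet> \<alpha> i = 0) \<Longrightarrow> x = 0"
    and root_sign: "\<beta> \<in> \<Phi> \<Longrightarrow> (\<forall>i. \<beta> \<bullet> \<omega> i \<ge> 0) \<or> (\<forall>i. \<beta> \<bullet> \<omega> i \<le> 0)"
    and mulr: "w \<in> W \<Longrightarrow> mulr w i \<in> W"
    and act_mulr: "w \<in> W \<Longrightarrow> act (mulr w i) x = act w (x - (2 * (x \<bullet> \<alpha> i)) *\<^sub>R \<alpha> i)"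
begin

definition chamber :: "'a set" where
  "chamber = {x. \<forall>i. x \<bullet> \<alpha> i \<ge> 0}"

lemma closed_chamber: "closed chamber"
  unfolding chamber_def by (intro closed_Collect_all closed_Collect_le continuous_intros)

lemma linear_act: "w \<in> W \<Longrightarrow> linear (act w)"
  using orth orthogonal_transformation_linear by blast

lemma inner_act: "w \<in> W \<Longrightarrow> act w x \<bullet> act w y = x \<bullet> y"
  using orth orthogonal_transformation_def by blast

lemma norm_act: "w \<in> W \<Longrightarrow> norm (act w x) = norm x"
  by (simp add: norm_eq_sqrt_inner inner_act)

lemma weight_expansion: "x = (\<Sum>i\<in>UNIV. (x \<bullet> \<alpha> i / (\<alpha> i \<bullet> \<omega> i)) *\<^sub>R \<omega> i)"
proof -
  let ?y = "\<Sum>i\<in>UNIV. (x \<bullet> \<alpha> i / (\<alpha> i \<bullet> \<omega> i)) *\<^sub>R \<omega> i"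
  have "(x - ?y) \<bullet> \<alpha> j = 0" for j
  proof -
    have "?y \<bullet> \<alpha> j = (\<Sum>i\<in>UNIV. x \<bullet> \<alpha> i / (\<alpha> i \<bullet> \<omega> i) * (\<omega> i \<bullet> \<alpha> j))"
      by (simp add: inner_sum_left)
    also have "\<dots> = (\<Sum>i\<in>UNIV. if i = j then x \<bullet> \<alpha> j else 0)"
      using dual dual_pos by (intro sum.cong) (auto simp: inner_commute[of "\<omega> _"] less_le)
    finally show ?thesis by (simp add: inner_diff_left)
  qed
  then show ?thesis using nondegenerate[of "x - ?y"] by simp
qed

lemma weights_nondegenerate:
  assumes "\<And>i. x \<bullet> \<omega> i = 0"
  shows "x = 0"
proof -
  have "x \<bullet> x = x \<bullet> (\<Sum>i\<in>UNIV. (x \<bullet> \<alpha> i / (\<alpha> i \<bullet> \<omega> i)) *\<^sub>R \<omega> i)"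
    using weight_expansion by simp
  also have "\<dots> = 0" by (simp add: inner_sum_right assms)
  finally show ?thesis by simp
qed

lemma root_expansion: "x = (\<Sum>i\<in>UNIV. (x \<bullet> \<omega> i / (\<alpha> i \<bullet> \<omega> i)) *\<^sub>R \<alpha> i)"
proof -
  let ?y = "\<Sum>i\<in>UNIV. (x \<bullet> \<omega> i / (\<alpha> i \<bullet> \<omega> i)) *\<^sub>R \<alpha> i"
  have "(x - ?y) \<bullet> \<omega> j = 0" for j
  proof -
    have "?y \<bullet> \<omega> j = (\<Sum>i\<in>UNIV. x \<bullet> \<omega> i / (\<alpha> i \<bullet> \<omega> i) * (\<alpha> i \<bullet> \<omega> j))"
      by (simp add: inner_sum_left)
    also have "\<dots> = (\<Sum>i\<in>UNIV. if i = j then x \<bullet> \<omega> j else 0)"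
      using dual dual_pos by (intro sum.cong) (auto simp: less_le)
    finally show ?thesis by (simp add: inner_diff_left)
  qed
  then show ?thesis using weights_nondegenerate[of "x - ?y"] by simp
qed

definition positive :: "'a \<Rightarrow> bool" where
  "positive \<beta> \<longleftrightarrow> \<beta> \<in> \<Phi> \<and> (\<forall>i. \<beta> \<bullet> \<omega> i \<ge> 0)"

lemma inner_positive_chamber:
  assumes "\<forall>i. \<beta> \<bullet> \<omega> i \<ge> 0" "x \<in> chamber"
  shows "x \<bullet> \<beta> \<ge> 0"
proof -
  have "x \<bullet> \<beta> = (\<Sum>i\<in>UNIV. (x \<bullet> \<alpha> i / (\<alpha> i \<bullet> \<omega> i)) *\<^sub>R \<omega> i) \<bullet> \<beta>"
    using weight_expansion by simp
  also have "\<dots> = (\<Sum>i\<in>UNIV. (x \<bullet> \<alpha> i / (\<alpha> i \<bullet> \<omega> i)) * (\<beta> \<bullet> \<omega> i))"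
    by (simp add: inner_sum_left inner_commute[of "\<omega> _"])
  also have "\<dots> \<ge> 0"
    using assms dual_pos by (intro sum_nonneg mult_nonneg_nonneg divide_nonneg_pos) (auto simp: chamber_def)
  finally show ?thesis .
qed

definition \<rho> :: 'a where "\<rho> = (\<Sum>i\<in>UNIV. \<omega> i)"

lemma rho_simple: "\<rho> \<bullet> \<alpha> i > 0"
proof -
  have "\<rho> \<bullet> \<alpha> i = (\<Sum>j\<in>UNIV. if j = i then \<alpha> i \<bullet> \<omega> i else 0)"
    unfolding \<rho>_def inner_sum_left using dual by (intro sum.cong) (auto simp: inner_commute)
  then show ?thesis using dual_pos by simp
qed

text \<open>Among all images of the interior point \<open>\<rho>\<close> choose one that is closest to \<open>x\<close>. If the
  corresponding chamber did not contain \<open>x\<close>, reflecting \<open>\<rho>\<close> in the wall that separates it from \<open>x\<close>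
  would bring it closer.\<close>

lemma chamber_represents: "\<exists>w\<in>W. \<exists>c\<in>chamber. x = act w c"
proof -
  let ?f = "\<lambda>w. x \<bullet> act w \<rho>"
  have "Max (?f ` W) \<in> ?f ` W" using finW neW by (intro Max_in) auto
  then obtain w where w: "w \<in> W" and "?f w = Max (?f ` W)" by auto
  then have max: "?f v \<le> ?f w" if "v \<in> W" for v
    using finW that by simp
  obtain c where c: "x = act w c" using orthogonal_transformation_surj[OF orth[OF w]] by blast
  have "c \<bullet> \<alpha> i \<ge> 0" for i
  proof -
    have "?f (mulr w i) \<le> ?f w" using max mulr[OF w] .
    then have "c \<bullet> (\<rho> - (2 * (\<rho> \<bullet> \<alpha> i)) *\<^sub>R \<alpha> i) \<le> c \<bullet> \<rho>"
      by (simp add: c act_mulr[OF w] inner_act[OF w])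
    then have "(\<rho> \<bullet> \<alpha> i) * (c \<bullet> \<alpha> i) \<ge> 0" by (simp add: inner_diff_right mult.commute)
    then show ?thesis using rho_simple[of i] by (simp add: zero_le_mult_iff)
  qed
  then show ?thesis using w c unfolding chamber_def by blast
qed

lemma inner_rho_negative_root:
  assumes "\<beta> \<in> \<Phi>" "\<forall>i. \<beta> \<bullet> \<omega> i \<le> 0"
  shows "\<beta> \<bullet> \<rho> < 0"
proof -
  have "\<beta> \<noteq> 0" using unit_root[OF assms(1)] by auto
  then obtain k where "\<beta> \<bullet> \<omega> k \<noteq> 0" using weights_nondegenerate by blast
  then have k: "\<beta> \<bullet> \<omega> k < 0" using assms(2) by (meson less_le)
  have "\<beta> \<bullet> \<rho> = \<beta> \<bullet> \<omega> k + (\<Sum>i\<in>UNIV - {k}. \<beta> \<bullet> \<omega> i)"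
    unfolding \<rho>_def inner_sum_right by (rule sum.remove) auto
  moreover have "(\<Sum>i\<in>UNIV - {k}. \<beta> \<bullet> \<omega> i) \<le> 0" using assms(2) by (intro sum_nonpos) auto
  ultimately show ?thesis using k by simp
qed

text \<open>An isometry that maps simple roots to positive roots permutes the positive roots. Writing the
  image of a simple root as a non-negative combination of simple roots and applying the inverse
  expresses \<open>\<alpha> j\<close> as a non-negative combination of positive roots. As the coefficients of \<open>\<alpha> j\<close> at
  the other simple roots vanish, every root that really occurs is a multiple of \<open>\<alpha> j\<close>, hence equal to
  it.\<close>

lemma permutes_simple_roots:
  assumes v: "v \<in> W" and pos: "\<And>i. positive (act v (\<alpha> i))"
  shows "\<exists>k. act v (\<alpha> j) = \<alpha> k"
proof -
  have posv: "positive (act v \<beta>)" if "positive \<beta>" for \<beta>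
  proof -
    have "act v \<beta> = (\<Sum>i\<in>UNIV. (\<beta> \<bullet> \<omega> i / (\<alpha> i \<bullet> \<omega> i)) *\<^sub>R act v (\<alpha> i))"
      by (subst root_expansion[of \<beta>])
        (simp add: linear_sum[OF linear_act[OF v]] linear_cmul[OF linear_act[OF v]])
    then have e: "act v \<beta> \<bullet> \<omega> m = (\<Sum>i\<in>UNIV. (\<beta> \<bullet> \<omega> i / (\<alpha> i \<bullet> \<omega> i)) * (act v (\<alpha> i) \<bullet> \<omega> m))" for m
      by (simp add: inner_sum_left)
    have "act v \<beta> \<bullet> \<omega> m \<ge> 0" for m
      unfolding e using that pos dual_pos
      by (intro sum_nonneg mult_nonneg_nonneg divide_nonneg_pos) (auto simp: positive_def)
    then show ?thesis using that act_root[OF v] by (simp add: positive_def)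
  qed
  have "inj (act v)" using orthogonal_transformation_inj[OF orth[OF v]] .
  then have "inj_on (act v) {\<beta>. positive \<beta>}" by (rule inj_on_subset) simp
  moreover have "finite {\<beta>. positive \<beta>}" using finPhi by (rule rev_finite_subset) (auto simp: positive_def)
  ultimately have onto: "act v ` {\<beta>. positive \<beta>} = {\<beta>. positive \<beta>}"
    using posv by (intro endo_inj_surj) auto
  have pa: "positive (\<alpha> k)" for k
    unfolding positive_def using simple_root dual dual_pos by (metis less_le order_refl)
  have "\<exists>u. positive u \<and> \<alpha> k = act v u" for k
  proof -
    have "\<alpha> k \<in> act v ` {\<beta>. positive \<beta>}" unfolding onto using pa by simp
    then show ?thesis by blast
  qed
  then obtain u where u: "\<And>k. positive (u k)" "\<And>k. \<alpha> k = act v (u k)" by metis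
  define c where "c k = act v (\<alpha> j) \<bullet> \<omega> k / (\<alpha> k \<bullet> \<omega> k)" for k
  have c0: "c k \<ge> 0" for k
    unfolding c_def using pos[of j] dual_pos by (intro divide_nonneg_pos) (auto simp: positive_def)
  have "act v (\<alpha> j) = (\<Sum>k\<in>UNIV. c k *\<^sub>R \<alpha> k)" unfolding c_def by (rule root_expansion)
  also have "\<dots> = (\<Sum>k\<in>UNIV. c k *\<^sub>R act v (u k))" using u(2) by simp
  also have "\<dots> = act v (\<Sum>k\<in>UNIV. c k *\<^sub>R u k)"
    by (simp add: linear_sum[OF linear_act[OF v]] linear_cmul[OF linear_act[OF v]])
  finally have aj: "\<alpha> j = (\<Sum>k\<in>UNIV. c k *\<^sub>R u k)" using \<open>inj (act v)\<close> by (simp add: inj_eq)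
  have "\<alpha> j \<noteq> 0" using unit_root[OF simple_root[of j]] by auto
  then obtain k where "c k \<noteq> 0" using aj by (metis (no_types, lifting) scaleR_zero_left sum.neutral)
  then have k: "c k > 0" using c0 by (simp add: less_le)
  have z: "u k \<bullet> \<omega> m = 0" if "m \<noteq> j" for m
  proof -
    have "0 = (\<Sum>k\<in>UNIV. c k * (u k \<bullet> \<omega> m))"
      using arg_cong[OF aj, of "\<lambda>x. x \<bullet> \<omega> m"] dual[of j m] that by (simp add: inner_sum_left)
    then have "c k * (u k \<bullet> \<omega> m) = 0"
      using sum_nonneg_eq_0_iff[of UNIV "\<lambda>k. c k * (u k \<bullet> \<omega> m)"] c0 u(1) by (simp add: positive_def)
    then show ?thesis using k by simp
  qed
  have "u k = (\<Sum>m\<in>UNIV. (u k \<bullet> \<omega> m / (\<alpha> m \<bullet> \<omega> m)) *\<^sub>R \<alpha> m)" by (rule root_expansion)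
  also have "\<dots> = (\<Sum>m\<in>UNIV. if m = j then (u k \<bullet> \<omega> j / (\<alpha> j \<bullet> \<omega> j)) *\<^sub>R \<alpha> j else 0)"
    using z by (intro sum.cong) auto
  finally have uk: "u k = (u k \<bullet> \<omega> j / (\<alpha> j \<bullet> \<omega> j)) *\<^sub>R \<alpha> j" by simp
  define t where "t = u k \<bullet> \<omega> j / (\<alpha> j \<bullet> \<omega> j)"
  have "t \<ge> 0" unfolding t_def using u(1)[of k] dual_pos[of j] by (simp add: positive_def)
  moreover have "norm (u k) = 1" using u(1)[of k] unit_root by (simp add: positive_def)
  moreover have "norm (u k) = \<bar>t\<bar>"
    using arg_cong[OF uk[folded t_def], of norm] unit_root[OF simple_root[of j]] by simp
  ultimately have "u k = \<alpha> j" using uk[folded t_def] by simp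
  then show ?thesis using u(2)[of k] by metis
qed

text \<open>This replaces the length function of a Coxeter group. If \<open>x\<close> and its image lie in the chamber and a
  simple root \<open>\<alpha> i\<close> is mapped to a negative root, then \<open>x\<close> lies on the wall of \<open>\<alpha> i\<close>, so composing with
  the reflection in it does not change the image of \<open>x\<close>. It moves the image of \<open>\<rho>\<close> closer to \<open>\<rho>\<close>,
  which can happen only finitely often. In the end all simple roots are mapped to positive roots, hence
  permuted. Thus \<open>P\<close> has to be checked for isometries that permute the simple roots, and to be
  propagated along simple reflections that fix \<open>x\<close>.\<close>

lemma chamber_induct:
  assumes w: "w \<in> W" and x: "x \<in> chamber" and wx: "act w x \<in> chamber"
    and base: "\<And>v. v \<in> W \<Longrightarrow> act v x = act w x \<Longrightarrow> (\<And>j. \<exists>k. act v (\<alpha> j) = \<alpha> k) \<Longrightarrow> P v"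
    and step: "\<And>v i. v \<in> W \<Longrightarrow> x \<bullet> \<alpha> i = 0 \<Longrightarrow> P (mulr v i) \<Longrightarrow> P v"
  shows "P w"
proof -
  let ?val = "\<lambda>v. act v \<rho> \<bullet> \<rho>"
  let ?m = "\<lambda>v. card {u \<in> W. ?val u > ?val v}"
  have "v \<in> W \<Longrightarrow> act v x = act w x \<Longrightarrow> P v" for v
  proof (induction "?m v" arbitrary: v rule: less_induct)
    case less
    show ?case
    proof (cases "\<forall>i. positive (act v (\<alpha> i))")
      case True
      then show ?thesis using base less.prems permutes_simple_roots by blast
    next
      case False
      then obtain i where "\<not> positive (act v (\<alpha> i))" by blast
      then have neg: "\<forall>k. act v (\<alpha> i) \<bullet> \<omega> k \<le> 0"
        using root_sign[OF act_root[OF less.prems(1) simple_root]] act_root[OF less.prems(1) simple_root]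
        by (auto simp: positive_def)
      have "act w x \<bullet> (- act v (\<alpha> i)) \<ge> 0"
        by (rule inner_positive_chamber[OF _ wx]) (use neg in simp)
      then have "x \<bullet> \<alpha> i \<le> 0"
        using inner_act[OF less.prems(1), of x "\<alpha> i"] less.prems(2) by simp
      moreover have "x \<bullet> \<alpha> i \<ge> 0" using x by (simp add: chamber_def)
      ultimately have xi: "x \<bullet> \<alpha> i = 0" by simp
      have mv: "mulr v i \<in> W" using mulr less.prems(1) by blast
      have "act (mulr v i) x = act w x" using act_mulr[OF less.prems(1), of i x] xi less.prems(2) by simp
      \<comment> \<open>The inner product of \<open>\<rho>\<close> with its image grows, since \<open>\<rho>\<close> is positive on \<open>\<alpha> i\<close> and negative on the image of \<open>\<alpha> i\<close>.\<close>
      moreover have "?val (mulr v i) > ?val v"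
      proof -
        have "?val (mulr v i) = ?val v - 2 * (\<rho> \<bullet> \<alpha> i) * (act v (\<alpha> i) \<bullet> \<rho>)"
          using linear_act[OF less.prems(1)]
          by (simp add: act_mulr[OF less.prems(1)] linear_diff linear_cmul inner_diff_left)
        moreover have "(\<rho> \<bullet> \<alpha> i) * (act v (\<alpha> i) \<bullet> \<rho>) < 0"
          using rho_simple inner_rho_negative_root[OF act_root[OF less.prems(1) simple_root] neg]
          by (simp add: mult_pos_neg)
        ultimately show ?thesis by simp
      qed
      then have "?m (mulr v i) < ?m v"
        using finW mv by (intro psubset_card_mono) auto
      ultimately have "P (mulr v i)" using less.hyps mv by blast
      then show ?thesis using step[OF less.prems(1) xi] by blast
    qed
  qed
  then show ?thesis using w by blast
qed

lemma act_eq_id_if_fixes_simple: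
  assumes "v \<in> W" "\<And>j. act v (\<alpha> j) = \<alpha> j"
  shows "act v x = x"
proof -
  have "act v x = (\<Sum>i\<in>UNIV. (x \<bullet> \<omega> i / (\<alpha> i \<bullet> \<omega> i)) *\<^sub>R act v (\<alpha> i))"
    by (subst root_expansion[of x])
      (simp add: linear_sum[OF linear_act[OF assms(1)]] linear_cmul[OF linear_act[OF assms(1)]])
  also have "\<dots> = x" unfolding assms(2) by (rule root_expansion[symmetric])
  finally show ?thesis .
qed

text \<open>The images of the chamber are finitely many closed sets that cover the space, so functions that
  are continuous on each and agree on the overlaps can be glued.\<close>

lemma chamber_gluing:
  fixes g :: "'w \<Rightarrow> 'a \<Rightarrow> 'b::topological_space"
  assumes cont: "\<And>w. w \<in> W \<Longrightarrow> continuous_on UNIV (g w)"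
    and wd: "\<And>w w' c c'. \<lbrakk>w \<in> W; w' \<in> W; c \<in> chamber; c' \<in> chamber; act w c = act w' c'\<rbrakk> \<Longrightarrow> g w c = g w' c'"
  shows "\<exists>F. continuous_on UNIV F \<and> (\<forall>w\<in>W. \<forall>c\<in>chamber. F (act w c) = g w c)"
proof -
  have "\<exists>y. \<forall>w\<in>W. \<forall>c\<in>chamber. x = act w c \<longrightarrow> y = g w c" for x
  proof -
    obtain w c where wc: "w \<in> W" "c \<in> chamber" "x = act w c" using chamber_represents by blast
    have "g w c = g w' c'" if "w' \<in> W" "c' \<in> chamber" "x = act w' c'" for w' c'
      by (rule wd[OF wc(1) that(1) wc(2) that(2)]) (simp only: wc(3)[symmetric] that(3)[symmetric])
    then show ?thesis by (intro exI[of _ "g w c"] ballI impI)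
  qed
  then obtain F where F: "\<And>w c. w \<in> W \<Longrightarrow> c \<in> chamber \<Longrightarrow> F (act w c) = g w c" by metis
  have "continuous_on (\<Union>w\<in>W. act w ` chamber) F"
  proof (rule continuous_on_closed_Union)
    show "finite W" by (rule finW)
    fix w assume w: "w \<in> W"
    have bij: "bij (act w)" using orthogonal_transformation_bij[OF orth[OF w]] .
    have oi: "orthogonal_transformation (inv_into UNIV (act w))" using orthogonal_transformation_inv[OF orth[OF w]] .
    have ci: "continuous_on S (inv_into UNIV (act w))" for S
      using linear_continuous_on[OF linear_linear[THEN iffD2, OF orthogonal_transformation_linear[OF oi]]] .
    show "closed (act w ` chamber)"
      using closed_injective_linear_image[OF closed_chamber linear_act[OF w]] bij bij_is_inj by blast
    have "continuous_on (act w ` chamber) (\<lambda>x. g w (inv_into UNIV (act w) x))"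
      by (rule continuous_on_compose2[OF cont[OF w] ci]) simp
    then show "continuous_on (act w ` chamber) F"
      by (rule continuous_on_eq) (use F w bij_is_inj[OF bij] in auto)
  qed
  moreover have "(\<Union>w\<in>W. act w ` chamber) = UNIV" using chamber_represents by blast
  ultimately show ?thesis using F by (intro exI[of _ F]) auto
qed

end

section \<open>Reflection groups generated by finite groups of unit quaternions\<close>

text \<open>Names of the isometries \<open>x \<mapsto> a x b\<close> and \<open>x \<mapsto> a x\<^sup>* b\<close>. The factors are kept because the sign
  characters are defined in terms of them.\<close>

datatype qsym = QSym (lfactor: quat) (rfactor: quat) (direct: bool)

fun qact :: "qsym \<Rightarrow> quat \<Rightarrow> quat" where
  "qact (QSym a b e) x = (if e then a \<odot> x \<odot> b else a \<odot> qcnj x \<odot> b)"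

fun qcomp :: "qsym \<Rightarrow> qsym \<Rightarrow> qsym" where
  "qcomp (QSym a b e) (QSym a' b' e') =
     (if e then QSym (a \<odot> a') (b' \<odot> b) e' else QSym (a \<odot> qcnj b') (qcnj a' \<odot> b) (\<not> e'))"

fun qinv :: "qsym \<Rightarrow> qsym" where
  "qinv (QSym a b e) = (if e then QSym (qcnj a) (qcnj b) e else QSym b a e)"

lemma qact_qcomp: "qact (qcomp v w) x = qact v (qact w x)"
  by (cases v; cases w) (simp add: qmul_assoc qcnj_qmul)

text \<open>From \<open>x \<alpha>\<^sup>* + \<alpha> x\<^sup>* = 2 \<langle>x, \<alpha>\<rangle>\<close> by multiplication with \<open>\<alpha>\<close>. So a group of unit quaternions that
  contains \<open>\<alpha>\<close> provides the reflection in \<open>\<alpha>\<close>.\<close>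

lemma quat_reflection:
  assumes "norm \<alpha> = 1"
  shows "x - (2 * (x \<bullet> \<alpha>)) *\<^sub>R \<alpha> = - (\<alpha> \<odot> qcnj x \<odot> \<alpha>)"
proof -
  have "x \<odot> qcnj \<alpha> + \<alpha> \<odot> qcnj x = (2 * (x \<bullet> \<alpha>)) *\<^sub>R qone"
    by (simp add: qmul_def qcnj_def inner_quat complex_eq_iff algebra_simps)
  then have "(x \<odot> qcnj \<alpha> + \<alpha> \<odot> qcnj x) \<odot> \<alpha> = (2 * (x \<bullet> \<alpha>)) *\<^sub>R \<alpha>" by (simp only: qmul_scaleR qmul_one)
  then have "x + \<alpha> \<odot> qcnj x \<odot> \<alpha> = (2 * (x \<bullet> \<alpha>)) *\<^sub>R \<alpha>"
    by (simp add: qmul_add qmul_qcnj_cancel(4)[OF assms])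
  then show ?thesis by (simp add: algebra_simps)
qed

text \<open>Four wall coordinates of a point of the chamber with two signs attached, each to one coordinate of
  a pair. Attaching the sign to the other coordinate of the pair would make no difference after
  squaring.\<close>

definition signed_coords :: "real \<Rightarrow> real \<Rightarrow> (4 \<Rightarrow> real) \<Rightarrow> quat" where
  "signed_coords s t l = (Complex (s * l 1) (l 2), Complex (t * l 3) (l 4))"

lemma signed_coords_scaleR: "signed_coords s t (\<lambda>i. r * l i) = r *\<^sub>R signed_coords s t l"
  by (simp add: signed_coords_def complex_eq_iff algebra_simps)

text \<open>The group \<open>\<Gamma>\<close> is its own root system, and \<open>\<kappa>\<close> is a sign character of it that distinguishes two
  classes of roots. The subgroup of interest consists of the maps \<open>x \<mapsto> a x b\<close> with \<open>\<kappa> a = \<kappa> b = 1\<close>.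
  Assumption \<open>rigid\<close> excludes symmetries of the Dynkin diagram that respect \<open>\<kappa>\<close>, so that
  representatives in the chamber are unique. The map \<open>\<psi>\<close> folds the signed wall coordinates onto the
  quaternions: it does not see the change of signs by a simple reflection on its own wall
  (\<open>psi_flip\<close>), and it forgets nothing else (\<open>psi_separates\<close>).\<close>

locale quat_chamber =
  fixes \<Gamma> :: "quat set" and \<kappa> :: "quat \<Rightarrow> real" and \<alpha> \<omega> :: "4 \<Rightarrow> quat" and \<psi> :: "quat \<Rightarrow> quat"
  assumes grp: "unit_quat_group \<Gamma>"
    and chi_mult: "a \<in> \<Gamma> \<Longrightarrow> b \<in> \<Gamma> \<Longrightarrow> \<kappa> (a \<odot> b) = \<kappa> a * \<kappa> b"
    and chi_sign: "a \<in> \<Gamma> \<Longrightarrow> \<kappa> a = 1 \<or> \<kappa> a = - 1"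
    and chi_minus_one: "\<kappa> (- qone) = 1"
    and simple_mem: "\<alpha> i \<in> \<Gamma>"
    and simple_dual: "i \<noteq> j \<Longrightarrow> \<alpha> i \<bullet> \<omega> j = 0" and simple_dual_pos: "\<alpha> i \<bullet> \<omega> i > 0"
    and simple_nondegenerate: "(\<And>i. x \<bullet> \<alpha> i = 0) \<Longrightarrow> x = 0"
    and mem_sign: "\<beta> \<in> \<Gamma> \<Longrightarrow> (\<forall>i. \<beta> \<bullet> \<omega> i \<ge> 0) \<or> (\<forall>i. \<beta> \<bullet> \<omega> i \<le> 0)"
    and rigid: "\<lbrakk>\<And>i j. \<alpha> (\<pi> i) \<bullet> \<alpha> (\<pi> j) = \<alpha> i \<bullet> \<alpha> j; \<And>i. \<kappa> (\<alpha> (\<pi> i)) = \<kappa> (\<alpha> i)\<rbrakk> \<Longrightarrow> \<pi> k = k"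
    and psi_onto: "norm_onto_map \<psi>"
    and psi_scaleR: "r > 0 \<Longrightarrow> \<psi> (r *\<^sub>R x) = r *\<^sub>R \<psi> x"
    and psi_flip: "\<lbrakk>s = 1 \<or> s = - 1; t \<in> \<kappa> ` \<Gamma>; l i = 0\<rbrakk> \<Longrightarrow>
      \<psi> (signed_coords (- \<kappa> (\<alpha> i) * s) (\<kappa> (\<alpha> i) * t) l) = \<psi> (signed_coords s t l)"
    and psi_separates: "\<lbrakk>s = 1 \<or> s = - 1; s' = 1 \<or> s' = - 1; t \<in> \<kappa> ` \<Gamma>; t' \<in> \<kappa> ` \<Gamma>;
      \<And>i. l i \<ge> 0; \<And>i. l' i \<ge> 0; \<psi> (signed_coords s t l) = \<psi> (signed_coords s' t' l')\<rbrakk> \<Longrightarrow>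
      l = l' \<and> (s' = s \<and> t' = t \<or> (\<exists>i. l i = 0 \<and> s' = - \<kappa> (\<alpha> i) * s \<and> t' = \<kappa> (\<alpha> i) * t) \<or>
        (\<exists>i j. l i = 0 \<and> l j = 0 \<and> s' = \<kappa> (\<alpha> i) * \<kappa> (\<alpha> j) * s \<and> t' = \<kappa> (\<alpha> i) * \<kappa> (\<alpha> j) * t))"
    and psi_cover: "\<exists>s t l. (s = 1 \<or> s = - 1) \<and> t \<in> \<kappa> ` \<Gamma> \<and> (\<forall>i. l i \<ge> 0) \<and> \<psi> z = \<psi> (signed_coords s t l)"
begin

lemmas grpD = unit_quat_groupD[OF grp]

lemma chi_one: "\<kappa> qone = 1"
  using chi_mult[OF grpD(2) grpD(2)] chi_sign[OF grpD(2)] by auto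

lemma chi_minus: "a \<in> \<Gamma> \<Longrightarrow> \<kappa> (- a) = \<kappa> a"
  using chi_mult[OF grpD(4)[OF grpD(2)], of a] by (simp only: qmul_minus qmul_one chi_minus_one mult_1)

lemma chi_square: "a \<in> \<Gamma> \<Longrightarrow> \<kappa> a * \<kappa> a = 1"
  using chi_sign[of a] by auto

lemma chi_qcnj: "a \<in> \<Gamma> \<Longrightarrow> \<kappa> (qcnj a) = \<kappa> a"
proof -
  assume a: "a \<in> \<Gamma>"
  have "\<kappa> a * \<kappa> (qcnj a) = 1"
    using chi_mult[OF a grpD(5)[OF a]] qmul_qcnj(1)[OF grpD(3)[OF a]] chi_one by simp
  then show ?thesis using chi_sign[OF a] by auto
qed

text \<open>The condition on \<open>\<kappa>\<close> means that the two classes of roots are preserved; it defines a group that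
  contains all reflections in elements of \<open>\<Gamma>\<close>.\<close>

definition W :: "qsym set" where
  "W = {w. lfactor w \<in> \<Gamma> \<and> rfactor w \<in> \<Gamma> \<and> \<kappa> (lfactor w) = \<kappa> (rfactor w)}"

text \<open>The signs \<open>sgn1\<close> and \<open>sgn2\<close> are the characters of \<open>W\<close> that count reflections in roots with
  \<open>\<kappa> = 1\<close> and with \<open>\<kappa> = -1\<close>, see \<open>mulr_W\<close>. Their product is the determinant, and their common kernel
  is the subgroup of interest.\<close>

definition sgn1 :: "qsym \<Rightarrow> real" where
  "sgn1 w = (if direct w then 1 else - 1) * \<kappa> (lfactor w)"

definition sgn2 :: "qsym \<Rightarrow> real" where
  "sgn2 w = \<kappa> (lfactor w)"

fun mulr :: "qsym \<Rightarrow> 4 \<Rightarrow> qsym" where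
  "mulr (QSym a b e) i = (if e then QSym (- (a \<odot> \<alpha> i)) (\<alpha> i \<odot> b) False
     else QSym (- (a \<odot> qcnj (\<alpha> i))) (qcnj (\<alpha> i) \<odot> b) True)"

lemma W_QSym: "QSym a b e \<in> W \<longleftrightarrow> a \<in> \<Gamma> \<and> b \<in> \<Gamma> \<and> \<kappa> a = \<kappa> b"
  by (simp add: W_def)

lemma sgn_QSym: "sgn1 (QSym a b e) = (if e then 1 else - 1) * \<kappa> a" "sgn2 (QSym a b e) = \<kappa> a"
  by (simp_all add: sgn1_def sgn2_def)

lemma mulr_W:
  assumes "w \<in> W"
  shows "mulr w i \<in> W" "sgn1 (mulr w i) = - \<kappa> (\<alpha> i) * sgn1 w" "sgn2 (mulr w i) = \<kappa> (\<alpha> i) * sgn2 w"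
proof -
  obtain a b e where w: "w = QSym a b e" by (cases w)
  then have ab: "a \<in> \<Gamma>" "b \<in> \<Gamma>" "\<kappa> a = \<kappa> b" using assms by (simp_all add: W_QSym)
  have cm: "qcnj (\<alpha> i) \<in> \<Gamma>" using grpD(5)[OF simple_mem] .
  note m = grpD(6)[OF ab(1) simple_mem[of i]] grpD(6)[OF ab(1) cm] grpD(6)[OF simple_mem[of i] ab(2)] grpD(6)[OF cm ab(2)]
  note s = chi_mult[OF ab(1) simple_mem[of i]] chi_mult[OF ab(1) cm] chi_mult[OF simple_mem[of i] ab(2)]
    chi_mult[OF cm ab(2)] chi_minus[OF m(1)] chi_minus[OF m(2)] chi_qcnj[OF simple_mem[of i]]
  show "mulr w i \<in> W" unfolding w using m grpD(4)[OF m(1)] grpD(4)[OF m(2)] ab(3) by (simp add: W_QSym s)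
  show "sgn1 (mulr w i) = - \<kappa> (\<alpha> i) * sgn1 w" "sgn2 (mulr w i) = \<kappa> (\<alpha> i) * sgn2 w"
    unfolding w by (simp_all add: sgn_QSym s)
qed

lemma qact_mulr: "qact (mulr w i) x = qact w (x - (2 * (x \<bullet> \<alpha> i)) *\<^sub>R \<alpha> i)"
  unfolding quat_reflection[OF grpD(3)[OF simple_mem]]
  by (cases w) (simp add: qmul_assoc qcnj_qmul)

lemma qcomp_W:
  assumes "v \<in> W" "w \<in> W"
  shows "qcomp v w \<in> W" "sgn1 (qcomp v w) = sgn1 v * sgn1 w" "sgn2 (qcomp v w) = sgn2 v * sgn2 w"
proof -
  obtain a b e where v: "v = QSym a b e" by (cases v)
  obtain a' b' e' where w: "w = QSym a' b' e'" by (cases w)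
  have m: "a \<in> \<Gamma>" "b \<in> \<Gamma>" "\<kappa> a = \<kappa> b" "a' \<in> \<Gamma>" "b' \<in> \<Gamma>" "\<kappa> a' = \<kappa> b'"
    using assms by (simp_all add: v w W_QSym)
  have c: "qcnj a' \<in> \<Gamma>" "qcnj b' \<in> \<Gamma>" using grpD(5) m by blast+
  note mm = grpD(6)[OF m(1,4)] grpD(6)[OF m(5,2)] grpD(6)[OF m(1) c(2)] grpD(6)[OF c(1) m(2)]
  note s = chi_mult[OF m(1,4)] chi_mult[OF m(5,2)] chi_mult[OF m(1) c(2)] chi_mult[OF c(1) m(2)]
    chi_qcnj[OF m(4)] chi_qcnj[OF m(5)] m(3,6)
  show "qcomp v w \<in> W" "sgn1 (qcomp v w) = sgn1 v * sgn1 w" "sgn2 (qcomp v w) = sgn2 v * sgn2 w"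
    unfolding v w using mm by (simp_all add: W_QSym sgn_QSym s)
qed

lemma qinv_W:
  assumes "v \<in> W"
  shows "qinv v \<in> W" "sgn1 (qinv v) = sgn1 v" "sgn2 (qinv v) = sgn2 v"
    "qact (qinv v) (qact v x) = x" "qact v (qact (qinv v) x) = x"
proof -
  obtain a b e where v: "v = QSym a b e" by (cases v)
  have m: "a \<in> \<Gamma>" "b \<in> \<Gamma>" "\<kappa> a = \<kappa> b" using assms by (simp_all add: v W_QSym)
  note n = grpD(3)[OF m(1)] grpD(3)[OF m(2)]
  show "qinv v \<in> W" "sgn1 (qinv v) = sgn1 v" "sgn2 (qinv v) = sgn2 v"
    unfolding v using m grpD(5) by (simp_all add: W_QSym sgn_QSym chi_qcnj)
  show "qact (qinv v) (qact v x) = x" "qact v (qact (qinv v) x) = x"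
    unfolding v using n by (simp_all add: qcnj_qmul qmul_assoc qmul_qcnj qmul_qcnj_cancel)
qed

lemma sgn_values:
  assumes "w \<in> W"
  shows "sgn1 w = 1 \<or> sgn1 w = - 1" "sgn2 w \<in> \<kappa> ` \<Gamma>" "sgn1 w * sgn1 w = 1" "sgn2 w * sgn2 w = 1"
  using assms chi_sign[of "lfactor w"] by (auto simp: W_def sgn1_def sgn2_def)

lemma chi_image_mult: "s \<in> \<kappa> ` \<Gamma> \<Longrightarrow> t \<in> \<kappa> ` \<Gamma> \<Longrightarrow> s * t \<in> \<kappa> ` \<Gamma>"
  using chi_mult grpD(6) by (metis (no_types, lifting) imageE imageI)

sublocale reflection_chamber W qact \<Gamma> \<alpha> \<omega> mulr
proof
  have "W \<subseteq> (\<lambda>(a, b, e). QSym a b e) ` (\<Gamma> \<times> \<Gamma> \<times> UNIV)"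
  proof
    fix w assume "w \<in> W"
    then show "w \<in> (\<lambda>(a, b, e). QSym a b e) ` (\<Gamma> \<times> \<Gamma> \<times> UNIV)"
      by (intro image_eqI[of _ _ "(lfactor w, rfactor w, direct w)"]) (simp_all add: W_def)
  qed
  then show "finite W" by (rule finite_subset) (use grpD(1) in simp)
  show "W \<noteq> {}" using W_QSym[of qone qone True] grpD(2) by blast
  show "finite \<Gamma>" by (rule grpD(1))
  show "orthogonal_transformation (qact w)" if "w \<in> W" for w
  proof -
    obtain a b e where w: "w = QSym a b e" by (cases w)
    then have n: "norm a = 1" "norm b = 1" using that grpD(3) by (simp_all add: W_QSym)
    have "linear (qact w)"
      by (rule linearI) (simp_all add: w qmul_add qcnj_add)
    then show ?thesis
      unfolding orthogonal_transformation_def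
      by (simp add: w inner_qmul_left inner_qmul_right n)
  qed
  show "qact w \<beta> \<in> \<Gamma>" if "w \<in> W" "\<beta> \<in> \<Gamma>" for w \<beta>
    using that grpD(5,6) by (cases w) (simp add: W_QSym)
  show "norm \<beta> = 1" if "\<beta> \<in> \<Gamma>" for \<beta> using grpD(3)[OF that] .
qed (rule simple_mem simple_dual simple_dual_pos simple_nondegenerate mem_sign mulr_W(1) qact_mulr; assumption?)+

text \<open>The signs depend only on the map and not on its name; for the identity this follows from the fact
  that \<open>\<plusminus>1\<close> are the only lifts of the trivial rotation, and that \<open>x \<mapsto> a x\<^sup>* a\<^sup>*\<close> is not the identity
  because \<open>-1\<close> is not a rotation of space.\<close>

lemma direct_if_qact_id:
  assumes w: "w \<in> W" and id: "\<And>x. qact w x = x"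
  shows "sgn1 w = 1" "sgn2 w = 1"
proof -
  obtain a b e where w': "w = QSym a b e" by (cases w)
  have ab: "a \<in> \<Gamma>" "b \<in> \<Gamma>" using w by (simp_all add: w' W_QSym)
  have n: "norm a = 1" using grpD(3)[OF ab(1)] .
  have "a \<odot> b = qone" using id[of qone] by (cases e) (simp_all add: w')
  then have "qcnj a \<odot> (a \<odot> b) = qcnj a" by simp
  then have b: "b = qcnj a" using qmul_qcnj_cancel(1)[OF n] by simp
  have "e \<and> (a = qone \<or> a = - qone)"
  proof (cases e)
    case True
    then have "imq (rot a *v u) = imq u" for u using id[of "imq u"] by (simp add: w' b imq_rot)
    then have "rot a *v u = mat 1 *v u" for u by (simp add: imq_inject)
    then have "rot a = mat 1" unfolding matrix_eq by blast
    then show ?thesis using rot_eq_one[OF n] True by simp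
  next
    case False
    have "rot a *v u = (- mat 1) *v u" for u
    proof -
      have "qcnj (imq u) = - imq u" by (simp add: imq_def qcnj_def complex_eq_iff)
      then have "- imq (rot a *v u) = imq u" using id[of "imq u"] False by (simp add: w' b imq_rot)
      then have "imq (rot a *v u) = imq (- u)" by (simp add: imq_minus minus_equation_iff[of _ "imq u"] eq_commute)
      moreover have "(- mat 1) *v u = - u"
        by (simp add: vec_eq_iff forall_3 matrix_vector_mult_def sum_3 mat_def)
      ultimately show ?thesis by (simp add: imq_inject)
    qed
    then have "rot a = - mat 1" unfolding matrix_eq by blast
    moreover have "det (rot a) = 1" using rot_in_SO3[OF n] by (simp add: SO3_def rotation_matrix_def)
    moreover have "det (- mat 1 :: real^3^3) = - 1" by (simp add: det_3 mat_def)
    ultimately show ?thesis by simp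
  qed
  then show "sgn1 w = 1" "sgn2 w = 1"
    unfolding w' sgn_QSym using chi_one chi_minus_one by auto
qed

definition coords :: "quat \<Rightarrow> 4 \<Rightarrow> real" where
  "coords c = (\<lambda>i. c \<bullet> \<alpha> i)"

text \<open>Two points of the chamber in one orbit coincide, and the signs of an isometry that fixes a point
  of the chamber are invisible after folding at that point. Both are proved along \<open>chamber_induct\<close>: at
  the end of the induction stands the identity, by \<open>rigid\<close>, and each step is a reflection in a wall
  through the point, by \<open>psi_flip\<close>.\<close>

lemma chamber_stabiliser:
  assumes w: "w \<in> W" and c: "c \<in> chamber" and wc: "qact w c \<in> chamber"
  shows "qact w c = c \<and> (\<forall>s t. (s = 1 \<or> s = - 1) \<longrightarrow> t \<in> \<kappa> ` \<Gamma> \<longrightarrow>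
    \<psi> (signed_coords (s * sgn1 w) (t * sgn2 w) (coords c)) = \<psi> (signed_coords s t (coords c)))"
proof -
  define P where "P v \<longleftrightarrow> qact w c = c \<and> (\<forall>s t. (s = 1 \<or> s = - 1) \<longrightarrow> t \<in> \<kappa> ` \<Gamma> \<longrightarrow>
    \<psi> (signed_coords (s * sgn1 v) (t * sgn2 v) (coords c)) = \<psi> (signed_coords s t (coords c)))" for v
  have "P w"
  proof (rule chamber_induct[OF w c wc])
    fix v assume v: "v \<in> W" and vc: "qact v c = qact w c" and perm: "\<And>j. \<exists>k. qact v (\<alpha> j) = \<alpha> k"
    obtain \<pi> where pi: "\<And>j. qact v (\<alpha> j) = \<alpha> (\<pi> j)" using perm by metis
    have "\<pi> k = k" for k
    proof (rule rigid)
      show "\<alpha> (\<pi> i) \<bullet> \<alpha> (\<pi> j) = \<alpha> i \<bullet> \<alpha> j" for i j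
        unfolding pi[symmetric] by (rule inner_act[OF v])
      obtain a b e where v': "v = QSym a b e" by (cases v)
      have ab: "a \<in> \<Gamma>" "b \<in> \<Gamma>" "\<kappa> a = \<kappa> b" using v by (simp_all add: v' W_QSym)
      show "\<kappa> (\<alpha> (\<pi> i)) = \<kappa> (\<alpha> i)" for i
      proof -
        have 1: "\<kappa> (a \<odot> x \<odot> b) = \<kappa> x" if "x \<in> \<Gamma>" for x
          using chi_mult[OF grpD(6)[OF ab(1) that] ab(2)] chi_mult[OF ab(1) that] chi_square[OF ab(1)] ab(3)
          by (simp add: mult.assoc mult.left_commute)
        show ?thesis
          unfolding pi[symmetric] v' using 1[OF simple_mem[of i]] 1[OF grpD(5)[OF simple_mem[of i]]]
            chi_qcnj[OF simple_mem[of i]] by simp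
      qed
    qed
    then have id: "qact v x = x" for x
      using act_eq_id_if_fixes_simple[OF v, of x] by (simp add: pi)
    have "sgn1 v = 1" "sgn2 v = 1" using direct_if_qact_id[OF v] id by blast+
    then show "P v" unfolding P_def using vc id by simp
  next
    fix v i assume v: "v \<in> W" and ci: "c \<bullet> \<alpha> i = 0" and Pm: "P (mulr v i)"
    show "P v"
      unfolding P_def
    proof (intro conjI allI impI)
      show "qact w c = c" using Pm by (simp add: P_def)
      fix s t :: real assume st: "s = 1 \<or> s = - 1" "t \<in> \<kappa> ` \<Gamma>"
      have "\<psi> (signed_coords (- \<kappa> (\<alpha> i) * (s * sgn1 v)) (\<kappa> (\<alpha> i) * (t * sgn2 v)) (coords c)) =
          \<psi> (signed_coords (s * sgn1 v) (t * sgn2 v) (coords c))"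
        by (rule psi_flip) (use st sgn_values[OF v] chi_image_mult ci in \<open>auto simp: coords_def\<close>)
      moreover have "\<psi> (signed_coords (s * sgn1 (mulr v i)) (t * sgn2 (mulr v i)) (coords c)) =
          \<psi> (signed_coords s t (coords c))" using Pm st unfolding P_def by blast
      ultimately show "\<psi> (signed_coords (s * sgn1 v) (t * sgn2 v) (coords c)) = \<psi> (signed_coords s t (coords c))"
        by (simp add: mulr_W[OF v] mult.left_commute)
    qed
  qed
  then show ?thesis by (simp add: P_def)
qed

text \<open>The value of the orbit map at the image of \<open>c\<close> under \<open>w\<close>, up to normalisation.\<close>

definition chamber_value :: "qsym \<Rightarrow> quat \<Rightarrow> quat" where
  "chamber_value w c = \<psi> (signed_coords (sgn1 w) (sgn2 w) (coords c))"

lemma representatives_unique: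
  assumes "w \<in> W" "w' \<in> W" "c \<in> chamber" "c' \<in> chamber" "qact w c = qact w' c'"
  shows "c = c'" "chamber_value w c = chamber_value w' c'"
proof -
  define v where "v = qcomp (qinv w) w'"
  have v: "v \<in> W" and s: "sgn1 v = sgn1 w * sgn1 w'" "sgn2 v = sgn2 w * sgn2 w'"
    using qcomp_W[OF qinv_W(1)[OF assms(1)] assms(2)] qinv_W(2,3)[OF assms(1)] by (simp_all add: v_def)
  have vc: "qact v c' = c" by (simp add: v_def qact_qcomp assms(5)[symmetric] qinv_W(4)[OF assms(1)])
  note st = chamber_stabiliser[OF v assms(4), unfolded vc, OF assms(3)]
  then show "c = c'" by blast
  have "\<psi> (signed_coords (sgn1 w * sgn1 v) (sgn2 w * sgn2 v) (coords c')) =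
      \<psi> (signed_coords (sgn1 w) (sgn2 w) (coords c'))"
    using st sgn_values[OF assms(1)] by blast
  moreover have "sgn1 w * sgn1 v = sgn1 w'" "sgn2 w * sgn2 v = sgn2 w'"
    using sgn_values(3,4)[OF assms(1)] by (simp_all add: s mult.assoc[symmetric])
  ultimately show "chamber_value w c = chamber_value w' c'"
    using \<open>c = c'\<close> by (simp add: chamber_value_def)
qed

lemma chamber_value_scaleR: "r > 0 \<Longrightarrow> chamber_value w (r *\<^sub>R c) = r *\<^sub>R chamber_value w c"
  using signed_coords_scaleR[of _ _ r "coords c"] psi_scaleR
  by (simp add: chamber_value_def coords_def)

lemma chamber_value_nonzero:
  assumes w: "w \<in> W" and "c \<noteq> 0"
  shows "chamber_value w c \<noteq> 0"
proof
  assume "chamber_value w c = 0"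
  then have "norm (signed_coords (sgn1 w) (sgn2 w) (coords c)) = 0"
    using psi_onto unfolding chamber_value_def norm_onto_map_def by (metis norm_zero)
  then have "signed_coords (sgn1 w) (sgn2 w) (coords c) = 0" by simp
  then have "coords c 1 = 0" "coords c 2 = 0" "coords c 3 = 0" "coords c 4 = 0"
    using sgn_values(3,4)[OF w] by (auto simp: signed_coords_def prod_eq_iff complex_eq_iff)
  then have "\<forall>i. c \<bullet> \<alpha> i = 0" unfolding forall_4 by (simp add: coords_def)
  then show False using simple_nondegenerate[of c] assms(2) by blast
qed

lemma continuous_chamber_value: "continuous_on UNIV (chamber_value w)"
proof -
  have "continuous_on UNIV (\<lambda>c. signed_coords (sgn1 w) (sgn2 w) (coords c))"
    unfolding signed_coords_def coords_def Complex_eq by (intro continuous_intros)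
  moreover have "continuous_on UNIV \<psi>" using psi_onto by (simp add: norm_onto_map_def)
  ultimately show ?thesis
    unfolding chamber_value_def[abs_def] using continuous_on_compose2 by blast
qed

text \<open>Gluing the folded and signed wall coordinates over all chambers yields the orbit map. Equal values
  force equal representatives, by \<open>psi_separates\<close>, and signs that differ at most by reflections in walls
  through the representative. Composing with these reflections gives an element of the common kernel
  of both characters that maps one point to the other. The last clause records the values of the map
  for use with isometries outside \<open>W\<close>.\<close>

theorem chamber_orbit_map:
  "\<exists>f. continuous_on (sphere 0 1) f \<and> f ` sphere 0 1 = sphere 0 1 \<and>
     (\<forall>x\<in>sphere 0 1. \<forall>y\<in>sphere 0 1.
        f x = f y \<longleftrightarrow> (\<exists>a\<in>{a\<in>\<Gamma>. \<kappa> a = 1}. \<exists>b\<in>{a\<in>\<Gamma>. \<kappa> a = 1}. y = a \<odot> x \<odot> b)) \<and>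
     (\<forall>w\<in>W. \<forall>c\<in>chamber. f (qact w c) = sgn (chamber_value w c))"
proof -
  obtain F where Fc: "continuous_on UNIV F"
    and F: "\<And>w c. w \<in> W \<Longrightarrow> c \<in> chamber \<Longrightarrow> F (qact w c) = chamber_value w c"
    using chamber_gluing[of chamber_value] continuous_chamber_value representatives_unique(2) by blast
  have F0: "F x \<noteq> 0" if x: "norm x = 1" for x
  proof -
    obtain w c where w: "w \<in> W" "c \<in> chamber" "x = qact w c" using chamber_represents by blast
    then have "norm c = 1" using x norm_act[OF w(1)] by simp
    then have "c \<noteq> 0" by auto
    then show ?thesis using chamber_value_nonzero[OF w(1)] F[OF w(1,2)] w(3) by metis
  qed
  define f where "f x = sgn (F x)" for x
  have "continuous_on (sphere 0 1) F" using Fc continuous_on_subset by blast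
  then have fc: "continuous_on (sphere 0 1) f"
    unfolding f_def sgn_div_norm using F0 by (intro continuous_intros) auto
  have fn: "norm (f x) = 1" if "norm x = 1" for x using F0[OF that] by (simp add: f_def norm_sgn)
  have onto: "\<exists>x. norm x = 1 \<and> f x = y" if y: "norm y = 1" for y
  proof -
    obtain z where z: "\<psi> z = y" using psi_onto unfolding norm_onto_map_def surj_def by metis
    obtain s t l where stl: "s = 1 \<or> s = - 1" "t \<in> \<kappa> ` \<Gamma>" "\<forall>i. l i \<ge> 0" "y = \<psi> (signed_coords s t l)"
      using psi_cover[of z] z by blast
    obtain a where a: "a \<in> \<Gamma>" "t = \<kappa> a" using stl(2) by blast
    \<comment> \<open>The determinant is chosen as \<open>s t\<close>, the product of both signs.\<close>
    define w where "w = QSym a a (s * t = 1)"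
    have w: "w \<in> W" using a by (simp add: w_def W_QSym)
    have sw: "sgn1 w = s" "sgn2 w = t"
      using stl(1) chi_sign[OF a(1)] by (auto simp: w_def sgn_QSym a(2))
    define c where "c = (\<Sum>i\<in>UNIV. (l i / (\<alpha> i \<bullet> \<omega> i)) *\<^sub>R \<omega> i)"
    have cl: "c \<bullet> \<alpha> j = l j" for j
    proof -
      have "c \<bullet> \<alpha> j = (\<Sum>i\<in>UNIV. if i = j then l j else 0)"
        unfolding c_def inner_sum_left using simple_dual simple_dual_pos
        by (intro sum.cong) (auto simp: inner_commute[of "\<omega> _"] less_le)
      then show ?thesis by simp
    qed
    have cc: "c \<in> chamber" using stl(3) by (simp add: chamber_def cl)
    have cv: "chamber_value w c = y" by (simp add: chamber_value_def sw coords_def cl stl(4))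
    have "c \<noteq> 0"
    proof
      assume "c = 0"
      then have "l i = 0" for i using cl[of i] by simp
      then have "signed_coords s t l = 0" by (simp add: signed_coords_def zero_prod_def zero_complex.code)
      then have "norm y = 0" using psi_onto unfolding stl(4) norm_onto_map_def by (metis norm_zero)
      then show False using y by simp
    qed
    define r where "r = 1 / norm c"
    have r: "r > 0" using \<open>c \<noteq> 0\<close> by (simp add: r_def)
    have rc: "r *\<^sub>R c \<in> chamber" using cc r by (simp add: chamber_def)
    have "norm (qact w (r *\<^sub>R c)) = 1" using norm_act[OF w] \<open>c \<noteq> 0\<close> by (simp add: r_def)
    moreover have "f (qact w (r *\<^sub>R c)) = y"
      using r y by (simp add: f_def F[OF w rc] chamber_value_scaleR cv sgn_scaleR sgn_div_norm)
    ultimately show ?thesis by blast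
  qed
  have img: "f ` sphere 0 1 = sphere 0 1"
  proof
    show "f ` sphere 0 1 \<subseteq> sphere 0 1" using fn by auto
    show "sphere 0 1 \<subseteq> f ` sphere 0 1"
    proof
      fix y :: quat assume "y \<in> sphere 0 1"
      then obtain x where "norm x = 1" "f x = y" using onto[of y] by auto
      then show "y \<in> f ` sphere 0 1" by (intro image_eqI[of _ _ x]) simp_all
    qed
  qed
  have K: "(\<exists>a\<in>{a\<in>\<Gamma>. \<kappa> a = 1}. \<exists>b\<in>{a\<in>\<Gamma>. \<kappa> a = 1}. y = a \<odot> x \<odot> b) \<longleftrightarrow>
      (\<exists>v\<in>W. sgn1 v = 1 \<and> sgn2 v = 1 \<and> y = qact v x)" for x y
  proof
    assume "\<exists>a\<in>{a\<in>\<Gamma>. \<kappa> a = 1}. \<exists>b\<in>{a\<in>\<Gamma>. \<kappa> a = 1}. y = a \<odot> x \<odot> b"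
    then obtain a b where "a \<in> \<Gamma>" "\<kappa> a = 1" "b \<in> \<Gamma>" "\<kappa> b = 1" "y = a \<odot> x \<odot> b" by blast
    then show "\<exists>v\<in>W. sgn1 v = 1 \<and> sgn2 v = 1 \<and> y = qact v x"
      by (intro bexI[of _ "QSym a b True"]) (simp_all add: W_QSym sgn_QSym)
  next
    assume "\<exists>v\<in>W. sgn1 v = 1 \<and> sgn2 v = 1 \<and> y = qact v x"
    then obtain v where v: "v \<in> W" "sgn1 v = 1" "sgn2 v = 1" "y = qact v x" by blast
    obtain a b e where v': "v = QSym a b e" by (cases v)
    have "\<kappa> a = 1" "e" "\<kappa> b = 1" "a \<in> \<Gamma>" "b \<in> \<Gamma>"
      using v(1,2,3) unfolding v' W_QSym sgn_QSym by (auto split: if_splits)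
    then show "\<exists>a\<in>{a\<in>\<Gamma>. \<kappa> a = 1}. \<exists>b\<in>{a\<in>\<Gamma>. \<kappa> a = 1}. y = a \<odot> x \<odot> b"
      using v(4) unfolding v' qact.simps if_P[OF \<open>e\<close>] by blast
  qed
  have fib: "f x = f y \<longleftrightarrow> (\<exists>v\<in>W. sgn1 v = 1 \<and> sgn2 v = 1 \<and> y = qact v x)"
    if x: "norm x = 1" and y: "norm y = 1" for x y
  proof
    assume "\<exists>v\<in>W. sgn1 v = 1 \<and> sgn2 v = 1 \<and> y = qact v x"
    then obtain v where v: "v \<in> W" "sgn1 v = 1" "sgn2 v = 1" "y = qact v x" by blast
    obtain w c where w: "w \<in> W" "c \<in> chamber" "x = qact w c" using chamber_represents by blast
    have "y = qact (qcomp v w) c" by (simp add: v(4) w(3) qact_qcomp)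
    then have "F y = F x"
      using F[OF qcomp_W(1)[OF v(1) w(1)] w(2)] F[OF w(1,2)] qcomp_W(2,3)[OF v(1) w(1)] v(2,3)
      by (simp add: w(3) chamber_value_def)
    then show "f x = f y" by (simp add: f_def)
  next
    assume eq: "f x = f y"
    obtain w c where w: "w \<in> W" "c \<in> chamber" "x = qact w c" using chamber_represents by blast
    obtain w' c' where w': "w' \<in> W" "c' \<in> chamber" "y = qact w' c'" using chamber_represents by blast
    have nc: "norm c = 1" "norm c' = 1" using norm_act[OF w(1)] norm_act[OF w'(1)] x y w(3) w'(3) by simp_all
    define r where "r = norm (F x) / norm (F y)"
    have r: "r > 0" using F0[OF x] F0[OF y] by (simp add: r_def)
    have "norm (F x) *\<^sub>R f x = norm (F x) *\<^sub>R f y" using eq by simp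
    then have "F x = r *\<^sub>R F y"
      using F0[OF x] by (simp add: f_def sgn_div_norm r_def divide_inverse)
    then have "chamber_value w c = chamber_value w' (r *\<^sub>R c')"
      using F[OF w(1,2)] F[OF w'(1,2)] chamber_value_scaleR[OF r] by (simp add: w(3) w'(3))
    moreover have "r *\<^sub>R c' \<in> chamber" using w'(2) r by (simp add: chamber_def)
    ultimately have sep: "coords c = coords (r *\<^sub>R c') \<and>
      (sgn1 w' = sgn1 w \<and> sgn2 w' = sgn2 w \<or>
       (\<exists>i. coords c i = 0 \<and> sgn1 w' = - \<kappa> (\<alpha> i) * sgn1 w \<and> sgn2 w' = \<kappa> (\<alpha> i) * sgn2 w) \<or>
       (\<exists>i j. coords c i = 0 \<and> coords c j = 0 \<and> sgn1 w' = \<kappa> (\<alpha> i) * \<kappa> (\<alpha> j) * sgn1 w \<and>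
          sgn2 w' = \<kappa> (\<alpha> i) * \<kappa> (\<alpha> j) * sgn2 w))"
      using w(2) unfolding chamber_value_def
      by (intro psi_separates sgn_values w(1) w'(1)) (auto simp: coords_def chamber_def)
    have "(c - r *\<^sub>R c') \<bullet> \<alpha> i = 0" for i
      using fun_cong[OF conjunct1[OF sep], of i] by (simp add: coords_def inner_diff_left)
    then have "c - r *\<^sub>R c' = 0" using simple_nondegenerate by blast
    then have crc: "c = r *\<^sub>R c'" by simp
    then have "r = 1" using nc r by simp
    then have cc: "c' = c" using crc by simp
    have "\<exists>u\<in>W. qact u c = x \<and> sgn1 u = sgn1 w' \<and> sgn2 u = sgn2 w'"
    proof -
      from sep consider "sgn1 w' = sgn1 w" "sgn2 w' = sgn2 w"
        | i where "coords c i = 0" "sgn1 w' = - \<kappa> (\<alpha> i) * sgn1 w" "sgn2 w' = \<kappa> (\<alpha> i) * sgn2 w"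
        | i j where "coords c i = 0" "coords c j = 0" "sgn1 w' = \<kappa> (\<alpha> i) * \<kappa> (\<alpha> j) * sgn1 w"
          "sgn2 w' = \<kappa> (\<alpha> i) * \<kappa> (\<alpha> j) * sgn2 w" by blast
      then show ?thesis
      proof cases
        case 1
        then show ?thesis using w by (intro bexI[of _ w]) simp_all
      next
        case 2
        then show ?thesis
          using w mulr_W[OF w(1), of i] qact_mulr[of w i c] by (intro bexI[of _ "mulr w i"]) (simp_all add: coords_def)
      next
        case 3
        then show ?thesis
          using w mulr_W[OF w(1), of i] mulr_W[OF mulr_W(1)[OF w(1)], of i j] qact_mulr[of w i c]
            qact_mulr[of "mulr w i" j c]
          by (intro bexI[of _ "mulr (mulr w i) j"]) (simp_all add: coords_def)
      qed
    qed
    then obtain u where u: "u \<in> W" "qact u c = x" "sgn1 u = sgn1 w'" "sgn2 u = sgn2 w'" by blast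
    define v where "v = qcomp w' (qinv u)"
    have "v \<in> W" "sgn1 v = 1" "sgn2 v = 1"
      using qcomp_W[OF w'(1) qinv_W(1)[OF u(1)]] qinv_W(2,3)[OF u(1)] sgn_values(3,4)[OF w'(1)] u(3,4)
      by (simp_all add: v_def)
    moreover have "qact v x = y"
      using qinv_W(4)[OF u(1), of c] u(2) w'(3) cc by (simp add: v_def qact_qcomp)
    ultimately show "\<exists>v\<in>W. sgn1 v = 1 \<and> sgn2 v = 1 \<and> y = qact v x" by blast
  qed
  show ?thesis
  proof (rule exI[of _ f], intro conjI ballI)
    show "continuous_on (sphere 0 1) f" "f ` sphere 0 1 = sphere 0 1" by (fact fc, fact img)
    fix x y :: quat assume "x \<in> sphere 0 1" "y \<in> sphere 0 1"
    then show "f x = f y \<longleftrightarrow> (\<exists>a\<in>{a\<in>\<Gamma>. \<kappa> a = 1}. \<exists>b\<in>{a\<in>\<Gamma>. \<kappa> a = 1}. y = a \<odot> x \<odot> b)"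
      unfolding K using fib by simp
  next
    fix w c assume "w \<in> W" "c \<in> chamber"
    then show "f (qact w c) = sgn (chamber_value w c)" using F by (simp add: f_def)
  qed
qed

end

section \<open>Symmetry groups of finite vertex sets\<close>

text \<open>The vertices are the points of the solid at the largest distance from the centre, because such
  points are extreme points of the ball. A rotation preserves distances from the centre, hence it
  preserves the solid if and only if it permutes the vertices.\<close>

lemma rotational_symmetries_convex_hull:
  assumes fin: "finite V" and r: "\<And>v. v \<in> V \<Longrightarrow> norm v = r"
  shows "rotational_symmetries (convex hull V) = {A \<in> carrier SO3. (\<lambda>x. A *v x) ` V = V}"
proof -
  let ?P = "convex hull V"
  have "?P \<subseteq> cball 0 r" using r by (intro hull_minimal) auto
  then have ball: "norm x \<le> r" if "x \<in> ?P" for x using that by auto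
  have V: "V = {x \<in> ?P. norm x = r}"
  proof
    show "V \<subseteq> {x \<in> ?P. norm x = r}" using r hull_inc by auto
    show "{x \<in> ?P. norm x = r} \<subseteq> V"
    proof
      fix x assume "x \<in> {x \<in> ?P. norm x = r}"
      then have x: "x \<in> ?P" "norm x = r" by auto
      have "x extreme_point_of ?P"
        unfolding extreme_point_of_def
      proof (intro conjI ballI notI)
        fix a b assume ab: "a \<in> ?P" "b \<in> ?P" "x \<in> open_segment a b"
        then have "dist 0 x < dist 0 a \<or> dist 0 x < dist 0 b"
          using dist_decreases_open_segment by blast
        then show False using x(2) ball[OF ab(1)] ball[OF ab(2)] by simp
      qed (fact x)
      then show "x \<in> V" by (rule extreme_point_of_convex_hull)
    qed
  qed
  have lin: "linear (\<lambda>x. A *v x)" for A :: "real^3^3" by (rule matrix_vector_mul_linear)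
  show ?thesis
    unfolding rotational_symmetries_def
  proof (intro Collect_cong conj_cong refl)
    fix A :: "real^3^3" assume "A \<in> carrier SO3"
    then have "orthogonal_transformation ((*v) A)"
      by (simp add: SO3_def rotation_matrix_def orthogonal_transformation_matrix)
    then have n: "norm (A *v x) = norm x" for x by (simp add: orthogonal_transformation)
    show "((\<lambda>x. A *v x) ` ?P = ?P) = ((\<lambda>x. A *v x) ` V = V)"
    proof
      assume "(\<lambda>x. A *v x) ` ?P = ?P"
      then have "(\<lambda>x. A *v x) ` {x \<in> ?P. norm x = r} = {x \<in> ?P. norm x = r}"
        using n by (auto simp: set_eq_iff image_iff) metis+
      then show "(\<lambda>x. A *v x) ` V = V" using V by simp
    next
      assume "(\<lambda>x. A *v x) ` V = V"
      then show "(\<lambda>x. A *v x) ` ?P = ?P" using convex_hull_linear_image[OF lin, of A V] by simp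
    qed
  qed
qed

definition vertex_group :: "(real^3) set \<Rightarrow> quat set" where
  "vertex_group V = {q. norm q = 1 \<and> (\<lambda>x. rot q *v x) ` V = V}"

lemma rot_image_mult: "(\<lambda>x. rot (p \<odot> q) *v x) ` V = (\<lambda>x. rot p *v x) ` (\<lambda>x. rot q *v x) ` V"
  by (simp add: image_image rot_qmul matrix_vector_mul_assoc)

lemma rot_image_one: "(\<lambda>x. rot qone *v x) ` V = V"
  by (simp add: rot_one)

lemma rot_image_qcnj:
  assumes "norm q = 1"
  shows "(\<lambda>x. rot (qcnj q) *v x) ` (\<lambda>x. rot q *v x) ` V = V"
  unfolding rot_image_mult[symmetric] qmul_qcnj[OF assms] rot_image_one ..

lemma rot_image_uminus: "(\<lambda>x. rot q *v x) ` uminus ` V = uminus ` (\<lambda>x. rot q *v x) ` V"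
proof -
  have "rot q *v (- x) = - (rot q *v x)" for x
    using linear_neg[OF matrix_vector_mul_linear[of "rot q"]] by simp
  then show ?thesis by (simp add: image_image)
qed

lemma inj_rot: "norm q = 1 \<Longrightarrow> inj (\<lambda>x. rot q *v x)"
  by (rule injI) (metis rot_cancel(2))

lemma vertex_groupI:
  assumes "finite V" "norm q = 1" "\<And>v. v \<in> V \<Longrightarrow> rot q *v v \<in> V"
  shows "q \<in> vertex_group V"
proof -
  have "(\<lambda>x. rot q *v x) ` V = V"
    by (rule endo_inj_surj[OF assms(1)]) (use assms(3) inj_rot[OF assms(2)] in \<open>auto intro: inj_on_subset\<close>)
  then show ?thesis using assms(2) by (simp add: vertex_group_def)
qed

lemma vertex_groupD:
  assumes "q \<in> vertex_group V"
  shows "norm q = 1" "v \<in> V \<Longrightarrow> rot q *v v \<in> V"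
  using assms unfolding vertex_group_def by blast+

lemma vertex_group_closed:
  "qone \<in> vertex_group V"
  "p \<in> vertex_group V \<Longrightarrow> q \<in> vertex_group V \<Longrightarrow> p \<odot> q \<in> vertex_group V"
  "q \<in> vertex_group V \<Longrightarrow> qcnj q \<in> vertex_group V"
  "q \<in> vertex_group V \<Longrightarrow> - q \<in> vertex_group V"
proof -
  show "qone \<in> vertex_group V" by (simp add: vertex_group_def rot_image_one norm_Pair)
  show "p \<odot> q \<in> vertex_group V" if "p \<in> vertex_group V" "q \<in> vertex_group V"
    using that by (simp add: vertex_group_def rot_image_mult norm_qmul)
  show "- q \<in> vertex_group V" if "q \<in> vertex_group V" using that by (simp add: vertex_group_def)
  show "qcnj q \<in> vertex_group V" if "q \<in> vertex_group V"
    using that rot_image_qcnj[of q V] by (simp add: vertex_group_def)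
qed

lemma unit_quat_group_vertex_group: "finite (vertex_group V) \<Longrightarrow> unit_quat_group (vertex_group V)"
  using vertex_group_closed vertex_groupD(1) unfolding unit_quat_group_def by blast

lemma rot_vertex_group: "rot ` vertex_group V = {A \<in> carrier SO3. (\<lambda>x. A *v x) ` V = V}"
proof
  show "rot ` vertex_group V \<subseteq> {A \<in> carrier SO3. (\<lambda>x. A *v x) ` V = V}"
    using rot_in_SO3 unfolding vertex_group_def by blast
  show "{A \<in> carrier SO3. (\<lambda>x. A *v x) ` V = V} \<subseteq> rot ` vertex_group V"
  proof
    fix A assume A: "A \<in> {A \<in> carrier SO3. (\<lambda>x. A *v x) ` V = V}"
    then obtain q where "norm q = 1" "rot q = A" using rot_surj by blast
    then show "A \<in> rot ` vertex_group V" using A unfolding vertex_group_def by blast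
  qed
qed

definition quat4 :: "real \<Rightarrow> real \<Rightarrow> real \<Rightarrow> real \<Rightarrow> quat" where
  "quat4 a b c d = (Complex a b, Complex c d)"

lemma quat4_mult: "quat4 a b c d \<odot> quat4 e f g h =
   quat4 (a*e - b*f - c*g - d*h) (a*f + b*e + c*h - d*g) (a*g - b*h + c*e + d*f) (a*h + b*g - c*f + d*e)"
  by (simp add: quat4_def qmul_def complex_eq_iff)

lemma quat4_simps:
  "quat4 a b c d \<bullet> quat4 e f g h = a*e + b*f + c*g + d*h"
  "- quat4 a b c d = quat4 (- a) (- b) (- c) (- d)"
  "qcnj (quat4 a b c d) = quat4 a (- b) (- c) (- d)"
  "r *\<^sub>R quat4 a b c d = quat4 (r * a) (r * b) (r * c) (r * d)"
  "quat4 a b c d + quat4 e f g h = quat4 (a + e) (b + f) (c + g) (d + h)"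
  by (simp_all add: quat4_def inner_quat qcnj_def complex_eq_iff)

lemma quat4_eq_iff: "quat4 a b c d = quat4 e f g h \<longleftrightarrow> a = e \<and> b = f \<and> c = g \<and> d = h"
  by (auto simp: quat4_def)

lemma norm_quat4: "norm (quat4 a b c d) = 1 \<longleftrightarrow> a\<^sup>2 + b\<^sup>2 + c\<^sup>2 + d\<^sup>2 = 1"
proof -
  have "(norm (quat4 a b c d))\<^sup>2 = a\<^sup>2 + b\<^sup>2 + c\<^sup>2 + d\<^sup>2" by (simp add: norm_quat_squared quat4_def)
  then show ?thesis using power2_eq_1_iff[of "norm (quat4 a b c d)"] norm_ge_zero[of "quat4 a b c d"] by auto
qed

lemma quat4_surj: obtains a b c d where "q = quat4 a b c d"
  by (metis quat4_def complex_surj prod.collapse)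

lemma qone_quat4: "qone = quat4 1 0 0 0"
  by (simp add: quat4_def complex_eq_iff)

lemma rot_quat4: "rot (quat4 a b c d) *v vector [x, y, z] = vector
   [(a^2 + b^2 - c^2 - d^2) * x + 2 * (b*c - a*d) * y + 2 * (b*d + a*c) * z,
    2 * (b*c + a*d) * x + (a^2 - b^2 + c^2 - d^2) * y + 2 * (c*d - a*b) * z,
    2 * (b*d - a*c) * x + 2 * (c*d + a*b) * y + (a^2 - b^2 - c^2 + d^2) * z]"
  by (simp add: rot_def quat4_def Let_def matrix_vector_mult_def sum_3 vector_3 vec_eq_iff forall_3)

lemma vector_3_eq_iff: "(vector [a, b, c] :: real^3) = vector [a', b', c'] \<longleftrightarrow> a = a' \<and> b = b' \<and> c = c'"
  by (auto simp: vec_eq_iff forall_3 vector_3)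

lemma vector_3_inner: "(vector [a, b, c] :: real^3) \<bullet> vector [a', b', c'] = a * a' + b * b' + c * c'"
  by (simp add: inner_vec_def sum_3 vector_3)

lemma vector_3_minus: "- (vector [a, b, c] :: real^3) = vector [- a, - b, - c]"
  by (simp add: vec_eq_iff forall_3 vector_3)

lemma norm_vector_3: "norm (vector [a, b, c] :: real^3) = sqrt (a\<^sup>2 + b\<^sup>2 + c\<^sup>2)"
  by (simp add: norm_vec_def L2_set_def sum_3 vector_3)

lemma commutes_if_fixes:
  assumes "norm q = 1" "rot q *v v = v"
  shows "q \<odot> imq v = imq v \<odot> q"
proof -
  have "q \<odot> imq v \<odot> qcnj q = imq v" using imq_rot[of q v] assms(2) by simp
  then have "q \<odot> imq v \<odot> qcnj q \<odot> q = imq v \<odot> q" by simp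
  then show ?thesis using qmul_qcnj_cancel(4)[OF assms(1)] by simp
qed

text \<open>A rotation fixes exactly the multiples of the imaginary part of the quaternion, unless this part
  vanishes: a quaternion that commutes with an imaginary one has imaginary part parallel to it.\<close>

lemma imaginary_part_parallel:
  assumes n: "norm (quat4 a b c d) = 1" and f: "rot (quat4 a b c d) *v vector [x, y, z] = vector [x, y, z]"
  shows "c * z = d * y" "d * x = b * z" "b * y = c * x"
proof -
  have "imq (vector [x, y, z]) = quat4 0 x y z" by (simp add: imq_def quat4_def vector_3)
  then have "quat4 a b c d \<odot> quat4 0 x y z = quat4 0 x y z \<odot> quat4 a b c d"
    using commutes_if_fixes[OF n f] by simp
  then show "c * z = d * y" "d * x = b * z" "b * y = c * x"
    unfolding quat4_mult quat4_eq_iff by (simp_all add: algebra_simps)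
qed

lemma fixes_two_vectors:
  assumes n: "norm q = 1" and f: "rot q *v vector [x, y, z] = vector [x, y, z]"
    "rot q *v vector [x', y', z'] = vector [x', y', z']"
    and indep: "y * z' - z * y' \<noteq> 0 \<or> z * x' - x * z' \<noteq> 0 \<or> x * y' - y * x' \<noteq> 0"
  shows "q = qone \<or> q = - qone"
proof -
  obtain a b c d where q: "q = quat4 a b c d" by (rule quat4_surj)
  have e: "c * z = d * y" "d * x = b * z" "b * y = c * x" "c * z' = d * y'" "d * x' = b * z'" "b * y' = c * x'"
    using imaginary_part_parallel[of a b c d x y z] imaginary_part_parallel[of a b c d x' y' z'] n f
    unfolding q by blast+
  have "r = 0" if "r * (y * z' - z * y') = 0" "r * (z * x' - x * z') = 0" "r * (x * y' - y * x') = 0" for r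
    using that indep by auto
  note r0 = this
  have k: "b * (y * z' - z * y') = z' * (b * y - c * x) + y' * (d * x - b * z) + x * (c * z' - d * y')"
    "b * (z * x' - x * z') = x' * (b * z - d * x) + x * (d * x' - b * z')"
    "b * (x * y' - y * x') = x * (b * y' - c * x') + x' * (c * x - b * y)"
    "c * (y * z' - z * y') = y * (c * z' - d * y') + y' * (d * y - c * z)"
    "c * (z * x' - x * z') = x' * (c * z - d * y) + z' * (b * y - c * x) + y * (d * x' - b * z')"
    "c * (x * y' - y * x') = y' * (c * x - b * y) + y * (b * y' - c * x')"
    "d * (y * z' - z * y') = z' * (d * y - c * z) + z * (c * z' - d * y')"
    "d * (z * x' - x * z') = z * (d * x' - b * z') + z' * (b * z - d * x)"
    "d * (x * y' - y * x') = y' * (d * x - b * z) + x' * (c * z - d * y) + z * (b * y' - c * x')"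
    by (simp_all add: algebra_simps)
  have z: "b = 0" "c = 0" "d = 0" by (rule r0; simp only: k e diff_self mult_zero_right add_0)+
  then have "a = 1 \<or> a = - 1" using n unfolding q norm_quat4 by (simp add: power2_eq_1_iff)
  then show ?thesis unfolding q qone_quat4 quat4_simps quat4_eq_iff using z by auto
qed

section \<open>The binary tetrahedral group\<close>

definition tetra_vertices :: "(real^3) set" where
  "tetra_vertices = {vector [1, 1, 1], vector [1, -1, -1], vector [-1, 1, -1], vector [-1, -1, 1]}"

abbreviation bin_tetra :: "quat set" where "bin_tetra \<equiv> vertex_group tetra_vertices"

text \<open>Representatives modulo sign: \<open>klein_units\<close> for the half turns about the coordinate axes,
  \<open>three_fold\<close> for the rotations about the diagonal \<open>(1, 1, 1)\<close>.\<close>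

definition klein_units :: "quat set" where
  "klein_units = {quat4 1 0 0 0, quat4 0 1 0 0, quat4 0 0 1 0, quat4 0 0 0 1}"

definition three_fold :: "quat set" where
  "three_fold = {quat4 1 0 0 0, quat4 (1/2) (1/2) (1/2) (1/2), quat4 (-1/2) (1/2) (1/2) (1/2)}"

lemma klein_units_norm: "t \<in> klein_units \<Longrightarrow> norm t = 1"
  by (auto simp: klein_units_def norm_quat4)

lemma three_fold_norm: "m \<in> three_fold \<Longrightarrow> norm m = 1"
  by (auto simp: three_fold_def norm_quat4 power2_eq_square)

lemma finite_tetra_vertices: "finite tetra_vertices"
  by (simp add: tetra_vertices_def)

lemma klein_units_tetra: "t \<in> klein_units \<Longrightarrow> t \<in> bin_tetra"
  by (rule vertex_groupI[OF finite_tetra_vertices klein_units_norm])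
    (auto simp: klein_units_def tetra_vertices_def rot_quat4 vector_3_eq_iff)

lemma vertex_group_left_quotient:
  assumes "norm t = 1" "rot t *v u = rot q *v u"
  shows "rot (qcnj t \<odot> q) *v u = u"
  using rot_cancel(2)[OF assms(1), of u] assms(2)
  by (simp add: rot_qmul matrix_vector_mul_assoc[symmetric])

lemma left_quotient_sign:
  assumes "norm t = 1" "qcnj t \<odot> q = s \<or> qcnj t \<odot> q = - s"
  shows "q = t \<odot> s \<or> q = - (t \<odot> s)"
  using assms(2) qmul_qcnj_cancel(2)[OF assms(1), of q] by (metis qmul_minus(2))

text \<open>The half turns act simply transitively on the vertices, and the stabiliser of one vertex is
  determined by the image of a second vertex. Dividing out both leaves a rotation that fixes two
  independent vectors.\<close>

lemma binary_tetrahedral_elements: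
  assumes q: "q \<in> bin_tetra"
  shows "\<exists>t\<in>klein_units. \<exists>m\<in>three_fold. q = t \<odot> m \<or> q = - (t \<odot> m)"
proof -
  have "rot q *v vector [1, 1, 1] \<in> tetra_vertices"
    using vertex_groupD(2)[OF q] by (simp add: tetra_vertices_def)
  moreover have "\<exists>t\<in>klein_units. rot t *v vector [1, 1, 1] = v" if "v \<in> tetra_vertices" for v
    using that by (auto simp: tetra_vertices_def klein_units_def rot_quat4 vector_3_eq_iff)
  ultimately obtain t where t: "t \<in> klein_units" "rot t *v vector [1, 1, 1] = rot q *v vector [1, 1, 1]"
    by blast
  note nt = klein_units_norm[OF t(1)]
  define r where "r = qcnj t \<odot> q"
  have r: "r \<in> bin_tetra"
    unfolding r_def using vertex_group_closed(2,3) klein_units_tetra[OF t(1)] q by blast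
  have r0: "rot r *v vector [1, 1, 1] = vector [1, 1, 1]"
    unfolding r_def by (rule vertex_group_left_quotient[OF nt t(2)])
  have "rot r *v vector [1, -1, -1] \<in> tetra_vertices"
    using vertex_groupD(2)[OF r] by (simp add: tetra_vertices_def)
  moreover have "rot r *v vector [1, -1, -1] \<noteq> vector [1, 1, 1]"
  proof
    assume "rot r *v vector [1, -1, -1] = vector [1, 1, 1]"
    then have "rot r *v vector [1, -1, -1] = rot r *v vector [1, 1, 1]" using r0 by simp
    then have "(vector [1, -1, -1] :: real^3) = vector [1, 1, 1]"
      by (rule injD[OF inj_rot[OF vertex_groupD(1)[OF r]]])
    then show False by (simp add: vector_3_eq_iff)
  qed
  moreover have "\<exists>m\<in>three_fold. rot m *v vector [1, 1, 1] = vector [1, 1, 1] \<and> rot m *v vector [1, -1, -1] = v"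
    if "v \<in> tetra_vertices" "v \<noteq> vector [1, 1, 1]" for v
    using that by (auto simp: tetra_vertices_def three_fold_def rot_quat4 vector_3_eq_iff power2_eq_square)
  ultimately obtain m where m: "m \<in> three_fold" "rot m *v vector [1, 1, 1] = vector [1, 1, 1]"
      "rot m *v vector [1, -1, -1] = rot r *v vector [1, -1, -1]" by blast
  note nm = three_fold_norm[OF m(1)]
  have "qcnj m \<odot> r = qone \<or> qcnj m \<odot> r = - qone"
  proof (rule fixes_two_vectors)
    show "norm (qcnj m \<odot> r) = 1" using nm vertex_groupD(1)[OF r] by (simp add: norm_qmul)
    show "rot (qcnj m \<odot> r) *v vector [1, 1, 1] = vector [1, 1, 1]"
      by (rule vertex_group_left_quotient[OF nm]) (simp add: r0 m(2))
    show "rot (qcnj m \<odot> r) *v vector [1, -1, -1] = vector [1, -1, -1]"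
      by (rule vertex_group_left_quotient[OF nm m(3)])
  qed simp
  then have "r = m \<or> r = - m" using left_quotient_sign[OF nm, of r qone] by simp
  then have "q = t \<odot> m \<or> q = - (t \<odot> m)" unfolding r_def by (rule left_quotient_sign[OF nt])
  then show ?thesis using t(1) m(1) by blast
qed

lemma finite_binary_tetrahedral: "finite (bin_tetra)"
proof -
  let ?L = "(\<lambda>(t, m). t \<odot> m) ` (klein_units \<times> three_fold)"
  have "bin_tetra \<subseteq> ?L \<union> uminus ` ?L"
  proof
    fix q assume "q \<in> bin_tetra"
    then obtain t m where "t \<in> klein_units" "m \<in> three_fold" and q: "q = t \<odot> m \<or> q = - (t \<odot> m)"
      using binary_tetrahedral_elements by blast
    then have "t \<odot> m \<in> ?L" by (intro image_eqI[of _ _ "(t, m)"]) simp_all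
    then show "q \<in> ?L \<union> uminus ` ?L" using q by blast
  qed
  moreover have "finite ?L" by (simp add: klein_units_def three_fold_def)
  ultimately show ?thesis by (meson finite_Un finite_imageI finite_subset)
qed

section \<open>The binary octahedral group\<close>

definition octa_vertices :: "(real^3) set" where
  "octa_vertices = {vector [1, 0, 0], vector [-1, 0, 0], vector [0, 1, 0], vector [0, -1, 0],
                  vector [0, 0, 1], vector [0, 0, -1]}"

abbreviation bin_octa :: "quat set" where "bin_octa \<equiv> vertex_group octa_vertices"

lemma finite_octa_vertices: "finite octa_vertices"
  by (simp add: octa_vertices_def)

text \<open>The tetrahedron and its opposite together form a cube, whose vertices are recognised by their
  inner products with the vertices of the octahedron.\<close>

lemma cube_vertices:
  assumes "\<And>e. e \<in> octa_vertices \<Longrightarrow> \<bar>x \<bullet> e\<bar> = 1"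
  shows "x \<in> tetra_vertices \<union> uminus ` tetra_vertices"
proof -
  have x: "x = vector [x$1, x$2, x$3]" by (simp add: vec_eq_iff forall_3 vector_3)
  have "\<bar>x$1\<bar> = 1" "\<bar>x$2\<bar> = 1" "\<bar>x$3\<bar> = 1"
    using assms[of "vector [1, 0, 0]"] assms[of "vector [0, 1, 0]"] assms[of "vector [0, 0, 1]"]
    by (simp_all add: octa_vertices_def inner_vec_def sum_3 vector_3)
  then have "x$1 \<in> {1, -1}" "x$2 \<in> {1, -1}" "x$3 \<in> {1, -1}" by (auto simp: abs_if split: if_splits)
  then show ?thesis
    by (subst x) (auto simp: tetra_vertices_def vector_3_minus vector_3_eq_iff simp del: insert_iff
        intro: insertI1 insertI2)
qed

lemma tetra_octa_inner: "v \<in> tetra_vertices \<Longrightarrow> e \<in> octa_vertices \<Longrightarrow> \<bar>v \<bullet> e\<bar> = 1"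
  by (auto simp: tetra_vertices_def octa_vertices_def vector_3_inner)

lemma tetra_inner: "v \<in> tetra_vertices \<Longrightarrow> w \<in> tetra_vertices \<Longrightarrow> v \<bullet> w = 3 \<or> v \<bullet> w = - 1"
  by (auto simp: tetra_vertices_def vector_3_inner)

lemma octa_vertex_midpoint:
  "e \<in> octa_vertices \<longleftrightarrow> (\<exists>v\<in>tetra_vertices. \<exists>w\<in>tetra_vertices. v \<noteq> w \<and> e = (1/2) *\<^sub>R (v + w))"
proof -
  have s: "(1/2) *\<^sub>R (vector [a, b, c] + vector [a', b', c'] :: real^3)
      = vector [(a + a') / 2, (b + b') / 2, (c + c') / 2]" for a b c a' b' c'
    by (simp add: vec_eq_iff forall_3 vector_3)
  show ?thesis by (auto simp: tetra_vertices_def octa_vertices_def s vector_3_eq_iff)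
qed

lemma octa_vertex_minus: "e \<in> octa_vertices \<Longrightarrow> - e \<in> octa_vertices"
  by (auto simp: octa_vertices_def vector_3_minus vector_3_eq_iff)

lemma tetra_not_symmetric: "uminus ` tetra_vertices \<noteq> tetra_vertices"
proof -
  have "- vector [1, 1, 1] \<notin> tetra_vertices"
    by (simp add: tetra_vertices_def vector_3_minus vector_3_eq_iff)
  moreover have "vector [1, 1, 1] \<in> tetra_vertices" by (simp add: tetra_vertices_def)
  ultimately show ?thesis by blast
qed

text \<open>Symmetries of the octahedron are symmetries of the dual cube, in which two opposite tetrahedra are
  inscribed. Vertices of the same tetrahedron have inner products \<open>3\<close> or \<open>-1\<close>, vertices of opposite
  ones \<open>-3\<close> or \<open>1\<close>; so each symmetry either keeps the two tetrahedra or exchanges them. Conversely, the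
  vertices of the octahedron are the midpoints of the edges of one tetrahedron.\<close>

lemma vertex_group_octa_iff:
  "q \<in> bin_octa \<longleftrightarrow> norm q = 1 \<and>
     ((\<lambda>x. rot q *v x) ` tetra_vertices = tetra_vertices \<or>
      (\<lambda>x. rot q *v x) ` tetra_vertices = uminus ` tetra_vertices)"
proof
  assume q: "q \<in> bin_octa"
  note n = vertex_groupD(1)[OF q]
  have cube: "rot q *v v \<in> tetra_vertices \<union> uminus ` tetra_vertices" if v: "v \<in> tetra_vertices" for v
  proof (rule cube_vertices)
    fix e assume "e \<in> octa_vertices"
    then obtain e' where e': "e' \<in> octa_vertices" "e = rot q *v e'" using q unfolding vertex_group_def by blast
    then show "\<bar>(rot q *v v) \<bullet> e\<bar> = 1" using tetra_octa_inner[OF v e'(1)] by (simp add: inner_rot[OF n])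
  qed
  have mixed: False if vw: "v \<in> tetra_vertices" "w \<in> tetra_vertices" "rot q *v v \<in> tetra_vertices"
     and w: "rot q *v w \<in> uminus ` tetra_vertices" for v w
  proof -
    obtain u where u: "u \<in> tetra_vertices" "rot q *v w = - u" using w by blast
    have "v \<bullet> w = - ((rot q *v v) \<bullet> u)" using inner_rot[OF n, of v w] u(2) by simp
    then show False using tetra_inner[OF vw(1,2)] tetra_inner[OF vw(3) u(1)] by auto
  qed
  have "(\<lambda>x. rot q *v x) ` tetra_vertices \<subseteq> tetra_vertices \<or>
      (\<lambda>x. rot q *v x) ` tetra_vertices \<subseteq> uminus ` tetra_vertices"
    using cube mixed by blast
  moreover have "card ((\<lambda>x. rot q *v x) ` tetra_vertices) = card tetra_vertices"
    by (rule card_image) (rule inj_on_subset[OF inj_rot[OF n]], simp)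
  moreover have "card (uminus ` tetra_vertices) = card tetra_vertices" by (rule card_image) simp
  ultimately show "norm q = 1 \<and> ((\<lambda>x. rot q *v x) ` tetra_vertices = tetra_vertices \<or>
      (\<lambda>x. rot q *v x) ` tetra_vertices = uminus ` tetra_vertices)"
    using n finite_tetra_vertices by (metis card_subset_eq finite_imageI)
next
  assume q: "norm q = 1 \<and> ((\<lambda>x. rot q *v x) ` tetra_vertices = tetra_vertices \<or>
      (\<lambda>x. rot q *v x) ` tetra_vertices = uminus ` tetra_vertices)"
  have lin: "rot q *v ((1/2) *\<^sub>R (v + w)) = (1/2) *\<^sub>R (rot q *v v + rot q *v w)" for v w
    by (simp add: matrix_vector_mult_scaleR matrix_vector_right_distrib)
  show "q \<in> bin_octa"
  proof (rule vertex_groupI[OF finite_octa_vertices])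
    show "norm q = 1" using q by blast
    note inj = injD[OF inj_rot[OF this]]
    fix e assume "e \<in> octa_vertices"
    then obtain v w where vw: "v \<in> tetra_vertices" "w \<in> tetra_vertices" "v \<noteq> w" "e = (1/2) *\<^sub>R (v + w)"
      using octa_vertex_midpoint by blast
    have ne: "rot q *v v \<noteq> rot q *v w" using inj vw(3) by blast
    have e: "rot q *v e = (1/2) *\<^sub>R (rot q *v v + rot q *v w)" unfolding vw(4) by (rule lin)
    from q consider "(\<lambda>x. rot q *v x) ` tetra_vertices = tetra_vertices"
      | "(\<lambda>x. rot q *v x) ` tetra_vertices = uminus ` tetra_vertices" by blast
    then show "rot q *v e \<in> octa_vertices"
    proof cases
      case 1
      then have "rot q *v v \<in> tetra_vertices" "rot q *v w \<in> tetra_vertices" using vw by blast+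
      then show ?thesis using ne e octa_vertex_midpoint by blast
    next
      case 2
      then obtain v' w' where v': "v' \<in> tetra_vertices" "w' \<in> tetra_vertices" "rot q *v v = - v'" "rot q *v w = - w'"
        using vw by blast
      have "v' \<noteq> w'" using ne v' by auto
      then have "(1/2) *\<^sub>R (v' + w') \<in> octa_vertices" using v' octa_vertex_midpoint by blast
      moreover have "rot q *v e = - ((1/2) *\<^sub>R (v' + w'))" unfolding e v'(3,4) by (simp add: algebra_simps)
      ultimately show ?thesis using octa_vertex_minus by metis
    qed
  qed
qed

text \<open>The character of the octahedral group that tells whether the two inscribed tetrahedra are
  exchanged. Its kernel is the tetrahedral group.\<close>

definition octa_sign :: "quat \<Rightarrow> real" where
  "octa_sign q = (if (\<lambda>x. rot q *v x) ` tetra_vertices = tetra_vertices then 1 else - 1)"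

lemma octa_sign_mult:
  assumes "a \<in> bin_octa" "b \<in> bin_octa"
  shows "octa_sign (a \<odot> b) = octa_sign a * octa_sign b"
proof -
  have uu: "uminus ` uminus ` S = S" for S :: "(real^3) set" by (simp add: image_image)
  note ns = tetra_not_symmetric
  have a: "(\<lambda>x. rot a *v x) ` tetra_vertices = tetra_vertices \<or>
      (\<lambda>x. rot a *v x) ` tetra_vertices = uminus ` tetra_vertices"
    and b: "(\<lambda>x. rot b *v x) ` tetra_vertices = tetra_vertices \<or>
      (\<lambda>x. rot b *v x) ` tetra_vertices = uminus ` tetra_vertices"
    using assms unfolding vertex_group_octa_iff by blast+
  from b show ?thesis
  proof
    assume b: "(\<lambda>x. rot b *v x) ` tetra_vertices = tetra_vertices"
    then show ?thesis unfolding octa_sign_def rot_image_mult by simp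
  next
    assume b: "(\<lambda>x. rot b *v x) ` tetra_vertices = uminus ` tetra_vertices"
    from a show ?thesis
    proof
      assume "(\<lambda>x. rot a *v x) ` tetra_vertices = tetra_vertices"
      then show ?thesis unfolding octa_sign_def rot_image_mult b rot_image_uminus by (simp only: ns if_False if_True) simp
    next
      assume "(\<lambda>x. rot a *v x) ` tetra_vertices = uminus ` tetra_vertices"
      then show ?thesis unfolding octa_sign_def rot_image_mult b rot_image_uminus by (simp only: ns uu if_False if_True) simp
    qed
  qed
qed

lemma octa_sign_values: "octa_sign a = 1 \<or> octa_sign a = - 1"
  by (simp add: octa_sign_def)

lemma octa_kernel: "{a \<in> bin_octa. octa_sign a = 1} = bin_tetra"
proof -
  have "a \<in> bin_octa \<and> octa_sign a = 1 \<longleftrightarrow> a \<in> bin_tetra" for a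
    unfolding vertex_group_octa_iff octa_sign_def by (auto simp: vertex_group_def)
  then show ?thesis by blast
qed

definition quarter_turn :: quat where "quarter_turn = quat4 (1 / sqrt 2) (1 / sqrt 2) 0 0"

lemma quarter_turn_octa: "quarter_turn \<in> bin_octa" "octa_sign quarter_turn = - 1"
proof -
  have n: "norm quarter_turn = 1" by (simp add: quarter_turn_def norm_quat4 power_divide)
  have r: "rot quarter_turn *v vector [x, y, z] = vector [x, - z, y]" for x y z
    by (simp add: quarter_turn_def rot_quat4 power_divide vector_3_eq_iff)
  show "quarter_turn \<in> bin_octa"
    by (rule vertex_groupI[OF finite_octa_vertices n]) (auto simp: octa_vertices_def r vector_3_eq_iff)
  have "vector [1, - 1, 1] \<in> (\<lambda>x. rot quarter_turn *v x) ` tetra_vertices"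
    by (rule image_eqI[of _ _ "vector [1, 1, 1]"]) (simp_all add: r tetra_vertices_def)
  moreover have "vector [1, - 1, 1] \<notin> tetra_vertices" by (simp add: tetra_vertices_def vector_3_eq_iff)
  ultimately have "(\<lambda>x. rot quarter_turn *v x) ` tetra_vertices \<noteq> tetra_vertices" by blast
  then show "octa_sign quarter_turn = - 1" by (simp add: octa_sign_def)
qed

lemma binary_octahedral_elements:
  assumes q: "q \<in> bin_octa"
  shows "q \<in> bin_tetra \<or> (\<exists>t\<in>bin_tetra. q = t \<odot> quarter_turn)"
proof (cases "octa_sign q = 1")
  case True
  then show ?thesis using q octa_kernel by blast
next
  case False
  then have s: "octa_sign q = - 1" using octa_sign_values by blast
  note g = quarter_turn_octa
  have n: "norm quarter_turn = 1" using vertex_groupD(1)[OF g(1)] .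
  define t where "t = q \<odot> qcnj quarter_turn"
  have t: "t \<in> bin_octa" unfolding t_def using vertex_group_closed q g(1) by blast
  have tq: "q = t \<odot> quarter_turn" unfolding t_def using qmul_qcnj_cancel(4)[OF n] by simp
  then have "octa_sign t = 1" using octa_sign_mult[OF t g(1)] s g(2) by simp
  then show ?thesis using t tq octa_kernel by blast
qed

lemma finite_binary_octahedral: "finite (bin_octa)"
proof -
  have "bin_octa \<subseteq> bin_tetra \<union> (\<lambda>t. t \<odot> quarter_turn) ` bin_tetra"
    using binary_octahedral_elements by blast
  then show ?thesis using finite_binary_tetrahedral by (meson finite_Un finite_imageI finite_subset)
qed

section \<open>The root system of type F4\<close>

text \<open>Simple roots of F4 in the binary octahedral group. The first two lie in the binary tetrahedral
  group and the last two do not. The Dynkin diagram is the chain 1, 2, 4, 3, numbered so that its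
  symmetry exchanges 1 with 3 and 2 with 4.\<close>

definition f4_roots :: "quat^4" where
  "f4_roots = vector [quat4 (1/2) (-1/2) (-1/2) (-1/2), quat4 0 0 0 1,
     quat4 0 (1 / sqrt 2) (-1 / sqrt 2) 0, quat4 0 0 (1 / sqrt 2) (-1 / sqrt 2)]"

text \<open>The edges of the chamber, up to scaling: each is orthogonal to all simple roots but one.\<close>

definition f4_weights :: "quat^4" where
  "f4_weights = vector [quat4 1 0 0 0, quat4 3 1 1 1, quat4 1 1 0 0, quat4 2 1 1 0]"

lemma f4_roots_mem:
  "f4_roots $ i \<in> bin_octa"
  "octa_sign (f4_roots $ 1) = 1" "octa_sign (f4_roots $ 2) = 1"
  "octa_sign (f4_roots $ 3) = - 1" "octa_sign (f4_roots $ 4) = - 1"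
proof -
  have n: "norm (f4_roots $ 1) = 1" "norm (f4_roots $ 2) = 1" "norm (f4_roots $ 3) = 1" "norm (f4_roots $ 4) = 1"
    by (simp_all add: f4_roots_def norm_quat4 power_divide power2_eq_square)
  have "f4_roots $ 1 \<in> bin_tetra"
    by (rule vertex_groupI[OF finite_tetra_vertices n(1)])
      (auto simp: f4_roots_def tetra_vertices_def rot_quat4 vector_3_eq_iff power2_eq_square)
  moreover have "f4_roots $ 2 \<in> bin_tetra"
    by (rule vertex_groupI[OF finite_tetra_vertices n(2)])
      (auto simp: f4_roots_def tetra_vertices_def rot_quat4 vector_3_eq_iff)
  ultimately have 12: "f4_roots $ 1 \<in> bin_octa \<and> octa_sign (f4_roots $ 1) = 1"
     "f4_roots $ 2 \<in> bin_octa \<and> octa_sign (f4_roots $ 2) = 1"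
    using octa_kernel by blast+
  have r3: "rot (f4_roots $ 3) *v vector [x, y, z] = vector [- y, - x, - z]" for x y z
    by (simp add: f4_roots_def rot_quat4 power_divide vector_3_eq_iff)
  have r4: "rot (f4_roots $ 4) *v vector [x, y, z] = vector [- x, - z, - y]" for x y z
    by (simp add: f4_roots_def rot_quat4 power_divide vector_3_eq_iff)
  have m3: "f4_roots $ 3 \<in> bin_octa"
    by (rule vertex_groupI[OF finite_octa_vertices n(3)]) (auto simp: octa_vertices_def r3 vector_3_eq_iff)
  have m4: "f4_roots $ 4 \<in> bin_octa"
    by (rule vertex_groupI[OF finite_octa_vertices n(4)]) (auto simp: octa_vertices_def r4 vector_3_eq_iff)
  have v: "vector [1, 1, 1] \<in> tetra_vertices" "vector [- 1, - 1, - 1] \<notin> tetra_vertices"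
    by (simp_all add: tetra_vertices_def vector_3_eq_iff)
  have "vector [- 1, - 1, - 1] \<in> (\<lambda>x. rot (f4_roots $ 3) *v x) ` tetra_vertices"
    by (rule image_eqI[OF _ v(1)]) (simp add: r3)
  then show "octa_sign (f4_roots $ 3) = - 1" using v(2) by (auto simp: octa_sign_def)
  have "vector [- 1, - 1, - 1] \<in> (\<lambda>x. rot (f4_roots $ 4) *v x) ` tetra_vertices"
    by (rule image_eqI[OF _ v(1)]) (simp add: r4)
  then show "octa_sign (f4_roots $ 4) = - 1" using v(2) by (auto simp: octa_sign_def)
  show "octa_sign (f4_roots $ 1) = 1" "octa_sign (f4_roots $ 2) = 1" using 12 by blast+
  show "f4_roots $ i \<in> bin_octa" using exhaust_4[of i] 12 m3 m4 by auto
qed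

definition weakly_signed :: "quat^4 \<Rightarrow> quat \<Rightarrow> bool" where
  "weakly_signed W \<beta> \<longleftrightarrow> (\<forall>i. \<beta> \<bullet> W $ i \<ge> 0) \<or> (\<forall>i. \<beta> \<bullet> W $ i \<le> 0)"

lemma weakly_signed_minus: "weakly_signed W (- \<beta>) \<longleftrightarrow> weakly_signed W \<beta>"
  by (auto simp: weakly_signed_def)

lemma weakly_signed_scaleR: "weakly_signed W \<beta> \<Longrightarrow> r \<ge> 0 \<Longrightarrow> weakly_signed W (r *\<^sub>R \<beta>)"
  by (auto simp: weakly_signed_def mult_nonneg_nonpos intro: mult_nonneg_nonneg)

text \<open>A finite check over representatives modulo sign. For elements outside the binary tetrahedral group
  the common factor \<open>1/\<surd>2\<close> is split off, which leaves rational numbers.\<close>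

lemma f4_sign:
  assumes "\<beta> \<in> bin_octa"
  shows "weakly_signed f4_weights \<beta>"
proof -
  have 1: "weakly_signed f4_weights (t \<odot> m)" "weakly_signed f4_weights (t \<odot> m \<odot> quat4 1 1 0 0)"
    if "t \<in> klein_units" "m \<in> three_fold" for t m
    using that unfolding weakly_signed_def forall_4 f4_weights_def vector_4
    by (auto simp: klein_units_def three_fold_def quat4_mult quat4_simps)
  have 2: "weakly_signed f4_weights q" "weakly_signed f4_weights (q \<odot> quat4 1 1 0 0)"
    if q: "q \<in> bin_tetra" for q
  proof -
    obtain t m where tm: "t \<in> klein_units" "m \<in> three_fold" "q = t \<odot> m \<or> q = - (t \<odot> m)"
      using binary_tetrahedral_elements[OF q] by blast
    show "weakly_signed f4_weights q" using tm(3) 1(1)[OF tm(1,2)] weakly_signed_minus by metis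
    show "weakly_signed f4_weights (q \<odot> quat4 1 1 0 0)"
      using tm(3) 1(2)[OF tm(1,2)] weakly_signed_minus[of _ "t \<odot> m \<odot> quat4 1 1 0 0"] by auto
  qed
  have qt: "quarter_turn = (1 / sqrt 2) *\<^sub>R quat4 1 1 0 0"
    by (simp add: quarter_turn_def quat4_simps)
  from binary_octahedral_elements[OF assms] show ?thesis
  proof
    assume "\<beta> \<in> bin_tetra"
    then show ?thesis by (rule 2(1))
  next
    assume "\<exists>t\<in>bin_tetra. \<beta> = t \<odot> quarter_turn"
    then obtain t where t: "t \<in> bin_tetra" "\<beta> = (1 / sqrt 2) *\<^sub>R (t \<odot> quat4 1 1 0 0)"
      by (auto simp: qt)
    show ?thesis unfolding t(2) by (rule weakly_signed_scaleR[OF 2(2)[OF t(1)]]) simp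
  qed
qed

lemma exhaust_4_cases:
  obtains "i = 1" | "i = 2" | "i = 3" | "i = (4 :: 4)"
  using exhaust_4[of i] by blast

text \<open>Squaring both signed coordinate pairs forgets the first sign on the walls 1 and 2 and the second
  sign on the walls 3 and 4. A symmetry of the diagram that respects the classes of roots is trivial,
  since the double bond joins 2 and 4.\<close>

interpretation F4: quat_chamber "bin_octa" octa_sign "\<lambda>i. f4_roots $ i" "\<lambda>i. f4_weights $ i" "qpw 2"
proof
  have half: "1 / sqrt 2 * (1 / sqrt 2) = (1 / 2 :: real)" by simp
  note vals = f4_roots_def f4_weights_def quat4_simps
  show "unit_quat_group (bin_octa)"
    by (rule unit_quat_group_vertex_group[OF finite_binary_octahedral])
  show "octa_sign (a \<odot> b) = octa_sign a * octa_sign b"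
    if "a \<in> bin_octa" "b \<in> bin_octa" for a b
    using octa_sign_mult that .
  show "octa_sign a = 1 \<or> octa_sign a = - 1" for a by (rule octa_sign_values)
  show "octa_sign (- qone) = 1" unfolding octa_sign_def rot_minus rot_image_one by simp
  show "f4_roots $ i \<in> bin_octa" for i by (rule f4_roots_mem)
  show "f4_roots $ i \<bullet> f4_weights $ j = 0" if "i \<noteq> j" for i j
    using that by (cases i rule: exhaust_4_cases; cases j rule: exhaust_4_cases) (simp_all add: vals)
  show "f4_roots $ i \<bullet> f4_weights $ i > 0" for i
    by (cases i rule: exhaust_4_cases) (simp_all add: vals)
  show "x = 0" if x: "\<And>i. x \<bullet> f4_roots $ i = 0" for x
  proof -
    obtain a b c d where q: "x = quat4 a b c d" by (rule quat4_surj)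
    have "d = 0" "c = 0" "b = 0" "a = 0"
      using x[of 1] x[of 2] x[of 3] x[of 4] by (simp_all add: vals q field_simps)
    then show ?thesis by (simp add: q quat4_def zero_prod_def complex_eq_iff)
  qed
  show "(\<forall>i. \<beta> \<bullet> f4_weights $ i \<ge> 0) \<or> (\<forall>i. \<beta> \<bullet> f4_weights $ i \<le> 0)"
    if "\<beta> \<in> bin_octa" for \<beta>
    using f4_sign[OF that] by (simp add: weakly_signed_def)
  show "\<pi> k = k" if g: "\<And>i j. f4_roots $ \<pi> i \<bullet> f4_roots $ \<pi> j = f4_roots $ i \<bullet> f4_roots $ j"
    and s: "\<And>i. octa_sign (f4_roots $ \<pi> i) = octa_sign (f4_roots $ i)" for \<pi> k
  proof -
    have p: "\<pi> 1 = 1 \<or> \<pi> 1 = 2" "\<pi> 2 = 1 \<or> \<pi> 2 = 2" "\<pi> 3 = 3 \<or> \<pi> 3 = 4" "\<pi> 4 = 3 \<or> \<pi> 4 = 4"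
      using s[of 1] s[of 2] s[of 3] s[of 4]
      by (cases "\<pi> 1" rule: exhaust_4_cases; cases "\<pi> 2" rule: exhaust_4_cases;
        cases "\<pi> 3" rule: exhaust_4_cases; cases "\<pi> 4" rule: exhaust_4_cases; simp add: f4_roots_mem)+
    have 24: "\<pi> 2 = 2" "\<pi> 4 = 4" using g[of 2 4] p(2,4) by (auto simp: vals)
    have "\<pi> 1 = 1" using g[of 1 2] p(1) by (auto simp: vals 24)
    moreover have "\<pi> 3 = 3" using g[of 3 4] p(3) by (auto simp: vals 24 half)
    ultimately show ?thesis using 24 exhaust_4[of k] by auto
  qed
  show "norm_onto_map (qpw 2)" by (rule norm_onto_map_qpw) simp
  show "qpw 2 (r *\<^sub>R x) = r *\<^sub>R qpw 2 x" if "r > 0" for r x using that by (simp add: qpw_scaleR)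
  have sv: "t = 1 \<or> t = - 1" if "t \<in> octa_sign ` bin_octa" for t
    using that octa_sign_values by auto
  show "qpw 2 (signed_coords (- octa_sign (f4_roots $ i) * s) (octa_sign (f4_roots $ i) * t) l)
      = qpw 2 (signed_coords s t l)" if "l i = 0" for s t l i
    using that f4_roots_mem pw_2_flip[of "s * l 1" "l 2"] pw_2_flip[of "t * l 3" "l 4"]
    by (cases i rule: exhaust_4_cases) (simp_all add: signed_coords_def qpw_def)
  show "l = l' \<and> (s' = s \<and> t' = t \<or>
      (\<exists>i. l i = 0 \<and> s' = - octa_sign (f4_roots $ i) * s \<and> t' = octa_sign (f4_roots $ i) * t) \<or>
      (\<exists>i j. l i = 0 \<and> l j = 0 \<and> s' = octa_sign (f4_roots $ i) * octa_sign (f4_roots $ j) * s \<and>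
        t' = octa_sign (f4_roots $ i) * octa_sign (f4_roots $ j) * t))"
    if st: "s = 1 \<or> s = - 1" "s' = 1 \<or> s' = - 1" "t \<in> octa_sign ` bin_octa"
      "t' \<in> octa_sign ` bin_octa" and l: "\<And>i. l i \<ge> 0" "\<And>i. l' i \<ge> 0"
      and eq: "qpw 2 (signed_coords s t l) = qpw 2 (signed_coords s' t' l')" for s s' t t' l l'
  proof -
    have "l 1 = l' 1 \<and> l 2 = l' 2 \<and> (s' = s \<or> s' = - s \<and> (l 1 = 0 \<or> l 2 = 0))"
      by (rule pw_2_half_plane) (use st l eq in \<open>auto simp: signed_coords_def qpw_def\<close>)
    moreover have "l 3 = l' 3 \<and> l 4 = l' 4 \<and> (t' = t \<or> t' = - t \<and> (l 3 = 0 \<or> l 4 = 0))"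
      by (rule pw_2_half_plane) (use sv[OF st(3)] sv[OF st(4)] l eq in \<open>auto simp: signed_coords_def qpw_def\<close>)
    ultimately have "\<forall>i. l i = l' i" and s: "s' = s \<or> s' = - s \<and> (l 1 = 0 \<or> l 2 = 0)"
      and t: "t' = t \<or> t' = - t \<and> (l 3 = 0 \<or> l 4 = 0)" unfolding forall_4 by blast+
    then have "l = l'" by blast
    have A: "\<exists>i. l i = 0 \<and> octa_sign (f4_roots $ i) = 1" if "l 1 = 0 \<or> l 2 = 0" using that f4_roots_mem by blast
    have B: "\<exists>i. l i = 0 \<and> octa_sign (f4_roots $ i) = - 1" if "l 3 = 0 \<or> l 4 = 0" using that f4_roots_mem by blast
    consider "s' = s" "t' = t" | "s' = - s" "t' = t" "l 1 = 0 \<or> l 2 = 0" | "s' = s" "t' = - t" "l 3 = 0 \<or> l 4 = 0"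
      | "s' = - s" "t' = - t" "l 1 = 0 \<or> l 2 = 0" "l 3 = 0 \<or> l 4 = 0" using s t by blast
    then show ?thesis
    proof cases
      case 1
      then show ?thesis using \<open>l = l'\<close> by blast
    next
      case 2
      then obtain i where i: "l i = 0" "octa_sign (f4_roots $ i) = 1" using A by blast
      have "s' = - octa_sign (f4_roots $ i) * s \<and> t' = octa_sign (f4_roots $ i) * t" using 2 i by simp
      then show ?thesis using \<open>l = l'\<close> i(1) by blast
    next
      case 3
      then obtain i where i: "l i = 0" "octa_sign (f4_roots $ i) = - 1" using B by blast
      have "s' = - octa_sign (f4_roots $ i) * s \<and> t' = octa_sign (f4_roots $ i) * t" using 3 i by simp
      then show ?thesis using \<open>l = l'\<close> i(1) by blast
    next
      case 4
      then obtain i j where ij: "l i = 0" "octa_sign (f4_roots $ i) = 1" "l j = 0" "octa_sign (f4_roots $ j) = - 1"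
        using A B by blast
      have "s' = octa_sign (f4_roots $ i) * octa_sign (f4_roots $ j) * s \<and>
          t' = octa_sign (f4_roots $ i) * octa_sign (f4_roots $ j) * t" using 4 ij by simp
      then show ?thesis using \<open>l = l'\<close> ij(1,3) by blast
    qed
  qed
  show "\<exists>s t l. (s = 1 \<or> s = - 1) \<and> t \<in> octa_sign ` bin_octa \<and> (\<forall>i. l i \<ge> 0) \<and>
      qpw 2 z = qpw 2 (signed_coords s t l)" for z
  proof -
    obtain s a b where s: "s = 1 \<or> s = - 1" "a \<ge> 0" "b \<ge> 0" "pw 2 (fst z) = pw 2 (Complex (s * a) b)"
      using complex_half_plane by blast
    obtain t c d where t: "t = 1 \<or> t = - 1" "c \<ge> 0" "d \<ge> 0" "pw 2 (snd z) = pw 2 (Complex (t * c) d)"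
      using complex_half_plane by blast
    have "octa_sign (f4_roots $ 1) \<in> octa_sign ` bin_octa"
      "octa_sign (f4_roots $ 3) \<in> octa_sign ` bin_octa"
      using f4_roots_mem(1) by blast+
    then have tm: "t \<in> octa_sign ` bin_octa" using t(1) by (auto simp: f4_roots_mem)
    define l where "l i = (vector [a, b, c, d] :: real^4) $ i" for i
    have "\<forall>i. l i \<ge> 0" unfolding forall_4 using s t by (simp add: l_def)
    moreover have "qpw 2 z = qpw 2 (signed_coords s t l)"
      using s(4) t(4) by (simp add: qpw_def signed_coords_def l_def)
    ultimately show ?thesis using s(1) tm by blast
  qed
qed

section \<open>The tetrahedral and octahedral groups\<close>

lemma rotational_symmetries_tetrahedron:
  "rotational_symmetries regular_tetrahedron = rot ` bin_tetra"
  unfolding rot_vertex_group regular_tetrahedron_def tetra_vertices_def[symmetric]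
  by (rule rotational_symmetries_convex_hull[where r = "sqrt 3", OF finite_tetra_vertices])
    (auto simp: tetra_vertices_def norm_vector_3)

lemma rotational_symmetries_octahedron:
  "rotational_symmetries regular_octahedron = rot ` bin_octa"
  unfolding rot_vertex_group regular_octahedron_def octa_vertices_def[symmetric]
  by (rule rotational_symmetries_convex_hull[where r = 1, OF finite_octa_vertices])
    (auto simp: octa_vertices_def norm_vector_3)

lemma tetrahedral_carries:
  assumes "tetrahedral_rotation_group G"
  shows "carries_bicoset_structure S3 G"
proof -
  obtain f :: "quat \<Rightarrow> quat" where f: "continuous_on (sphere 0 1) f" "f ` sphere 0 1 = sphere 0 1"
    and fib: "\<forall>x\<in>sphere 0 1. \<forall>y\<in>sphere 0 1. f x = f y \<longleftrightarrow>
      (\<exists>a\<in>bin_tetra. \<exists>b\<in>bin_tetra. y = a \<odot> x \<odot> b)"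
    using F4.chamber_orbit_map unfolding octa_kernel by blast
  have "bicoset_orbit_map S3 (bin_tetra) (\<lambda>x. quat_vec (f x))"
    by (rule bicoset_orbit_map_S3[OF f]) (use fib in simp)
  then show ?thesis
    using carries_bicoset_structure_unit_quat_group[OF unit_quat_group_vertex_group[OF finite_binary_tetrahedral]
      Hausdorff_S3] assms
    unfolding tetrahedral_rotation_group_def rotational_symmetries_tetrahedron by blast
qed

definition qswap :: "quat \<Rightarrow> quat" where "qswap z = (snd z, fst z)"

definition qconj2 :: "quat \<Rightarrow> quat" where "qconj2 z = (cnj (fst z), cnj (snd z))"

lemma sgn_qswap: "sgn (qswap z) = qswap (sgn z)"
  by (simp add: sgn_div_norm qswap_def norm_prod_def add.commute)

lemma sgn_qconj2: "sgn (qconj2 z) = qconj2 (sgn z)"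
  by (simp add: sgn_div_norm qconj2_def norm_prod_def)

text \<open>The isometry \<open>x \<mapsto> a x b\<close> with \<open>a = (j + k)/\<surd>2\<close> and \<open>b = - j\<close> induces the symmetry of the Dynkin
  diagram (\<open>f4_twist_roots\<close>). Only the factor \<open>a\<close> exchanges the two tetrahedra, so the map does not belong
  to the reflection group.\<close>

definition f4_twist :: qsym where
  "f4_twist = QSym (quat4 0 0 (1 / sqrt 2) (1 / sqrt 2)) (quat4 0 0 (-1) 0) True"

lemma f4_twist_factors:
  "lfactor f4_twist \<in> bin_octa" "octa_sign (lfactor f4_twist) = - 1"
  "rfactor f4_twist \<in> bin_octa" "octa_sign (rfactor f4_twist) = 1"
proof -
  let ?a = "quat4 0 0 (1 / sqrt 2) (1 / sqrt 2)" and ?b = "quat4 0 0 (-1) 0"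
  have n: "norm ?a = 1" "norm ?b = 1" by (simp_all add: norm_quat4 power_divide)
  have r: "rot ?a *v vector [x, y, z] = vector [- x, z, y]" for x y z
    by (simp add: rot_quat4 power_divide vector_3_eq_iff)
  show "lfactor f4_twist \<in> bin_octa"
    unfolding f4_twist_def qsym.sel
    by (rule vertex_groupI[OF finite_octa_vertices n(1)]) (auto simp: octa_vertices_def r vector_3_eq_iff)
  have "vector [- 1, 1, 1] \<in> (\<lambda>x. rot ?a *v x) ` tetra_vertices"
    by (rule image_eqI[of _ _ "vector [1, 1, 1]"]) (simp_all add: r tetra_vertices_def)
  moreover have "vector [- 1, 1, 1] \<notin> tetra_vertices" by (simp add: tetra_vertices_def vector_3_eq_iff)
  ultimately show "octa_sign (lfactor f4_twist) = - 1" by (auto simp: octa_sign_def f4_twist_def)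
  have "?b \<in> bin_tetra"
    by (rule vertex_groupI[OF finite_tetra_vertices n(2)])
      (auto simp: tetra_vertices_def rot_quat4 vector_3_eq_iff)
  then show "rfactor f4_twist \<in> bin_octa" "octa_sign (rfactor f4_twist) = 1"
    unfolding octa_kernel[symmetric] f4_twist_def by simp_all
qed

text \<open>Conjugation with the twist exchanges the two classes of roots, and hence the two characters.\<close>

lemma f4_twist_conj:
  assumes w: "w \<in> F4.W"
  shows "\<exists>w'\<in>F4.W. F4.sgn1 w' = F4.sgn2 w \<and> F4.sgn2 w' = F4.sgn1 w \<and>
    (\<forall>x. qact w' (qact f4_twist x) = qact f4_twist (qact w x))"
proof -
  obtain a b e where w': "w = QSym a b e" by (cases w)
  have ab: "a \<in> bin_octa" "b \<in> bin_octa" "octa_sign a = octa_sign b"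
    using w by (simp_all add: w' F4.W_QSym)
  obtain c d where cd: "f4_twist = QSym c d True" by (simp add: f4_twist_def)
  have c: "c \<in> bin_octa" "octa_sign c = - 1"
    and d: "d \<in> bin_octa" "octa_sign d = 1"
    using f4_twist_factors by (simp_all add: cd)
  note n = vertex_groupD(1)[OF c(1)] vertex_groupD(1)[OF d(1)]
  note cl = vertex_group_closed(2)[of _ octa_vertices] vertex_group_closed(3)[of _ octa_vertices]
  have sq: "octa_sign (qcnj x) = octa_sign x" if "x \<in> bin_octa" for x
    using F4.chi_qcnj[OF that] .
  show ?thesis
  proof (cases e)
    case True
    show ?thesis
      by (rule bexI[of _ "QSym (c \<odot> a \<odot> qcnj c) (qcnj d \<odot> b \<odot> d) True"])
        (use ab c d True n in \<open>simp_all add: w' cd F4.W_QSym F4.sgn_QSym octa_sign_mult cl sq qmul_assoc qmul_qcnj_cancel\<close>)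
  next
    case False
    show ?thesis
      by (rule bexI[of _ "QSym (c \<odot> a \<odot> d) (c \<odot> b \<odot> d) False"])
        (use ab c d False n in \<open>simp_all add: w' cd F4.W_QSym F4.sgn_QSym octa_sign_mult cl sq qmul_assoc qcnj_qmul qmul_qcnj_cancel\<close>)
  qed
qed

lemma f4_twist_roots:
  "qact f4_twist (f4_roots $ 1) = f4_roots $ 3" "qact f4_twist (f4_roots $ 3) = f4_roots $ 1"
  "qact f4_twist (f4_roots $ 2) = f4_roots $ 4" "qact f4_twist (f4_roots $ 4) = f4_roots $ 2"
  by (simp_all add: f4_twist_def f4_roots_def quat4_mult quat4_eq_iff)

lemma f4_twist_coords:
  "F4.coords (qact f4_twist c) 1 = F4.coords c 3" "F4.coords (qact f4_twist c) 3 = F4.coords c 1"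
  "F4.coords (qact f4_twist c) 2 = F4.coords c 4" "F4.coords (qact f4_twist c) 4 = F4.coords c 2"
proof -
  have n: "norm (lfactor f4_twist) = 1" "norm (rfactor f4_twist) = 1"
    using vertex_groupD(1) f4_twist_factors by blast+
  have i: "qact f4_twist x \<bullet> qact f4_twist y = x \<bullet> y" for x y
    using n by (simp add: f4_twist_def inner_qmul_left inner_qmul_right)
  show "F4.coords (qact f4_twist c) 1 = F4.coords c 3" "F4.coords (qact f4_twist c) 3 = F4.coords c 1"
    "F4.coords (qact f4_twist c) 2 = F4.coords c 4" "F4.coords (qact f4_twist c) 4 = F4.coords c 2"
    unfolding F4.coords_def
    using i[of c "f4_roots $ 3"] i[of c "f4_roots $ 1"] i[of c "f4_roots $ 4"] i[of c "f4_roots $ 2"]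
    unfolding f4_twist_roots by simp_all
qed

text \<open>On the quotient by the tetrahedral group, which is a sphere in \<open>\<complex>\<^sup>2\<close>, the twist acts by the
  exchange of the coordinates, and multiplication by two elements of odd sign acts by complex
  conjugation. Every two-sided multiplication by octahedral elements is a product of such maps and of
  tetrahedral ones. So the orbits of the octahedral group are the orbits of exchange and conjugation,
  and \<open>swap_conj_fold\<close> is the quotient by these.\<close>

lemma octahedral_carries:
  assumes "octahedral_rotation_group G"
  shows "carries_bicoset_structure S3 G"
proof -
  let ?O = "bin_octa" and ?T = "bin_tetra"
  note O = unit_quat_groupD[OF unit_quat_group_vertex_group[OF finite_binary_octahedral]]
  obtain f where fc: "continuous_on (sphere 0 1) f" and onto: "f ` sphere 0 1 = sphere 0 1"
    and fib: "\<forall>x\<in>sphere 0 1. \<forall>y\<in>sphere 0 1. f x = f y \<longleftrightarrow> (\<exists>a\<in>?T. \<exists>b\<in>?T. y = a \<odot> x \<odot> b)"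
    and val: "\<forall>w\<in>F4.W. \<forall>c\<in>F4.chamber. f (qact w c) = sgn (F4.chamber_value w c)"
    using F4.chamber_orbit_map unfolding octa_kernel by blast
  have fib: "f x = f y \<longleftrightarrow> (\<exists>a\<in>?T. \<exists>b\<in>?T. y = a \<odot> x \<odot> b)" if "norm x = 1" "norm y = 1" for x y
    using fib that by simp
  have mem_T: "a \<in> ?T" if "a \<in> ?O" "octa_sign a = 1" for a using that octa_kernel by blast
  have T_O: "a \<in> ?O" if "a \<in> ?T" for a using that octa_kernel by blast
  obtain c d where cd: "f4_twist = QSym c d True" by (simp add: f4_twist_def)
  have c: "c \<in> ?O" "octa_sign c = - 1" and d: "d \<in> ?O" "octa_sign d = 1"
    using f4_twist_factors by (simp_all add: cd)
  note nc = O(3)[OF c(1)] and nd = O(3)[OF d(1)]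
  have swap: "f (c \<odot> x \<odot> d) = qswap (f x)" for x
  proof -
    obtain w k where w: "w \<in> F4.W" "k \<in> F4.chamber" "x = qact w k" using F4.chamber_represents by blast
    obtain w' where w': "w' \<in> F4.W" "F4.sgn1 w' = F4.sgn2 w" "F4.sgn2 w' = F4.sgn1 w"
        "qact w' (qact f4_twist k) = qact f4_twist (qact w k)"
      using f4_twist_conj[OF w(1)] by blast
    have "\<forall>i. F4.coords (qact f4_twist k) i \<ge> 0"
      unfolding forall_4 f4_twist_coords using w(2) by (simp add: F4.coords_def F4.chamber_def)
    then have tk: "qact f4_twist k \<in> F4.chamber" by (simp add: F4.coords_def F4.chamber_def)
    have "F4.chamber_value w' (qact f4_twist k) = qswap (F4.chamber_value w k)"
      by (simp add: F4.chamber_value_def w'(2,3) signed_coords_def f4_twist_coords qpw_def qswap_def)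
    moreover have "c \<odot> x \<odot> d = qact w' (qact f4_twist k)" using w'(4) by (simp add: cd w(3))
    ultimately show ?thesis using val w w'(1) tk by (simp add: sgn_qswap)
  qed
  have conj: "f (a \<odot> x \<odot> b) = qconj2 (f x)" if ab: "a \<in> ?O" "b \<in> ?O" "octa_sign a = - 1" "octa_sign b = - 1" for a b x
  proof -
    obtain w k where w: "w \<in> F4.W" "k \<in> F4.chamber" "x = qact w k" using F4.chamber_represents by blast
    have v: "QSym a b True \<in> F4.W" using ab by (simp add: F4.W_QSym)
    have s: "F4.sgn1 (QSym a b True) = - 1" "F4.sgn2 (QSym a b True) = - 1" using ab by (simp_all add: F4.sgn_QSym)
    note vw = F4.qcomp_W[OF v w(1), unfolded s]
    have "F4.chamber_value (qcomp (QSym a b True) w) k = qconj2 (F4.chamber_value w k)"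
      by (simp add: F4.chamber_value_def vw(2,3) signed_coords_def qpw_def qconj2_def pw_2_reflect)
    moreover have "a \<odot> x \<odot> b = qact (qcomp (QSym a b True) w) k" unfolding qact_qcomp w(3) by simp
    ultimately show ?thesis using val w vw(1) by (simp add: sgn_qconj2)
  qed
  have same: "f (a \<odot> x \<odot> b) = f x" if "a \<in> ?O" "b \<in> ?O" "octa_sign a = 1" "octa_sign b = 1" "norm x = 1" for a b x
  proof -
    have "norm (a \<odot> x \<odot> b) = 1" using that O(3) by (simp add: norm_qmul)
    then show ?thesis using fib[OF that(5)] mem_T that(1-4) by metis
  qed
  have orbit: "f (a \<odot> x \<odot> b) \<in> {f x, qswap (f x), qconj2 (f x), qconj2 (qswap (f x))}"
    if ab: "a \<in> ?O" "b \<in> ?O" and x: "norm x = 1" for a b x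
  proof -
    \<comment> \<open>Splitting off the twist changes the sign of the left factor only, so one of \<open>(a, b)\<close> and \<open>(a', b')\<close> has equal signs.\<close>
    define a' b' where a'b': "a' = a \<odot> qcnj c" "b' = qcnj d \<odot> b"
    have m: "a' \<in> ?O" "b' \<in> ?O" unfolding a'b' using O(5,6) ab c d by blast+
    have s: "octa_sign a' = - octa_sign a" "octa_sign b' = octa_sign b"
      unfolding a'b' using octa_sign_mult[OF ab(1) O(5)[OF c(1)]] octa_sign_mult[OF O(5)[OF d(1)] ab(2)]
        F4.chi_qcnj[OF c(1)] F4.chi_qcnj[OF d(1)] c(2) d(2) by simp_all
    have e: "a \<odot> x \<odot> b = a' \<odot> (c \<odot> x \<odot> d) \<odot> b'"
      unfolding a'b' by (simp add: qmul_assoc qmul_qcnj_cancel nc nd)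
    have n: "norm (c \<odot> x \<odot> d) = 1" by (simp add: norm_qmul nc nd x)
    consider "octa_sign a = 1" "octa_sign b = 1" | "octa_sign a = - 1" "octa_sign b = - 1"
      | "octa_sign a' = 1" "octa_sign b' = 1" | "octa_sign a' = - 1" "octa_sign b' = - 1"
      using octa_sign_values[of a] octa_sign_values[of b] s by auto
    then show ?thesis
    proof cases
      case 1
      then show ?thesis using same ab x by simp
    next
      case 2
      then show ?thesis using conj ab by simp
    next
      case 3
      then have "f (a \<odot> x \<odot> b) = qswap (f x)" unfolding e using same[OF m 3 n] swap by simp
      then show ?thesis by simp
    next
      case 4
      then have "f (a \<odot> x \<odot> b) = qconj2 (qswap (f x))" unfolding e using conj[OF m 4] swap by simp
      then show ?thesis by simp
    qed
  qed
  have reach: "\<exists>a\<in>?O. \<exists>b\<in>?O. z = f (a \<odot> x \<odot> b)"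
    if z: "z \<in> {f x, qswap (f x), qconj2 (f x), qconj2 (qswap (f x))}" and x: "norm x = 1" for z x
  proof -
    have "f x = f (qone \<odot> x \<odot> qone)" by simp
    moreover have "qswap (f x) = f (c \<odot> x \<odot> d)" using swap by simp
    moreover have "qconj2 (f x) = f (c \<odot> x \<odot> c)" using conj[OF c(1) c(1) c(2) c(2)] by simp
    moreover have "qconj2 (qswap (f x)) = f (c \<odot> (c \<odot> x \<odot> d) \<odot> c)" using conj[OF c(1) c(1) c(2) c(2)] swap by simp
    moreover have "c \<odot> (c \<odot> x \<odot> d) \<odot> c = (c \<odot> c) \<odot> x \<odot> (d \<odot> c)" by (simp add: qmul_assoc)
    ultimately show ?thesis using z O(2) c(1) d(1) O(6)[OF c(1) c(1)] O(6)[OF d(1) c(1)]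
      by (metis insertE singletonD)
  qed
  define g where "g x = swap_conj_fold (f x)" for x
  have "continuous_on (sphere 0 1) g"
    unfolding g_def using continuous_on_compose2[OF norm_onto_map_sphere(2)[OF norm_onto_map_swap_conj_fold] fc] by blast
  moreover have "g ` sphere 0 1 = sphere 0 1"
    unfolding g_def using onto norm_onto_map_sphere(1)[OF norm_onto_map_swap_conj_fold] by (metis image_image)
  moreover have "g x = g y \<longleftrightarrow> (\<exists>a\<in>?O. \<exists>b\<in>?O. y = a \<odot> x \<odot> b)" if x: "norm x = 1" and y: "norm y = 1" for x y
  proof -
    have "g x = g y \<longleftrightarrow> swap_conj_fold (f y) = swap_conj_fold (fst (f x), snd (f x))"
      unfolding g_def by (metis prod.collapse)
    also have "\<dots> \<longleftrightarrow> f y \<in> {f x, qswap (f x), qconj2 (f x), qconj2 (qswap (f x))}"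
      unfolding swap_conj_fold_eq_iff by (simp add: qswap_def qconj2_def)
    also have "\<dots> \<longleftrightarrow> (\<exists>a\<in>?O. \<exists>b\<in>?O. y = a \<odot> x \<odot> b)"
    proof
      assume "f y \<in> {f x, qswap (f x), qconj2 (f x), qconj2 (qswap (f x))}"
      then obtain a b where ab: "a \<in> ?O" "b \<in> ?O" "f y = f (a \<odot> x \<odot> b)" using reach x by blast
      have "norm (a \<odot> x \<odot> b) = 1" using ab O(3) x by (simp add: norm_qmul)
      then obtain a' b' where a'b': "a' \<in> ?T" "b' \<in> ?T" "y = a' \<odot> (a \<odot> x \<odot> b) \<odot> b'"
        using fib[OF _ y] ab(3) by metis
      then have "y = (a' \<odot> a) \<odot> x \<odot> (b \<odot> b')" by (simp add: qmul_assoc)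
      then show "\<exists>a\<in>?O. \<exists>b\<in>?O. y = a \<odot> x \<odot> b"
        using O(6)[OF T_O[OF a'b'(1)] ab(1)] O(6)[OF ab(2) T_O[OF a'b'(2)]] by blast
    next
      assume "\<exists>a\<in>?O. \<exists>b\<in>?O. y = a \<odot> x \<odot> b"
      then show "f y \<in> {f x, qswap (f x), qconj2 (f x), qconj2 (qswap (f x))}" using orbit x by blast
    qed
    finally show ?thesis .
  qed
  ultimately have "bicoset_orbit_map S3 ?O (\<lambda>x. quat_vec (g x))" by (rule bicoset_orbit_map_S3)
  then show ?thesis
    using carries_bicoset_structure_unit_quat_group[OF unit_quat_group_vertex_group[OF finite_binary_octahedral]
      Hausdorff_S3] assms
    unfolding octahedral_rotation_group_def rotational_symmetries_octahedron by blast
qed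

section \<open>The binary icosahedral group\<close>

abbreviation gr :: real where "gr \<equiv> golden_ratio"

lemma golden_ratio_square: "gr * gr = gr + 1" "gr * (gr * x) = gr * x + x"
proof -
  show "gr * gr = gr + 1" by (simp add: golden_ratio_def field_simps)
  then show "gr * (gr * x) = gr * x + x" by (metis distrib_right mult.assoc mult_1)
qed

text \<open>Signs of numbers \<open>p + q \<phi>\<close> with golden ratio \<open>\<phi>\<close> and small rational \<open>p, q\<close> are decided by these
  bounds.\<close>

lemma golden_ratio_bounds: "1.6 < gr" "gr < 1.62"
proof -
  have "2.2 < sqrt 5" by (rule real_less_rsqrt) (simp add: power2_eq_square)
  moreover have "sqrt 5 < 2.24" by (rule real_less_lsqrt) (simp_all add: power2_eq_square)
  ultimately show "1.6 < gr" "gr < 1.62" by (simp_all add: golden_ratio_def)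
qed

definition icosa_vertices :: "(real^3) set" where
  "icosa_vertices = (\<Union>s\<in>{1, -1}. \<Union>t\<in>{gr, - gr}.
     {vector [0, s, t], vector [s, t, 0], vector [t, 0, s]})"

abbreviation bin_icosa :: "quat set" where "bin_icosa \<equiv> vertex_group icosa_vertices"

lemma icosa_vertices_explicit: "icosa_vertices =
  {vector [0, 1, gr], vector [1, gr, 0], vector [gr, 0, 1],
   vector [0, 1, - gr], vector [1, - gr, 0], vector [- gr, 0, 1],
   vector [0, -1, gr], vector [-1, gr, 0], vector [gr, 0, -1],
   vector [0, -1, - gr], vector [-1, - gr, 0], vector [- gr, 0, -1]}"
  unfolding icosa_vertices_def by auto

lemma finite_icosa_vertices: "finite icosa_vertices"
  by (simp add: icosa_vertices_explicit)

lemma rot_klein: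
  "rot (quat4 1 0 0 0) *v vector [x, y, z] = vector [x, y, z]"
  "rot (quat4 0 1 0 0) *v vector [x, y, z] = vector [x, - y, - z]"
  "rot (quat4 0 0 1 0) *v vector [x, y, z] = vector [- x, y, - z]"
  "rot (quat4 0 0 0 1) *v vector [x, y, z] = vector [- x, - y, z]"
  by (simp_all add: rot_quat4)

lemma rot_three_fold:
  "rot (quat4 (1/2) (1/2) (1/2) (1/2)) *v vector [x, y, z] = vector [z, x, y]"
  "rot (quat4 (- (1/2)) (1/2) (1/2) (1/2)) *v vector [x, y, z] = vector [y, z, x]"
  by (simp_all add: rot_quat4 power2_eq_square)

lemma klein_units_icosa: "t \<in> klein_units \<Longrightarrow> t \<in> bin_icosa"
  by (rule vertex_groupI[OF finite_icosa_vertices klein_units_norm])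
    (auto simp: klein_units_def icosa_vertices_explicit rot_klein)

lemma three_fold_icosa: "m \<in> three_fold \<Longrightarrow> m \<in> bin_icosa"
  by (rule vertex_groupI[OF finite_icosa_vertices three_fold_norm])
    (auto simp: three_fold_def icosa_vertices_explicit rot_klein rot_three_fold)

text \<open>The powers of \<open>\<phi>/2 + ((\<phi> - 1) j + k)/2\<close>, which represent modulo sign the rotations about the vertex
  \<open>(0, 1, \<phi>)\<close>.\<close>

definition five_fold :: "quat set" where
  "five_fold = {quat4 1 0 0 0, quat4 (gr/2) 0 ((gr-1)/2) (1/2), quat4 ((gr-1)/2) 0 (1/2) (gr/2),
     quat4 ((1-gr)/2) 0 (1/2) (gr/2), quat4 (-gr/2) 0 ((gr-1)/2) (1/2)}"

lemma five_fold_norm: "m \<in> five_fold \<Longrightarrow> norm m = 1"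
  by (auto simp: five_fold_def norm_quat4 power2_eq_square field_simps golden_ratio_square)

lemma five_fold_vertices:
  "m \<in> five_fold \<Longrightarrow> rot m *v vector [0, 1, gr] = vector [0, 1, gr]"
  "rot (quat4 (gr/2) 0 ((gr-1)/2) (1/2)) *v vector [0, -1, gr] = vector [gr, 0, 1]"
  "rot (quat4 ((gr-1)/2) 0 (1/2) (gr/2)) *v vector [0, -1, gr] = vector [1, gr, 0]"
  "rot (quat4 ((1-gr)/2) 0 (1/2) (gr/2)) *v vector [0, -1, gr] = vector [-1, gr, 0]"
  "rot (quat4 (- (gr/2)) 0 ((gr-1)/2) (1/2)) *v vector [0, -1, gr] = vector [- gr, 0, 1]"
  unfolding five_fold_def
  by (auto simp: rot_quat4 vector_3_eq_iff power2_eq_square field_simps golden_ratio_square)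

lemma icosa_transitive:
  assumes "v \<in> icosa_vertices"
  shows "\<exists>t\<in>klein_units. \<exists>m\<in>three_fold. rot (t \<odot> m) *v vector [0, 1, gr] = v"
  using assms
  by (auto simp: icosa_vertices_explicit klein_units_def three_fold_def rot_qmul
      matrix_vector_mul_assoc[symmetric] rot_klein rot_three_fold vector_3_eq_iff)

lemma icosa_neighbours:
  assumes "v \<in> icosa_vertices" "v \<bullet> vector [0, 1, gr] = gr"
  shows "v \<in> {vector [0, -1, gr], vector [gr, 0, 1], vector [1, gr, 0], vector [-1, gr, 0], vector [- gr, 0, 1]}"
  using assms golden_ratio_bounds
  by (auto simp: icosa_vertices_explicit vector_3_inner golden_ratio_square)

text \<open>The tetrahedral group acts simply transitively on the twelve vertices, and the stabiliser of a
  vertex is determined by the image of one of its five neighbours. Dividing out both leaves a rotation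
  that fixes two independent vectors.\<close>

lemma binary_icosahedral_elements:
  assumes q: "q \<in> bin_icosa"
  shows "\<exists>t\<in>klein_units. \<exists>m\<in>three_fold. \<exists>z\<in>five_fold. q = t \<odot> m \<odot> z \<or> q = - (t \<odot> m \<odot> z)"
proof -
  have "rot q *v vector [0, 1, gr] \<in> icosa_vertices"
    using vertex_groupD(2)[OF q] by (simp add: icosa_vertices_explicit)
  then obtain t m where tm: "t \<in> klein_units" "m \<in> three_fold"
      "rot (t \<odot> m) *v vector [0, 1, gr] = rot q *v vector [0, 1, gr]"
    using icosa_transitive by blast
  have p: "t \<odot> m \<in> bin_icosa"
    using vertex_group_closed(2)[OF klein_units_icosa[OF tm(1)] three_fold_icosa[OF tm(2)]] .
  note np = vertex_groupD(1)[OF p]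
  define r where "r = qcnj (t \<odot> m) \<odot> q"
  have r: "r \<in> bin_icosa"
    unfolding r_def using vertex_group_closed(2,3) p q by blast
  note nr = vertex_groupD(1)[OF r]
  have r0: "rot r *v vector [0, 1, gr] = vector [0, 1, gr]"
    unfolding r_def by (rule vertex_group_left_quotient[OF np tm(3)])
  have "rot r *v vector [0, -1, gr] \<in> icosa_vertices"
    using vertex_groupD(2)[OF r] by (simp add: icosa_vertices_explicit)
  moreover have "(rot r *v vector [0, -1, gr]) \<bullet> vector [0, 1, gr] = gr"
    using inner_rot[OF nr, of "vector [0, -1, gr]" "vector [0, 1, gr]"] r0
    by (simp add: vector_3_inner golden_ratio_square)
  ultimately have "rot r *v vector [0, -1, gr] \<in>
      {vector [0, -1, gr], vector [gr, 0, 1], vector [1, gr, 0], vector [-1, gr, 0], vector [- gr, 0, 1]}"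
    by (rule icosa_neighbours)
  moreover have "\<exists>z\<in>five_fold. rot z *v vector [0, -1, gr] = v"
    if "v \<in> {vector [0, -1, gr], vector [gr, 0, 1], vector [1, gr, 0], vector [-1, gr, 0], vector [- gr, 0, 1]}" for v
    using that by (auto simp: five_fold_def five_fold_vertices rot_klein)
  ultimately obtain z where z: "z \<in> five_fold" "rot z *v vector [0, -1, gr] = rot r *v vector [0, -1, gr]"
    by blast
  note nz = five_fold_norm[OF z(1)]
  have "qcnj z \<odot> r = qone \<or> qcnj z \<odot> r = - qone"
  proof (rule fixes_two_vectors)
    show "norm (qcnj z \<odot> r) = 1" using nz nr by (simp add: norm_qmul)
    show "rot (qcnj z \<odot> r) *v vector [0, 1, gr] = vector [0, 1, gr]"
      by (rule vertex_group_left_quotient[OF nz]) (simp add: r0 five_fold_vertices(1)[OF z(1)])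
    show "rot (qcnj z \<odot> r) *v vector [0, -1, gr] = vector [0, -1, gr]"
      by (rule vertex_group_left_quotient[OF nz z(2)])
  qed (use golden_ratio_bounds in auto)
  then have "r = z \<or> r = - z" using left_quotient_sign[OF nz, of r qone] by simp
  then have "q = t \<odot> m \<odot> z \<or> q = - (t \<odot> m \<odot> z)" unfolding r_def by (rule left_quotient_sign[OF np])
  then show ?thesis using tm z(1) by blast
qed

lemma finite_binary_icosahedral: "finite (bin_icosa)"
proof -
  let ?L = "(\<lambda>(t, m, z). t \<odot> m \<odot> z) ` (klein_units \<times> three_fold \<times> five_fold)"
  have "bin_icosa \<subseteq> ?L \<union> uminus ` ?L"
  proof
    fix q assume "q \<in> bin_icosa"
    then obtain t m z where "t \<in> klein_units" "m \<in> three_fold" "z \<in> five_fold"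
      and q: "q = t \<odot> m \<odot> z \<or> q = - (t \<odot> m \<odot> z)"
      using binary_icosahedral_elements by blast
    then have "t \<odot> m \<odot> z \<in> ?L" by (intro image_eqI[of _ _ "(t, m, z)"]) simp_all
    then show "q \<in> ?L \<union> uminus ` ?L" using q by blast
  qed
  moreover have "finite ?L" by (simp add: klein_units_def three_fold_def five_fold_def)
  ultimately show ?thesis by (meson finite_Un finite_imageI finite_subset)
qed

section \<open>The root system of type H4\<close>

text \<open>The Dynkin diagram is the chain 1, 2, 3, 4, in which the roots 1 and 2 enclose an angle of 144
  degrees and the other neighbours an angle of 120 degrees. So it has no symmetries.\<close>

definition h4_roots :: "quat^4" where
  "h4_roots = vector [quat4 0 1 0 0, quat4 0 (-gr/2) (-1/2) ((1-gr)/2), quat4 0 0 1 0,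
     quat4 ((gr-1)/2) 0 (-1/2) (gr/2)]"

text \<open>The edges of the chamber, up to scaling: each is orthogonal to all simple roots but one.\<close>

definition h4_weights :: "quat^4" where
  "h4_weights = vector [quat4 (3 * gr + 2) 1 0 (- gr - 1), quat4 (gr + 1) 0 0 (-1),
     quat4 (3 * gr + 1) 0 1 (- gr), quat4 1 0 0 0]"

lemma h4_roots_mem: "h4_roots $ i \<in> bin_icosa"
proof -
  have r2: "rot (h4_roots $ 2) *v vector [x, y, z] =
      vector [((gr-1) * x + gr * y + z) / 2, (gr * x - y + (gr-1) * z) / 2, (x + (gr-1) * y - gr * z) / 2]" for x y z
    by (simp add: h4_roots_def rot_quat4 vector_3_eq_iff power2_eq_square field_simps golden_ratio_square)
  have r4: "rot (h4_roots $ 4) *v vector [x, y, z] =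
      vector [(- gr * x - y + (1-gr) * z) / 2, (x + (1-gr) * y - gr * z) / 2, ((gr-1) * x - gr * y + z) / 2]" for x y z
    by (simp add: h4_roots_def rot_quat4 vector_3_eq_iff power2_eq_square field_simps golden_ratio_square)
  have n: "norm (h4_roots $ 2) = 1" "norm (h4_roots $ 4) = 1"
    by (simp_all add: h4_roots_def norm_quat4 power2_eq_square field_simps golden_ratio_square)
  have k: "h4_roots $ 1 \<in> bin_icosa" "h4_roots $ 3 \<in> bin_icosa"
    by (rule klein_units_icosa; simp add: h4_roots_def klein_units_def)+
  have m2: "h4_roots $ 2 \<in> bin_icosa"
    by (rule vertex_groupI[OF finite_icosa_vertices n(1)])
      (auto simp: icosa_vertices_explicit r2 vector_3_eq_iff algebra_simps golden_ratio_square)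
  have m4: "h4_roots $ 4 \<in> bin_icosa"
    by (rule vertex_groupI[OF finite_icosa_vertices n(2)])
      (auto simp: icosa_vertices_explicit r4 vector_3_eq_iff algebra_simps golden_ratio_square)
  show ?thesis using exhaust_4[of i] k m2 m4 by auto
qed

lemma h4_sign:
  assumes "\<beta> \<in> bin_icosa"
  shows "weakly_signed h4_weights \<beta>"
proof -
  have "weakly_signed h4_weights (t \<odot> m \<odot> z)"
    if "t \<in> klein_units" "m \<in> three_fold" "z \<in> five_fold" for t m z
    using that golden_ratio_bounds unfolding weakly_signed_def forall_4 h4_weights_def vector_4
      klein_units_def three_fold_def five_fold_def
    by (elim insertE emptyE; simp add: quat4_mult quat4_simps algebra_simps golden_ratio_square
        add_divide_distrib diff_divide_distrib; linarith)
  then show ?thesis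
    using binary_icosahedral_elements[OF assms] weakly_signed_minus by metis
qed

text \<open>All roots are of one class here, so that the second sign is always \<open>1\<close> and the first one is the
  determinant. The fold by even sign changes loses it on each of the four walls.\<close>

interpretation H4: quat_chamber "bin_icosa" "\<lambda>_. 1" "\<lambda>i. h4_roots $ i" "\<lambda>i. h4_weights $ i" even_sign_fold
proof
  note vals = h4_roots_def h4_weights_def quat4_simps
  note b = golden_ratio_bounds
  show "unit_quat_group (bin_icosa)"
    by (rule unit_quat_group_vertex_group[OF finite_binary_icosahedral])
  show "h4_roots $ i \<in> bin_icosa" for i by (rule h4_roots_mem)
  show "h4_roots $ i \<bullet> h4_weights $ j = 0" if "i \<noteq> j" for i j
    using that by (cases i rule: exhaust_4_cases; cases j rule: exhaust_4_cases)
      (simp_all add: vals field_simps golden_ratio_square)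
  show "h4_roots $ i \<bullet> h4_weights $ i > 0" for i
    using b by (cases i rule: exhaust_4_cases) (simp_all add: vals field_simps golden_ratio_square)
  show "x = 0" if x: "\<And>i. x \<bullet> h4_roots $ i = 0" for x
  proof -
    obtain p q r s where q: "x = quat4 p q r s" by (rule quat4_surj)
    have "q = 0" "r = 0" using x[of 1] x[of 3] by (simp_all add: vals q)
    moreover from this have "s = 0" using x[of 2] b by (simp add: vals q)
    moreover from this have "p = 0" using x[of 4] b \<open>r = 0\<close> by (simp add: vals q)
    ultimately show ?thesis by (simp add: q quat4_def zero_prod_def complex_eq_iff)
  qed
  show "(\<forall>i. \<beta> \<bullet> h4_weights $ i \<ge> 0) \<or> (\<forall>i. \<beta> \<bullet> h4_weights $ i \<le> 0)"
    if "\<beta> \<in> bin_icosa" for \<beta>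
    using h4_sign[OF that] by (simp add: weakly_signed_def)
  show "\<pi> k = k" if g: "\<And>i j. h4_roots $ \<pi> i \<bullet> h4_roots $ \<pi> j = h4_roots $ i \<bullet> h4_roots $ j" for \<pi> k
  proof -
    have gram: "h4_roots $ 1 \<bullet> h4_roots $ 1 = 1" "h4_roots $ 2 \<bullet> h4_roots $ 2 = 1"
      "h4_roots $ 3 \<bullet> h4_roots $ 3 = 1" "h4_roots $ 4 \<bullet> h4_roots $ 4 = 1"
      "h4_roots $ 1 \<bullet> h4_roots $ 2 = - gr / 2" "h4_roots $ 2 \<bullet> h4_roots $ 1 = - gr / 2"
      "h4_roots $ 2 \<bullet> h4_roots $ 3 = - 1 / 2" "h4_roots $ 3 \<bullet> h4_roots $ 2 = - 1 / 2"
      "h4_roots $ 3 \<bullet> h4_roots $ 4 = - 1 / 2" "h4_roots $ 4 \<bullet> h4_roots $ 3 = - 1 / 2"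
      "h4_roots $ 1 \<bullet> h4_roots $ 3 = 0" "h4_roots $ 3 \<bullet> h4_roots $ 1 = 0"
      "h4_roots $ 1 \<bullet> h4_roots $ 4 = 0" "h4_roots $ 4 \<bullet> h4_roots $ 1 = 0"
      "h4_roots $ 2 \<bullet> h4_roots $ 4 = 0" "h4_roots $ 4 \<bullet> h4_roots $ 2 = 0"
      by (simp_all add: vals field_simps golden_ratio_square)
    have ne: "gr \<noteq> 1" "gr \<noteq> 0" "gr \<noteq> - 2" "- gr / 2 \<noteq> 1" "- gr / 2 \<noteq> 0" "- gr / 2 \<noteq> - 1 / 2" using b by auto
    have 12: "\<pi> 1 = 1 \<and> \<pi> 2 = 2 \<or> \<pi> 1 = 2 \<and> \<pi> 2 = 1"
      using g[of 1 2] ne by (cases "\<pi> 1" rule: exhaust_4_cases; cases "\<pi> 2" rule: exhaust_4_cases) (simp_all add: gram)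
    have "\<pi> 1 = 1 \<and> \<pi> 2 = 2 \<and> \<pi> 3 = 3"
      using 12 g[of 2 3] ne by (cases "\<pi> 3" rule: exhaust_4_cases) (auto simp: gram)
    moreover from this have "\<pi> 4 = 4"
      using g[of 3 4] g[of 2 4] ne by (cases "\<pi> 4" rule: exhaust_4_cases) (auto simp: gram)
    ultimately show ?thesis using exhaust_4[of k] by auto
  qed
  show "norm_onto_map even_sign_fold" by (rule norm_onto_map_even_sign_fold)
  show "even_sign_fold (r *\<^sub>R x) = r *\<^sub>R even_sign_fold x" if "r > 0" for r x
    using that by (rule even_sign_fold_scaleR)
  show "even_sign_fold (signed_coords (- 1 * s) (1 * t) l) = even_sign_fold (signed_coords s t l)"
    if "s = 1 \<or> s = - 1" "t \<in> (\<lambda>_. 1) ` bin_icosa" "l i = 0" for s t l i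
    using that(2,3) even_sign_fold_flip[of "s * l 1" "l 2" "l 3" "l 4"]
    by (cases i rule: exhaust_4_cases) (auto simp: signed_coords_def)
  show "l = l' \<and> (s' = s \<and> t' = t \<or> (\<exists>i. l i = 0 \<and> s' = - 1 * s \<and> t' = 1 * t) \<or>
      (\<exists>i j. l i = 0 \<and> l j = 0 \<and> s' = 1 * 1 * s \<and> t' = 1 * 1 * t))"
    if st: "s = 1 \<or> s = - 1" "s' = 1 \<or> s' = - 1" "t \<in> (\<lambda>_. 1) ` bin_icosa"
      "t' \<in> (\<lambda>_. 1) ` bin_icosa" and l: "\<And>i. l i \<ge> 0" "\<And>i. l' i \<ge> 0"
      and eq: "even_sign_fold (signed_coords s t l) = even_sign_fold (signed_coords s' t' l')" for s s' t t' l l'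
  proof -
    have t: "t = 1" "t' = 1" using st(3,4) by auto
    have "l 1 = l' 1 \<and> l 2 = l' 2 \<and> l 3 = l' 3 \<and> l 4 = l' 4 \<and>
        (s' = s \<or> s' = - s \<and> (l 1 = 0 \<or> l 2 = 0 \<or> l 3 = 0 \<or> l 4 = 0))"
      by (rule even_sign_fold_separates) (use st(1,2) l eq in \<open>auto simp: signed_coords_def t\<close>)
    then have "\<forall>i. l i = l' i" "s' = s \<or> s' = - s \<and> (\<exists>i. l i = 0)" unfolding forall_4 by blast+
    then show ?thesis by (auto simp: t)
  qed
  show "\<exists>s t l. (s = 1 \<or> s = - 1) \<and> t \<in> (\<lambda>_. 1) ` bin_icosa \<and> (\<forall>i. l i \<ge> 0) \<and>
      even_sign_fold z = even_sign_fold (signed_coords s t l)" for z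
  proof -
    obtain s a b c d where s: "s = 1 \<or> s = - 1" "a \<ge> 0" "b \<ge> 0" "c \<ge> 0" "d \<ge> 0"
        "even_sign_fold z = even_sign_fold (Complex (s * a) b, Complex c d)"
      using even_sign_fold_cover by blast
    define l where "l i = (vector [a, b, c, d] :: real^4) $ i" for i
    have "\<forall>i. l i \<ge> 0" unfolding forall_4 using s by (simp add: l_def)
    moreover have "even_sign_fold z = even_sign_fold (signed_coords s 1 l)"
      using s(6) by (simp add: signed_coords_def l_def)
    moreover have "1 \<in> (\<lambda>_. 1) ` bin_icosa" using vertex_group_closed(1) by blast
    ultimately show ?thesis using s(1) by blast
  qed
qed simp_all

section \<open>The icosahedral group and the theorem\<close>

lemma rotational_symmetries_icosahedron:
  "rotational_symmetries regular_icosahedron = rot ` bin_icosa"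
  unfolding rot_vertex_group regular_icosahedron_def icosa_vertices_def[symmetric]
  by (rule rotational_symmetries_convex_hull[where r = "sqrt (1 + gr\<^sup>2)", OF finite_icosa_vertices])
    (auto simp: icosa_vertices_explicit norm_vector_3 add.commute)

text \<open>The maps \<open>x \<mapsto> a x b\<close> are exactly the orientation preserving elements of the reflection group.\<close>

lemma icosahedral_carries:
  assumes "icosahedral_rotation_group G"
  shows "carries_bicoset_structure S3 G"
proof -
  let ?I = "bin_icosa"
  obtain f :: "quat \<Rightarrow> quat" where f: "continuous_on (sphere 0 1) f" "f ` sphere 0 1 = sphere 0 1"
    and fib: "\<forall>x\<in>sphere 0 1. \<forall>y\<in>sphere 0 1. f x = f y \<longleftrightarrow>
      (\<exists>a\<in>{a\<in>?I. (1::real) = 1}. \<exists>b\<in>{a\<in>?I. (1::real) = 1}. y = a \<odot> x \<odot> b)"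
    using H4.chamber_orbit_map by blast
  have "bicoset_orbit_map S3 ?I (\<lambda>x. quat_vec (f x))"
    by (rule bicoset_orbit_map_S3[OF f]) (use fib in simp)
  then show ?thesis
    using carries_bicoset_structure_unit_quat_group[OF unit_quat_group_vertex_group[OF finite_binary_icosahedral]
      Hausdorff_S3] assms
    unfolding icosahedral_rotation_group_def rotational_symmetries_icosahedron by blast
qed

theorem proposition3p2:
  fixes G :: "(real^3^3) set"
  shows
    "(dihedral_rotation_group 2 G \<or> dihedral_rotation_group 4 G \<or> dihedral_rotation_group 6 G \<or>
      tetrahedral_rotation_group G \<or> octahedral_rotation_group G \<or> icosahedral_rotation_group G
        \<longrightarrow> carries_bicoset_structure S3 G) \<and>
     (cyclic_rotation_group 2 G \<or> cyclic_rotation_group 3 G \<or> cyclic_rotation_group 4 G \<or>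
      cyclic_rotation_group 6 G \<or> dihedral_rotation_group 3 G
        \<longrightarrow> carries_bicoset_structure RP3 G)"
proof (intro conjI impI)
  assume "dihedral_rotation_group 2 G \<or> dihedral_rotation_group 4 G \<or> dihedral_rotation_group 6 G \<or>
      tetrahedral_rotation_group G \<or> octahedral_rotation_group G \<or> icosahedral_rotation_group G"
  then show "carries_bicoset_structure S3 G"
    using dihedral_even_carries[of 2 G] dihedral_even_carries[of 4 G] dihedral_even_carries[of 6 G]
      tetrahedral_carries octahedral_carries icosahedral_carries by auto
next
  assume "cyclic_rotation_group 2 G \<or> cyclic_rotation_group 3 G \<or> cyclic_rotation_group 4 G \<or>
      cyclic_rotation_group 6 G \<or> dihedral_rotation_group 3 G"
  then show "carries_bicoset_structure RP3 G"
    using cyclic_carries[of 2 G] cyclic_carries[of 3 G] cyclic_carries[of 4 G] cyclic_carries[of 6 G]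
      dihedral_odd_carries[of 3 G] by auto
qed

end
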